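(* Let $\mathcal V$ be a height function potential with dual spin potential $\mathcal U$. Let $\mu$ be any subsequential weak limit, as $N\to\infty$, of the spin measures $\mu_{\mathbb T_N,\Diamond}$ on the tori $\mathbb T_N=(\mathbb Z/2^N\mathbb Z)^2$, and let $\nu$ be the limit of the height measures $\nu_{\mathbb T_N,\star}$ along the same subsequence (which exists). If $$\sup_{v\in\mathbb Z^2}\nu[(h_v-h_{\mathbf 0})^2]=\infty,$$ then $$\sum_{i=1}^\infty i\,\big|\mu[\mathcal U'(J_0)\,\mathcal U'(J_i)]\big|=\infty .$$ In particular, the two-point function $\mu[\mathcal U'(J_0)\mathcal U'(J_i)]$ does not decay exponentially fast as $i\to\infty$.
   Context: $\mathbb S=\{z\in\mathbb C:|z|=1\}$ is identified with $\mathbb R/2\pi\mathbb Z$ and written additively. For a graph and $\mathbb G\in\{\mathbb Z,\mathbb S\}$, a 1-form is an antisymmetric $\mathbb G$-valued function on directed edges (equivalently, after fixing one orientation per edge, a function on edges). $\mathrm df_{xy}=f_y-f_x$, $\mathrm d^*\omega_x=\sum_{y\sim x}\omega_{yx}$; $H_\star(\mathbb G)=\mathrm{Im}(\mathrm d)$, $H_\Diamond(\mathbb G)=\ker(\mathrm d^* )$. Potentials: $\mathcal V:\mathbb Z\to\mathbb R\cup\{+\infty\}$ is a height function potential if $\mathcal V(n)=\mathcal V(-n)$, $\sum_{n\in\mathbb Z}n^2e^{-\mathcal V(n)}<\infty$, and $w(\alpha):=e^{-\mathcal V(0)}+\sum_{n\ge1}2e^{-\mathcal V(n)}\cos(n\alpha)>0$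 for all $\alpha$. Its dual spin potential is $\mathcal U=-\log w$ (even, $2\pi$-periodic, $C^2$). Measures on a finite graph $G=(V,E)$: $\mu_{G,\Diamond}$ is the probability measure on $H_\Diamond(G,\mathbb S)$ with density $\propto\prod_{e\in E}w(J_e)$ with respect to Haar probability measure; $\nu_{G,\star}$ is the probability measure on $H_\star(G,\mathbb Z)$ with $\nu_{G,\star}(\mathbf n)\propto\exp(-\sum_{e\in E}\mathcal V(\mathbf n_e))$. Limits: the torus $\mathbb T_N$ (nearest-neighbour graph) is identified with a fundamental domain in $\mathbb Z^2$ centred at the origin $\mathbf 0$, and limits are weak limits of the laws restricted to finite sets of edges of $\mathbb Z^2$. $\mu$ is then a measure on $H_\Diamond(\mathbb Z^2,\mathbb S)$ and $\nu$ a measure on $H_\star(\mathbb Z^2,\mathbb Z)$; under $\nu$, $h:\mathbb Z^2\to\mathbb Z$ is the height function with $h_{\mathbf 0}=0$ and $\mathrm dh=\mathbf n$. Both are translation and $\pi/2$-rotation invariant. $J_i=J_{e_i}$, where $e_i$ is the directed horizontal edge from $(i,0)$ to $(i+1,0)$ in $\mathbb Z^2$. *)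

theory Defs
  imports "HOL-Probability.Probability" "HOL-Number_Theory.Cong"
begin

text \<open>
  A simple graph is given by its set \<open>D\<close> of directed edges: a symmetric irreflexive relation
  containing both orientations of every edge. A 1-form is a function on all pairs of vertices
  which takes the neutral value off \<open>D\<close>.
  The circle group is the unit circle of the complex plane, hence is written multiplicatively;
  the angle of \<open>z\<close> is \<open>Arg z\<close>.
\<close>

subsection \<open>One-forms\<close>

definition ext_d :: "('v \<times> 'v) set \<Rightarrow> ('v \<Rightarrow> int) \<Rightarrow> ('v \<times> 'v \<Rightarrow> int)" where
  "ext_d D h = (\<lambda>(x, y). if (x, y) \<in> D then h y - h x else 0)"

definition H_star :: "('v \<times> 'v) set \<Rightarrow> ('v \<times> 'v \<Rightarrow> int) set" where
  "H_star D = range (ext_d D)"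

definition circle_forms :: "('v \<times> 'v) set \<Rightarrow> ('v \<times> 'v \<Rightarrow> complex) set" where
  "circle_forms D = {J. (\<forall>e\<in>D. norm (J e) = 1) \<and> (\<forall>e. e \<notin> D \<longrightarrow> J e = 1)
                      \<and> (\<forall>x y. (x, y) \<in> D \<longrightarrow> J (y, x) = inverse (J (x, y)))}"

definition d_star :: "('v \<times> 'v) set \<Rightarrow> ('v \<times> 'v \<Rightarrow> complex) \<Rightarrow> ('v \<Rightarrow> complex)" where
  "d_star D J x = (\<Prod>y | (y, x) \<in> D. J (y, x))"

definition H_diamond :: "('v \<times> 'v) set \<Rightarrow> ('v \<times> 'v \<Rightarrow> complex) set" where
  "H_diamond D = {J \<in> circle_forms D. \<forall>x. d_star D J x = 1}"

text \<open>
  One orientation per edge, so that sums and products over this set are over undirected edges.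
  The choice is immaterial, as only even functions of 1-forms are summed or multiplied.
\<close>
definition orientation :: "('v::countable \<times> 'v) set \<Rightarrow> ('v \<times> 'v) set" where
  "orientation D = {(x, y) \<in> D. to_nat x < to_nat y}"

subsection \<open>Potentials\<close>

definition exp_neg :: "ereal \<Rightarrow> real" where
  "exp_neg x = (if x = \<infinity> then 0 else exp (- real_of_ereal x))"

definition spin_weight :: "(int \<Rightarrow> ereal) \<Rightarrow> real \<Rightarrow> real" where
  "spin_weight V \<alpha> =
     exp_neg (V 0) + (\<Sum>n. 2 * exp_neg (V (int (Suc n))) * cos (real (Suc n) * \<alpha>))"

definition height_potential :: "(int \<Rightarrow> ereal) \<Rightarrow> bool" where
  "height_potential V \<longleftrightarrow>
     (\<forall>n. V n \<noteq> -\<infinity>) \<and> (\<forall>n. V n = V (- n)) \<and>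
     (\<lambda>n. (real_of_int n)\<^sup>2 * exp_neg (V n)) summable_on UNIV \<and>
     (\<forall>\<alpha>. spin_weight V \<alpha> > 0)"

definition spin_potential :: "(int \<Rightarrow> ereal) \<Rightarrow> real \<Rightarrow> real" where
  "spin_potential V \<alpha> = - ln (spin_weight V \<alpha>)"

subsection \<open>Measures on finite graphs\<close>

text \<open>
  Measures on 1-forms are Borel measures on the full function space (product topology),
  concentrated on the relevant set of 1-forms.
  The Haar probability measure is the unique invariant one.
\<close>
definition haar_diamond :: "('v::countable \<times> 'v) set \<Rightarrow> ('v \<times> 'v \<Rightarrow> complex) measure" where
  "haar_diamond D = (THE m. prob_space m \<and> sets m = sets borel \<and>
     (AE J in m. J \<in> H_diamond D) \<and>
     (\<forall>g\<in>H_diamond D. distr m borel (\<lambda>J e. g e * J e) = m))"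

definition spin_density ::
    "(int \<Rightarrow> ereal) \<Rightarrow> ('v::countable \<times> 'v) set \<Rightarrow> ('v \<times> 'v \<Rightarrow> complex) \<Rightarrow> real" where
  "spin_density V D J = (\<Prod>e\<in>orientation D. spin_weight V (Arg (J e)))"

definition spin_measure ::
    "(int \<Rightarrow> ereal) \<Rightarrow> ('v::countable \<times> 'v) set \<Rightarrow> ('v \<times> 'v \<Rightarrow> complex) measure" where
  "spin_measure V D = density (haar_diamond D)
     (\<lambda>J. ennreal (spin_density V D J / (\<integral>J'. spin_density V D J' \<partial>haar_diamond D)))"

definition height_mass ::
    "(int \<Rightarrow> ereal) \<Rightarrow> ('v::countable \<times> 'v) set \<Rightarrow> ('v \<times> 'v \<Rightarrow> int) \<Rightarrow> real" where
  "height_mass V D n = exp_neg (\<Sum>e\<in>orientation D. V (n e))"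

definition height_measure ::
    "(int \<Rightarrow> ereal) \<Rightarrow> ('v::countable \<times> 'v) set \<Rightarrow> ('v \<times> 'v \<Rightarrow> int) measure" where
  "height_measure V D = distr
     (point_measure (H_star D)
        (\<lambda>n. ennreal (height_mass V D n / (\<Sum>\<^sub>\<infinity>n'\<in>H_star D. height_mass V D n'))))
     borel (\<lambda>n. n)"

subsection \<open>The square lattice, the tori, and limits\<close>

type_synonym point = "int \<times> int"

definition Z2 :: "(point \<times> point) set" where
  "Z2 = {(x, y). \<bar>fst x - fst y\<bar> + \<bar>snd x - snd y\<bar> = 1}"

definition torus_box :: "nat \<Rightarrow> point set" where
  "torus_box N = (let I = {a. - (2 ^ N) \<le> 2 * a \<and> 2 * a < 2 ^ N} in I \<times> I)"

text \<open>
  The vertices of the torus of side \<open>2 ^ N\<close> are represented in the centred fundamental domain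
  \<open>torus_box N\<close>. Loops and multiple edges, which could only occur for \<open>N \<le> 1\<close>, are discarded.
\<close>
definition torus :: "nat \<Rightarrow> (point \<times> point) set" where
  "torus N = {(x, y). x \<in> torus_box N \<and> y \<in> torus_box N \<and> x \<noteq> y \<and>
     (\<exists>z. (x, z) \<in> Z2 \<and> [fst z = fst y] (mod 2 ^ N) \<and> [snd z = snd y] (mod 2 ^ N))}"

text \<open>
  Weak convergence of the laws of the restrictions to finite sets of edges of the square lattice.
  (Such a set consists of edges of \<open>torus N\<close> as soon as \<open>N\<close> is large.)
\<close>
definition local_weak_limit ::
    "(nat \<Rightarrow> (point \<times> point \<Rightarrow> 'a::topological_space) measure) \<Rightarrow>
     (point \<times> point \<Rightarrow> 'a) measure \<Rightarrow> bool" where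
  "local_weak_limit M L \<longleftrightarrow> (\<forall>F f. finite F \<longrightarrow> F \<subseteq> Z2 \<longrightarrow>
     continuous_on UNIV (f :: (point \<times> point \<Rightarrow> 'a) \<Rightarrow> real) \<longrightarrow> bounded (range f) \<longrightarrow>
     (\<lambda>k. \<integral>\<omega>. f (restrict \<omega> F) \<partial>M k) \<longlonglongrightarrow> (\<integral>\<omega>. f (restrict \<omega> F) \<partial>L))"

text \<open>The sequence \<open>r\<close> is the subsequence of sizes along which the limit is taken.\<close>

definition spin_limit ::
    "(int \<Rightarrow> ereal) \<Rightarrow> (nat \<Rightarrow> nat) \<Rightarrow> (point \<times> point \<Rightarrow> complex) measure \<Rightarrow> bool" where
  "spin_limit V r \<mu> \<longleftrightarrow> prob_space \<mu> \<and> sets \<mu> = sets borel \<and>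
     (AE J in \<mu>. J \<in> H_diamond Z2) \<and>
     local_weak_limit (\<lambda>k. spin_measure V (torus (r k))) \<mu>"

definition height_limit ::
    "(int \<Rightarrow> ereal) \<Rightarrow> (nat \<Rightarrow> nat) \<Rightarrow> (point \<times> point \<Rightarrow> int) measure \<Rightarrow> bool" where
  "height_limit V r \<nu> \<longleftrightarrow> prob_space \<nu> \<and> sets \<nu> = sets borel \<and>
     (AE n in \<nu>. n \<in> H_star Z2) \<and>
     local_weak_limit (\<lambda>k. height_measure V (torus (r k))) \<nu>"

definition height_fun :: "(point \<times> point \<Rightarrow> int) \<Rightarrow> point \<Rightarrow> int" where
  "height_fun n = (THE h. h (0, 0) = 0 \<and> ext_d Z2 h = n)"

definition horiz_edge :: "nat \<Rightarrow> point \<times> point" where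
  "horiz_edge i = ((int i, 0), (int i + 1, 0))"

definition two_point ::
    "(int \<Rightarrow> ereal) \<Rightarrow> (point \<times> point \<Rightarrow> complex) measure \<Rightarrow> nat \<Rightarrow> real" where
  "two_point V \<mu> i = (\<integral>J. deriv (spin_potential V) (Arg (J (horiz_edge 0))) *
                           deriv (spin_potential V) (Arg (J (horiz_edge i))) \<partial>\<mu>)"

end

theory Submission imports Defs begin

text \<open>
  Write \<open>c n = exp (- V n)\<close>, so that \<open>w\<close> is the Fourier series with coefficients \<open>c\<close>. On a finite graph the
  characters of the group of coexact circle-valued forms are the integer forms modulo the exact ones;
  expanding a product of Fourier series therefore gives
  \<open>\<nu>[n = a on F] = \<mu>[\<Prod>e\<in>F. c (a e) J_e^(a e) / w (J_e)]\<close> for every finite set \<open>F\<close> of edges. The right-hand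
  side is a bounded continuous local function of \<open>J\<close>, so it passes to the limit: this yields the limit \<open>\<nu>\<close>
  (by the Daniell-Kolmogorov theorem) and the same identity in infinite volume. Summing against \<open>a\<close>,
  \<open>\<nu>[n_e n_f] = - \<mu>[U'(J_e) U'(J_f)]\<close> for distinct edges, and \<open>\<nu>[(\<Sum>e. \<phi> e n_e)^2] \<le> C \<Sum>e. (\<phi> e)^2\<close>, because
  the off-diagonal terms form minus a square on the spin side.

  Let \<open>G k = \<nu>[(h (k, 0) - h (0, 0))^2]\<close> and \<open>a m = \<nu>[n_0 n_m]\<close>. Then \<open>G k = k S k - 2 (\<Sum>0<m<k. m a m)\<close> with
  \<open>S k = a 0 + 2 (\<Sum>0<m<k. a m)\<close>. If \<open>\<Sum>m. m |a m|\<close> is finite, \<open>G\<close> is therefore linear up to a bounded error;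
  but spreading the unit flow from \<open>(0, 0)\<close> to \<open>(k, 0)\<close> shows that \<open>G k = o(k)\<close>. Hence \<open>G\<close> is bounded, and by the
  lattice symmetries so is the variance of all height differences.
\<close>

section \<open>Graphs\<close>

text \<open>The minus sign in the covariance identity is the square of an imaginary unit: since U' =
  -w'/w, summing \<open>n * c n * z^n\<close> over n gives \<open>\<i> * w * U'\<close>, so each
  factor n_e turns into \<open>\<i> * U'(J_e)\<close>. On the diagonal both factors sit on one edge
  and the second Fourier moment of \<open>c\<close> appears instead; there the summability of
  \<open>n^2 * c n\<close> is used in full strength. No mass escapes in the limit of the heights
  because the observables \<open>c a * J^a / w\<close> sum to 1 over a, with a bound that is
  summable in a and uniform in J. The Haar measure is given by a definite description, so its
  existence and uniqueness have to be proved; it is built edge by edge. The bound o(k) averages L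
  detours: their vertical legs cost O(L), while the k * L horizontal edges, each of weight 1 / L,
  cost O(k / L). With L fixed and k growing, the slope of G must tend to 0; once it does,
  \<open>k * S k\<close> is controlled by the tail of the sum of m |a m|.\<close>

definition integer_flow :: "('v \<times> 'v) set \<Rightarrow> ('v \<times> 'v \<Rightarrow> int) \<Rightarrow> bool" where
  "integer_flow D k \<longleftrightarrow> (\<forall>x y. k (x, y) + k (y, x) = 0) \<and> (\<forall>e. e \<notin> D \<longrightarrow> k e = 0)"

text \<open>Unit of flow along one edge: 1 on \<open>e\<close>, -1 on its reversal. As a difference
  of two indicators it vanishes on a loop.\<close>

definition edge_flow :: "'v \<times> 'v \<Rightarrow> 'v \<times> 'v \<Rightarrow> int" where
  "edge_flow e = (\<lambda>d. (if d = e then 1 else 0) - (if d = prod.swap e then 1 else 0))"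

lemma edge_flow_antisym: "edge_flow (x, y) (u, v) + edge_flow (x, y) (v, u) = 0"
  unfolding edge_flow_def
  by (cases "u = x"; cases "v = y"; cases "u = y"; cases "v = x"; simp)

lemma edge_flow_zero:
  assumes "(x, y) \<in> D" "(y, x) \<in> D" "d \<notin> D"
  shows "edge_flow (x, y) d = 0"
proof -
  have "d \<noteq> (x, y)" "d \<noteq> (y, x)" using assms by metis+
  then show ?thesis unfolding edge_flow_def by simp
qed

lemma integer_flow_edge:
  assumes "sym D" "e \<in> D"
  shows "integer_flow D (edge_flow e)"
proof -
  obtain x y where e: "e = (x, y)" by (cases e)
  have "(x, y) \<in> D" "(y, x) \<in> D"
    using assms symD[of D x y] by (simp_all add: e)
  then show ?thesis
    unfolding integer_flow_def e using edge_flow_antisym edge_flow_zero by metis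
qed

lemma integer_flow_add:
  "integer_flow D k \<Longrightarrow> integer_flow D l \<Longrightarrow> integer_flow D (\<lambda>e. k e + l e)"
  unfolding integer_flow_def by (smt (verit))

lemma integer_flow_diff:
  "integer_flow D k \<Longrightarrow> integer_flow D l \<Longrightarrow> integer_flow D (\<lambda>e. k e - l e)"
  unfolding integer_flow_def by (smt (verit))

lemma integer_flow_mono: "integer_flow D k \<Longrightarrow> D \<subseteq> D' \<Longrightarrow> integer_flow D' k"
  unfolding integer_flow_def by blast

lemma sum_edge_flow:
  assumes "finite W" "x \<in> W" "y \<in> W"
  shows "(\<Sum>u\<in>W. edge_flow (x, y) (u, v)) = of_bool (v = y) - of_bool (v = x)"
proof -
  have "(\<Sum>u\<in>W. edge_flow (x, y) (u, v)) =
      (\<Sum>u\<in>W. if u = x then of_bool (v = y) else 0) - (\<Sum>u\<in>W. if u = y then of_bool (v = x) else 0)"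
    by (subst sum_subtractf [symmetric], intro sum.cong) (auto simp: edge_flow_def)
  then show ?thesis
    using assms by simp
qed

text \<open>Superpose \<open>edge_flow\<close> along a path from \<open>x\<close> to
  \<open>y\<close>: the contributions at interior vertices cancel. The column sum over
  \<open>u\<close> is the inflow at \<open>v\<close>.\<close>

lemma flow_between:
  assumes "finite W" "D \<subseteq> W \<times> W" "sym D" "(x, y) \<in> D\<^sup>*"
  obtains k where "integer_flow D k"
    "\<And>v. (\<Sum>u\<in>W. k (u, v)) = of_bool (v = y) - of_bool (v = x)"
proof -
  have "\<exists>k. integer_flow D k \<and> (\<forall>v. (\<Sum>u\<in>W. k (u, v)) = of_bool (v = y) - of_bool (v = x))"
    using assms(4)
  proof (induction rule: rtrancl_induct)
    case base
    show ?case by (intro exI[of _ "\<lambda>_. 0"]) (simp add: integer_flow_def)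
  next
    case (step y z)
    then obtain k where k: "integer_flow D k"
      "\<And>v. (\<Sum>u\<in>W. k (u, v)) = of_bool (v = y) - of_bool (v = x)"
      by blast
    have "y \<in> W" "z \<in> W"
      using step assms by auto
    then show ?case
      using k step.hyps assms
      by (intro exI[of _ "\<lambda>e. k e + edge_flow (y, z) e"])
        (simp add: integer_flow_add integer_flow_edge sum.distrib sum_edge_flow)
  qed
  then show ?thesis
    using that by blast
qed

lemma orientation_iff:
  assumes "irrefl D" "sym D" "(x, y) \<in> D"
  shows "(x, y) \<in> orientation D \<longleftrightarrow> (y, x) \<notin> orientation D"
proof -
  have "x \<noteq> y" "(y, x) \<in> D"
    using assms by (auto simp: irrefl_def dest: symD[of D x y])
  moreover from this have "to_nat x < to_nat y \<or> to_nat y < to_nat x"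
    by (metis from_nat_to_nat nat_neq_iff)
  ultimately show ?thesis
    using assms(3) unfolding orientation_def by auto
qed

lemma orientation_subset: "orientation D \<subseteq> D"
  unfolding orientation_def by blast

lemma finite_orientation: "finite D \<Longrightarrow> finite (orientation D)"
  using finite_subset[OF orientation_subset] .

text \<open>Integrate \<open>n\<close> along a flow from a root of each component. The flow to
  \<open>x\<close>, the edge \<open>(x, y)\<close> and the flow back from \<open>y\<close> form a
  cycle, so \<open>n (x, y)\<close> is the difference of the two integrals.\<close>

lemma exact_if_orthogonal:
  fixes D :: "('v::countable \<times> 'v) set"
  assumes D: "finite W" "D \<subseteq> W \<times> W" "sym D" "irrefl D"
    and orth: "\<And>k. integer_flow D k \<Longrightarrow> (\<forall>v. (\<Sum>u\<in>W. k (u, v)) = 0) \<Longrightarrow>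
      (\<Sum>e\<in>orientation D. n e * k e) = 0"
  shows "\<exists>h. \<forall>e\<in>orientation D. n e = ext_d D h e"
proof -
  \<comment> \<open>The set of admissible roots is the same for all vertices of a component, hence
    \<open>SOME\<close> picks the same root for them.\<close>
  define root where "root x = (SOME r. (r, x) \<in> D\<^sup>*)" for x
  have root: "(root x, x) \<in> D\<^sup>*" for x
    unfolding root_def by (rule someI[of _ x]) simp
  have symD: "sym (D\<^sup>*)"
    using D(3) by (rule sym_rtrancl)
  have root_eq: "root x = root y" if "(x, y) \<in> D" for x y
  proof -
    have "(r, x) \<in> D\<^sup>* \<longleftrightarrow> (r, y) \<in> D\<^sup>*" for r
      using that D(3) by (meson rtrancl.rtrancl_into_rtrancl symD symE)
    then show ?thesis by (simp add: root_def)
  qed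
  have "\<exists>k. integer_flow D k \<and>
      (\<forall>v. (\<Sum>u\<in>W. k (u, v)) = of_bool (v = x) - of_bool (v = root x))" for x
    using flow_between[OF D(1-3) root[of x]] by metis
  then obtain kf where kf: "\<And>x. integer_flow D (kf x)"
      "\<And>x v. (\<Sum>u\<in>W. kf x (u, v)) = of_bool (v = x) - of_bool (v = root x)"
    by metis
  define h where "h x = (\<Sum>e\<in>orientation D. n e * kf x e)" for x
  have fin: "finite (orientation D)"
    using D(1,2) by (intro finite_orientation finite_subset[of D "W \<times> W"]) simp_all
  have "n (x, y) = h y - h x" if e: "(x, y) \<in> orientation D" for x y
  proof -
    have xy: "(x, y) \<in> D" "(y, x) \<notin> orientation D" "x \<in> W" "y \<in> W"
    proof -
      show xy: "(x, y) \<in> D" using e orientation_subset by blast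
      then show "(y, x) \<notin> orientation D" using orientation_iff[OF D(4,3)] e by blast
      show "x \<in> W" "y \<in> W" using xy D(2) by blast+
    qed
    have "(\<Sum>e\<in>orientation D. n e * (kf x e + edge_flow (x, y) e - kf y e)) = 0"
    proof (rule orth)
      show "integer_flow D (\<lambda>e. kf x e + edge_flow (x, y) e - kf y e)"
        using D(3) xy(1) by (intro integer_flow_add integer_flow_diff integer_flow_edge kf)
      show "\<forall>v. (\<Sum>u\<in>W. kf x (u, v) + edge_flow (x, y) (u, v) - kf y (u, v)) = 0"
        using D(1) xy by (simp add: sum.distrib sum_subtractf kf(2) sum_edge_flow root_eq[OF xy(1)])
    qed
    \<comment> \<open>Of the two orientations of the edge only \<open>(x, y)\<close> lies in the
      range of summation, so the edge contributes \<open>n (x, y)\<close> once.\<close>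
    moreover have "(\<Sum>e\<in>orientation D. n e * edge_flow (x, y) e) =
        (\<Sum>e\<in>orientation D. if e = (x, y) then n e else 0)"
    proof (intro sum.cong refl)
      fix d assume "d \<in> orientation D"
      then have "d \<noteq> (y, x)" using xy by metis
      moreover have "x \<noteq> y" using xy D(4) by (auto simp: irrefl_def)
      ultimately show "n d * edge_flow (x, y) d = (if d = (x, y) then n d else 0)"
        unfolding edge_flow_def by simp
    qed
    ultimately show ?thesis
      using fin e by (simp add: h_def algebra_simps sum.distrib sum_subtractf)
  qed
  then show ?thesis
    by (intro exI[of _ h]) (auto simp: ext_d_def orientation_def)
qed

section \<open>Coclosed circle-valued forms and summation by parts\<close>

lemma d_star_eq_prod:
  assumes "finite W" "D \<subseteq> W \<times> W" "\<And>e. e \<notin> D \<Longrightarrow> J e = 1"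
  shows "d_star D J v = (\<Prod>u\<in>W. J (u, v))"
  unfolding d_star_def using assms by (intro prod.mono_neutral_left) auto

lemma circle_formsD:
  assumes "J \<in> circle_forms D"
  shows "norm (J e) = 1" "e \<notin> D \<Longrightarrow> J e = 1" "sym D \<Longrightarrow> J (y, x) = inverse (J (x, y))"
proof -
  have J: "\<And>e. e \<in> D \<Longrightarrow> norm (J e) = 1" "\<And>e. e \<notin> D \<Longrightarrow> J e = 1"
    "\<And>x y. (x, y) \<in> D \<Longrightarrow> J (y, x) = inverse (J (x, y))"
    using assms by (auto simp: circle_forms_def)
  show "norm (J e) = 1" by (cases "e \<in> D") (simp_all add: J)
  show "J e = 1" if "e \<notin> D" using J that by blast
  show "J (y, x) = inverse (J (x, y))" if "sym D"
  proof (cases "(x, y) \<in> D")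
    case False
    then have "(y, x) \<notin> D" using that by (blast dest: symD)
    with False show ?thesis by (simp add: J)
  qed (rule J)
qed

lemma power_int_sum:
  fixes z :: "'a::field"
  assumes "z \<noteq> 0"
  shows "z powi (\<Sum>x\<in>A. f x) = (\<Prod>x\<in>A. z powi f x)"
  using assms by (induction A rule: infinite_finite_induct) (auto simp: power_int_add)

lemma prod_power_int:
  fixes f :: "'b \<Rightarrow> 'a::field"
  shows "(\<Prod>x\<in>A. f x) powi n = (\<Prod>x\<in>A. f x powi n)"
  by (induction A rule: infinite_finite_induct) (auto simp: power_int_mult_distrib)

text \<open>Every divergence-free integer flow yields a one-parameter subgroup of coclosed forms;
  these supply the translations that are tested against Haar measure.\<close>

lemma cycle_in_H_diamond:
  fixes D :: "('v \<times> 'v) set"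
  assumes D: "finite W" "D \<subseteq> W \<times> W"
    and k: "integer_flow D k" "\<And>v. (\<Sum>u\<in>W. k (u, v)) = 0"
    and z: "norm (z::complex) = 1"
  shows "(\<lambda>e. z powi k e) \<in> H_diamond D"
proof -
  have "z \<noteq> 0" using z by auto
  have div: "(\<Prod>u\<in>W. z powi k (u, v)) = 1" for v
    using k(2)[of v] power_int_sum[OF \<open>z \<noteq> 0\<close>, of "\<lambda>u. k (u, v)" W] by simp
  have inv: "z powi k (y, x) = inverse (z powi k (x, y))" for x y
  proof -
    have "k (y, x) = - k (x, y)"
      using k(1) unfolding integer_flow_def by (metis add_eq_0_iff)
    then show ?thesis by (simp add: power_int_minus)
  qed
  have off: "z powi k e = 1" if "e \<notin> D" for e
  proof -
    have "k e = 0" using k(1) that unfolding integer_flow_def by blast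
    then show ?thesis by simp
  qed
  have "(\<lambda>e. z powi k e) \<in> circle_forms D"
    unfolding circle_forms_def mem_Collect_eq
    by (intro conjI ballI allI impI off inv) (simp_all add: z norm_power_int)
  moreover have "d_star D (\<lambda>e. z powi k e) v = 1" for v
    using div off by (subst d_star_eq_prod[OF D]) blast+
  ultimately show ?thesis
    unfolding H_diamond_def by blast
qed

text \<open>Summation by parts, written multiplicatively: an edge contributes the power
  \<open>h y\<close> of its spin at the head and \<open>- h x\<close> at the tail, and the latter is
  the head contribution of the reversed edge. Regrouping by heads produces \<open>d_star\<close>
  raised to the power \<open>h v\<close>.\<close>

lemma H_diamond_exact:
  fixes D :: "('v::countable \<times> 'v) set"
  assumes D: "finite D" "sym D" "irrefl D" and J: "J \<in> H_diamond D"
  shows "(\<Prod>e\<in>orientation D. J e powi ext_d D h e) = 1"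
proof -
  define W where "W = fst ` D \<union> snd ` D"
  have W: "finite W" "D \<subseteq> W \<times> W"
    using D(1) by (force simp: W_def)+
  have Jc: "J \<in> circle_forms D" and d: "d_star D J x = 1" for x
    using J by (auto simp: H_diamond_def)
  note J1 = circle_formsD[OF Jc]
  let ?O = "orientation D" and ?g = "\<lambda>e. J e powi h (snd e)"
  have fin: "finite ?O"
    using D(1) by (rule finite_orientation)
  have un: "D = ?O \<union> prod.swap ` ?O"
  proof (intro set_eqI iffI)
    fix e assume "e \<in> D"
    then show "e \<in> ?O \<union> prod.swap ` ?O"
      using orientation_iff[OF D(3,2), of "fst e" "snd e"] by (cases e) (force simp: image_iff)
  next
    fix e assume "e \<in> ?O \<union> prod.swap ` ?O"
    then show "e \<in> D"
      using D(2) unfolding orientation_def sym_def by auto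
  qed
  have "(\<Prod>e\<in>?O. J e powi ext_d D h e) = (\<Prod>e\<in>?O. ?g e * ?g (prod.swap e))"
  proof (intro prod.cong refl)
    fix e assume e: "e \<in> ?O"
    have "J e \<noteq> 0" using J1(1)[of e] by auto
    moreover have "J (prod.swap e) = inverse (J e)"
      using J1(3)[OF D(2), of "snd e" "fst e"] by (cases e) simp
    ultimately show "J e powi ext_d D h e = ?g e * ?g (prod.swap e)"
      using e by (cases e) (simp add: ext_d_def orientation_def power_int_diff
          power_int_inverse divide_inverse)
  qed
  also have "\<dots> = (\<Prod>e\<in>?O. ?g e) * (\<Prod>e\<in>prod.swap ` ?O. ?g e)"
    by (simp add: prod.distrib prod.reindex)
  also have "\<dots> = (\<Prod>e\<in>D. ?g e)"
    using fin by (subst (3) un, subst prod.union_disjoint) (auto simp: orientation_def)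
  also have "\<dots> = (\<Prod>e\<in>W \<times> W. ?g e)"
    using W J1(2) by (intro prod.mono_neutral_left) auto
  also have "\<dots> = (\<Prod>u\<in>W. \<Prod>v\<in>W. ?g (u, v))"
    by (simp add: prod.cartesian_product case_prod_beta)
  also have "\<dots> = (\<Prod>v\<in>W. \<Prod>u\<in>W. ?g (u, v))"
    by (rule prod.swap)
  also have "\<dots> = (\<Prod>v\<in>W. d_star D J v powi h v)"
    using J1(2) by (simp add: d_star_eq_prod[OF W] prod_power_int)
  finally show ?thesis
    by (simp add: d)
qed

text \<open>Pair the form with the coboundary of the indicator of one side of the bridge.\<close>

lemma H_diamond_bridge:
  fixes D :: "('v::countable \<times> 'v) set"
  assumes D: "finite D" "sym D" "irrefl D" and J: "J \<in> H_diamond D"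
    and xy: "(x, y) \<in> D" and bridge: "(x, y) \<notin> (D - {(x, y), (y, x)})\<^sup>*"
  shows "J (x, y) = 1"
proof -
  let ?D = "D - {(x, y), (y, x)}"
  define h where "h v = (of_bool ((x, v) \<in> ?D\<^sup>*) :: int)" for v
  have symD: "sym ?D" using D(2) unfolding sym_def by blast
  have h_eq: "ext_d D h e = 0" if "e \<in> ?D" for e
  proof -
    obtain a b where e: "e = (a, b)" by (cases e)
    then have "(a, b) \<in> ?D" "(b, a) \<in> ?D"
      using that symD unfolding sym_def by blast+
    then have "(x, a) \<in> ?D\<^sup>* \<longleftrightarrow> (x, b) \<in> ?D\<^sup>*"
      by (meson rtrancl.rtrancl_into_rtrancl)
    then show ?thesis by (simp add: e h_def ext_d_def)
  qed
  have h: "h x = 1" "h y = 0"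
    using bridge by (auto simp: h_def)
  have fin: "finite (orientation D)"
    using D(1) by (rule finite_orientation)
  have yx: "(y, x) \<in> D" and ne: "x \<noteq> y"
    using D xy unfolding sym_def irrefl_def by blast+
  have *: "J e powi ext_d D h e = 1" if "e \<in> orientation D" "e \<notin> {(x, y), (y, x)}" for e
    using h_eq[of e] that by (auto simp: orientation_def)
  have inv: "J (y, x) = inverse (J (x, y))"
    using J D circle_formsD(3) by (force simp: H_diamond_def)
  have "1 = (\<Prod>e\<in>orientation D. J e powi ext_d D h e)"
    using H_diamond_exact[OF D J] by simp
  also have "\<dots> = (\<Prod>e\<in>orientation D \<inter> {(x, y), (y, x)}. J e powi ext_d D h e)"
    using * fin by (intro prod.mono_neutral_right) auto
  also have "orientation D \<inter> {(x, y), (y, x)} = {if (x, y) \<in> orientation D then (x, y) else (y, x)}"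
    using orientation_iff[OF D(3,2) xy] by auto
  finally show ?thesis
    using xy yx h inv by (cases "(x, y) \<in> orientation D") (simp_all add: ext_d_def power_int_minus)
qed

section \<open>Haar measure\<close>

text \<open>Needed for the Borel sets of a countable product of integers to be generated by the
  coordinates. The countably many singletons form a base.\<close>

instance int :: second_countable_topology
proof
  let ?B = "range (\<lambda>x::int. {x})"
  have "open A = generate_topology ?B A" for A :: "int set"
  proof -
    have "generate_topology ?B (\<Union>x\<in>A. {x})"
      by (intro generate_topology_Union) (auto intro: generate_topology.Basis)
    moreover have "open A" by (rule discrete_topology_class.open_discrete)
    ultimately show ?thesis by simp
  qed
  then have "open = generate_topology ?B" by (rule ext)
  then show "\<exists>B::int set set. countable B \<and> open = generate_topology B"
    by (intro exI[of _ ?B]) simp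
qed

section \<open>Uniform measure on the circle\<close>

definition circle_measure :: "complex measure" where
  "circle_measure = distr (uniform_measure lborel {0..<1::real}) borel (\<lambda>t. cis (2 * pi * t))"

lemma prob_space_circle_measure: "prob_space circle_measure"
  unfolding circle_measure_def
  by (intro prob_space.prob_space_distr prob_space_uniform_measure) (auto simp: cis_conv_exp)

lemma sets_circle_measure [simp, measurable_cong]: "sets circle_measure = sets borel"
  by (simp add: circle_measure_def)

lemma AE_circle_measure: "AE z in circle_measure. norm z = 1"
  unfolding circle_measure_def by (subst AE_distr_iff) (auto simp: cis_conv_exp)

text \<open>The shifted window \<open>[s, 1 + s)\<close> is cut at 1 and its overhang is moved back
  by one period.\<close>

lemma nn_integral_periodic_shift:
  fixes f :: "real \<Rightarrow> ennreal"
  assumes [measurable]: "f \<in> borel_measurable borel" and per: "\<And>t. f (t + 1) = f t"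
    and s: "0 \<le> s" "s < 1"
  shows "(\<integral>\<^sup>+t. indicator {0..<1} t * f (t + s) \<partial>lborel) = (\<integral>\<^sup>+t. indicator {0..<1} t * f t \<partial>lborel)"
proof -
  have "(\<integral>\<^sup>+t. indicator {0..<1} t * f (t + s) \<partial>lborel) = (\<integral>\<^sup>+t. indicator {s..<1+s} t * f t \<partial>lborel)"
    using nn_integral_real_affine[of "\<lambda>t. indicator {s..<1+s} t * f t" 1 s]
    by (auto simp: indicator_def add.commute intro!: nn_integral_cong)
  also have "\<dots> = (\<integral>\<^sup>+t. indicator {s..<1} t * f t + indicator {1..<1+s} t * f t \<partial>lborel)"
    using s by (intro nn_integral_cong) (auto simp: indicator_def)
  also have "\<dots> = (\<integral>\<^sup>+t. indicator {s..<1} t * f t \<partial>lborel) + (\<integral>\<^sup>+t. indicator {1..<1+s} t * f t \<partial>lborel)"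
    by (rule nn_integral_add) auto
  also have "(\<integral>\<^sup>+t. indicator {1..<1+s} t * f t \<partial>lborel) = (\<integral>\<^sup>+t. indicator {0..<s} t * f t \<partial>lborel)"
    using nn_integral_real_affine[of "\<lambda>t. indicator {1..<1+s} t * f t" 1 1] per
    by (auto simp: indicator_def add.commute intro!: nn_integral_cong)
  also have "(\<integral>\<^sup>+t. indicator {s..<1} t * f t \<partial>lborel) + (\<integral>\<^sup>+t. indicator {0..<s} t * f t \<partial>lborel) =
      (\<integral>\<^sup>+t. indicator {s..<1} t * f t + indicator {0..<s} t * f t \<partial>lborel)"
    by (rule nn_integral_add [symmetric]) auto
  also have "\<dots> = (\<integral>\<^sup>+t. indicator {0..<1} t * f t \<partial>lborel)"
    using s by (intro nn_integral_cong) (auto simp: indicator_def)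
  finally show ?thesis .
qed

lemma circle_measure_rotate:
  assumes u: "norm u = 1"
  shows "distr circle_measure borel (\<lambda>z. u * z) = circle_measure"
proof (rule measure_eqI)
  \<comment> \<open>\<open>Arg\<close> lies in (-pi, pi]; the fractional part brings the angle,
    measured in turns, into [0, 1) as the periodic shift requires.\<close>
  define s where "s = frac (Arg u / (2 * pi))"
  have s: "0 \<le> s" "s < 1"
    by (simp_all add: s_def frac_lt_1)
  have "cis (2 * pi * s) = cis (Arg u) * cis (2 * pi * - of_int \<lfloor>Arg u / (2 * pi)\<rfloor>)"
    unfolding cis_mult s_def frac_def by (simp add: algebra_simps)
  also have "\<dots> = u"
  proof -
    have "cis (2 * pi * - of_int \<lfloor>Arg u / (2 * pi)\<rfloor>) = 1"
      by (rule cis_multiple_2pi) simp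
    moreover have "cis (Arg u) = u"
      using u by (cases "u = 0") (simp_all add: cis_Arg sgn_eq)
    ultimately show ?thesis by simp
  qed
  finally have us: "u = cis (2 * pi * s)" ..
  have [measurable]: "(\<lambda>t. cis (2 * pi * t)) \<in> borel_measurable borel"
    unfolding cis_conv_exp by measurable
  fix A assume "A \<in> sets (distr circle_measure borel (\<lambda>z. u * z))"
  then have [measurable]: "A \<in> sets borel" by simp
  let ?f = "\<lambda>t::real. indicator A (cis (2 * pi * t)) :: ennreal"
  have per: "?f (t + 1) = ?f t" for t
    by (simp add: cis_mult [symmetric] distrib_left)
  have em: "emeasure (uniform_measure lborel {0..<1::real}) B =
      (\<integral>\<^sup>+t. indicator {0..<1} t * indicator B t \<partial>lborel)" if [measurable]: "B \<in> sets borel" for B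
    by (simp add: indicator_inter_arith [symmetric] divide_ennreal_def)
  have mA: "(\<lambda>t. u * cis (2 * pi * t)) -` A \<in> sets borel" "(\<lambda>t. cis (2 * pi * t)) -` A \<in> sets borel"
    by (rule measurable_sets_borel[of _ borel]; measurable)+
  have "emeasure (distr circle_measure borel (\<lambda>z. u * z)) A =
      emeasure (uniform_measure lborel {0..<1::real}) ((\<lambda>t. u * cis (2 * pi * t)) -` A)"
    unfolding circle_measure_def
    by (subst distr_distr) (auto simp: emeasure_distr comp_def)
  also have "\<dots> = (\<integral>\<^sup>+t. indicator {0..<1} t * ?f (t + s) \<partial>lborel)"
    by (subst em[OF mA(1)]) (auto simp: us cis_mult distrib_left add.commute indicator_def intro!: nn_integral_cong)
  also have "\<dots> = (\<integral>\<^sup>+t. indicator {0..<1} t * ?f t \<partial>lborel)"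
    by (rule nn_integral_periodic_shift[where f = "?f", OF _ per s]) measurable
  also have "\<dots> = emeasure (uniform_measure lborel {0..<1::real}) ((\<lambda>t. cis (2 * pi * t)) -` A)"
    by (subst em[OF mA(2)]) (auto simp: indicator_def intro!: nn_integral_cong)
  also have "\<dots> = emeasure circle_measure A"
    unfolding circle_measure_def by (auto simp: emeasure_distr)
  finally show "emeasure (distr circle_measure borel (\<lambda>z. u * z)) A = emeasure circle_measure A" .
qed simp

lemma measurable_component [measurable (raw)]:
  "(\<lambda>J :: 'a::countable \<Rightarrow> 'b::second_countable_topology. J e) \<in> borel_measurable borel"
  by (intro borel_measurable_continuous_onI continuous_on_product_coordinates)

lemma measurable_fun_app:
  fixes f :: "'c \<Rightarrow> 'a::countable \<Rightarrow> 'b::second_countable_topology"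
  assumes "f \<in> borel_measurable M"
  shows "(\<lambda>x. f x e) \<in> borel_measurable M"
  by (rule measurable_compose[OF assms measurable_component])

lemma measurable_to_fun:
  fixes f :: "'c \<Rightarrow> 'a::countable \<Rightarrow> 'b::second_countable_topology"
  assumes "\<And>e. (\<lambda>x. f x e) \<in> borel_measurable M"
  shows "f \<in> borel_measurable M"
  using assms by (rule measurable_coordinatewise_then_product)

section \<open>Uniqueness and construction of the invariant measure\<close>

lemma sets_H_diamond [measurable]:
  fixes D :: "('v::countable \<times> 'v) set"
  shows "H_diamond D \<in> sets borel"
proof -
  have "H_diamond D = {J \<in> space borel. (\<forall>e. e \<in> D \<longrightarrow> norm (J e) = 1) \<and> (\<forall>e. e \<notin> D \<longrightarrow> J e = 1)
     \<and> (\<forall>x y. (x, y) \<in> D \<longrightarrow> J (y, x) = inverse (J (x, y))) \<and> (\<forall>x. (\<Prod>y | (y, x) \<in> D. J (y, x)) = 1)}"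
    unfolding H_diamond_def circle_forms_def d_star_def by (rule set_eqI, unfold mem_Collect_eq space_borel, blast)
  also have "\<dots> \<in> sets borel"
  proof (intro sets.sets_Collect_conj sets.sets_Collect_countable_All)
    fix e :: "'v \<times> 'v" and x y :: 'v
    show "{J \<in> space borel. e \<in> D \<longrightarrow> norm (J e :: complex) = 1} \<in> sets borel"
      by (cases "e \<in> D") (simp, measurable, simp)
    show "{J \<in> space borel. e \<notin> D \<longrightarrow> J e = (1 :: complex)} \<in> sets borel"
      by (cases "e \<in> D") (simp, simp, measurable)
    show "{J \<in> space borel. (x, y) \<in> D \<longrightarrow> J (y, x) = inverse (J (x, y) :: complex)} \<in> sets borel"
      by (intro sets.sets_Collect_imp sets.sets_Collect_const measurable_equality_set
          borel_measurable_inverse measurable_component)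
    show "{J \<in> space borel. (\<Prod>y | (y, x) \<in> D. J (y, x)) = (1 :: complex)} \<in> sets borel"
      by measurable
  qed
  finally show ?thesis .
qed

lemma H_diamond_mult:
  assumes "sym D" "g \<in> H_diamond D" "J \<in> H_diamond D"
  shows "(\<lambda>e. g e * J e) \<in> H_diamond D"
proof -
  have c: "g \<in> circle_forms D" "J \<in> circle_forms D"
    using assms by (simp_all add: H_diamond_def)
  have "(\<lambda>e. g e * J e) \<in> circle_forms D"
    unfolding circle_forms_def mem_Collect_eq
  proof (intro conjI ballI allI impI)
    fix x y
    have "g (y, x) = inverse (g (x, y))" "J (y, x) = inverse (J (x, y))"
      using circle_formsD(3)[OF c(1) assms(1)] circle_formsD(3)[OF c(2) assms(1)] by blast+
    then show "g (y, x) * J (y, x) = inverse (g (x, y) * J (x, y))"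
      by (metis inverse_mult_distrib)
  qed (simp_all add: norm_mult circle_formsD(1,2)[OF c(1)] circle_formsD(1,2)[OF c(2)])
  then show ?thesis
    using assms by (simp add: H_diamond_def d_star_def prod.distrib)
qed

definition is_haar :: "('v::countable \<times> 'v) set \<Rightarrow> ('v \<times> 'v \<Rightarrow> complex) measure \<Rightarrow> bool" where
  "is_haar D m \<longleftrightarrow> prob_space m \<and> sets m = sets borel \<and> (AE J in m. J \<in> H_diamond D) \<and>
     (\<forall>g\<in>H_diamond D. distr m borel (\<lambda>J e. g e * J e) = m)"

text \<open>Integrate the indicator of \<open>g * J \<in> A\<close> over both measures. By
  invariance the inner integral is constant in either order of integration; after Fubini,
  commutativity lets \<open>J\<close> play the role of the translation.\<close>

lemma is_haar_unique:
  assumes "is_haar D m" "is_haar D m'"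
  shows "m = m'"
proof (rule measure_eqI)
  interpret m: prob_space m using assms by (simp add: is_haar_def)
  interpret m': prob_space m' using assms by (simp add: is_haar_def)
  interpret P: pair_prob_space m m' ..
  have s [measurable_cong]: "sets m = sets borel" "sets m' = sets borel"
    using assms by (auto simp: is_haar_def)
  show "sets m = sets m'" using s by simp
  fix A assume "A \<in> sets m"
  then have A [measurable]: "A \<in> sets borel" by (simp add: s)
  have [measurable]: "(\<lambda>p e. fst p e * snd p e) \<in> borel_measurable (m \<Otimes>\<^sub>M m')"
  proof (rule measurable_to_fun)
    fix e
    have [measurable]: "(\<lambda>p. fst p e) \<in> borel_measurable (m \<Otimes>\<^sub>M m')"
      "(\<lambda>p. snd p e) \<in> borel_measurable (m \<Otimes>\<^sub>M m')"
      using measurable_fst[of m m'] measurable_snd[of m m']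
        measurable_cong_sets[OF refl s(1), of "m \<Otimes>\<^sub>M m'"] measurable_cong_sets[OF refl s(2), of "m \<Otimes>\<^sub>M m'"]
      by (auto intro: measurable_fun_app)
    show "(\<lambda>p. fst p e * snd p e) \<in> borel_measurable (m \<Otimes>\<^sub>M m')"
      by measurable
  qed
  have [measurable]: "(\<lambda>x e. g e * x e) \<in> borel_measurable borel" for g :: "'a \<times> 'a \<Rightarrow> complex"
    by (rule measurable_to_fun) measurable
  have shift: "emeasure n A = (\<integral>\<^sup>+J. indicator A (\<lambda>e. g e * J e) \<partial>n)"
    if "is_haar D n" "g \<in> H_diamond D" for n g
  proof -
    have sn [measurable_cong]: "sets n = sets borel" using that by (simp add: is_haar_def)
    have "emeasure n A = emeasure (distr n borel (\<lambda>J e. g e * J e)) A"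
      using that by (simp add: is_haar_def)
    also have "\<dots> = (\<integral>\<^sup>+J. indicator A (\<lambda>e. g e * J e) \<partial>n)"
      by (subst nn_integral_indicator [symmetric], simp, subst nn_integral_distr) auto
    finally show ?thesis .
  qed
  have "emeasure m A = (\<integral>\<^sup>+g. \<integral>\<^sup>+J. indicator A (\<lambda>e. g e * J e) \<partial>m \<partial>m')"
  proof -
    have "emeasure m A = (\<integral>\<^sup>+g. emeasure m A \<partial>m')"
      by (simp add: m'.emeasure_space_1)
    also have "\<dots> = (\<integral>\<^sup>+g. \<integral>\<^sup>+J. indicator A (\<lambda>e. g e * J e) \<partial>m \<partial>m')"
      using assms by (intro nn_integral_cong_AE) (auto simp: is_haar_def intro!: shift)
    finally show ?thesis .
  qed
  also have "\<dots> = (\<integral>\<^sup>+J. \<integral>\<^sup>+g. indicator A (\<lambda>e. g e * J e) \<partial>m' \<partial>m)"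
    by (rule P.Fubini') (auto simp: case_prod_beta mult.commute)
  also have "\<dots> = (\<integral>\<^sup>+J. emeasure m' A \<partial>m)"
    using assms by (intro nn_integral_cong_AE) (auto simp: is_haar_def shift mult.commute)
  finally show "emeasure m A = emeasure m' A"
    by (simp add: m.emeasure_space_1)
qed

text \<open>Turns the deletion of edges into passage to the subgroup of forms equal to 1 on them,
  which is the inductive step in building the Haar measure.\<close>

lemma H_diamond_subgraph:
  fixes D :: "('v \<times> 'v) set"
  assumes D: "finite D" "D' \<subseteq> D" "sym D'"
  shows "J \<in> H_diamond D' \<longleftrightarrow> J \<in> H_diamond D \<and> (\<forall>e\<in>D - D'. J e = 1)"
proof -
  have d: "d_star D J x = d_star D' J x" if "\<And>e. e \<notin> D' \<Longrightarrow> J e = 1" for x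
  proof -
    have "finite {y. (y, x) \<in> D}"
      using D(1) by (rule finite_surj[of _ _ fst]) force
    then show ?thesis
      unfolding d_star_def using D that by (intro prod.mono_neutral_right) auto
  qed
  have "J \<in> circle_forms D' \<longleftrightarrow> J \<in> circle_forms D \<and> (\<forall>e\<in>D - D'. J e = 1)"
  proof
    assume J: "J \<in> circle_forms D'"
    show "J \<in> circle_forms D \<and> (\<forall>e\<in>D - D'. J e = 1)"
      unfolding circle_forms_def mem_Collect_eq
      using circle_formsD(1)[OF J] circle_formsD(2)[OF J] circle_formsD(3)[OF J D(3)] D(2)
      by blast
  next
    assume "J \<in> circle_forms D \<and> (\<forall>e\<in>D - D'. J e = 1)"
    then show "J \<in> circle_forms D'"
      unfolding circle_forms_def mem_Collect_eq using D(2) by blast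
  qed
  moreover have "\<And>e. e \<notin> D' \<Longrightarrow> J e = 1" if "J \<in> circle_forms D'"
    using circle_formsD(2)[OF that] .
  ultimately show ?thesis
    unfolding H_diamond_def using d by (smt (verit) mem_Collect_eq)
qed

text \<open>Induction on the number of edges. Removing a bridge leaves the group unchanged, as
  coclosed forms are 1 there. Removing an edge on a cycle splits off one circle: a form is a power
  of a cycle flow times a form on the smaller graph, and the product of the circle measure with the
  smaller Haar measure is pushed forward.\<close>

lemma ex_haar:
  fixes D :: "('v::countable \<times> 'v) set"
  assumes "finite D" "sym D" "irrefl D"
  shows "\<exists>m. is_haar D m"
  using assms
proof (induction "card D" arbitrary: D rule: less_induct)
  case less
  show ?case
  proof (cases "D = {}")
    case True
    then have "H_diamond D = {\<lambda>_. 1}"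
      by (auto simp: H_diamond_def circle_forms_def d_star_def)
    moreover have "AE J in return borel (\<lambda>_ :: 'v \<times> 'v. 1 :: complex). J = (\<lambda>_. 1)"
      by (subst AE_return) auto
    ultimately show ?thesis
      by (intro exI[of _ "return borel (\<lambda>_. 1)"])
        (auto simp: is_haar_def prob_space_return distr_return)
  next
    case False
    then obtain x y where xy: "(x, y) \<in> D" by auto
    define D' where "D' = D - {(x, y), (y, x)}"
    have yx: "(y, x) \<in> D" and ne: "x \<noteq> y"
      using less.prems xy unfolding sym_def irrefl_def by blast+
    have D': "D' \<subseteq> D" "finite D'" "sym D'" "irrefl D'" "card D' < card D"
    proof -
      show "D' \<subseteq> D" "finite D'" using less.prems(1) by (auto simp: D'_def)
      show "sym D'" using less.prems(2) unfolding D'_def sym_def by blast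
      show "irrefl D'" using less.prems(3) unfolding D'_def irrefl_def by blast
      show "card D' < card D"
        using less.prems(1) xy by (intro psubset_card_mono) (auto simp: D'_def)
    qed
    obtain m where m: "is_haar D' m"
      using less.hyps[OF D'(5,2-4)] by blast
    note sub = H_diamond_subgraph[OF less.prems(1) D'(1) D'(3)]
    show ?thesis
    proof (cases "(x, y) \<in> D'\<^sup>*")
      case False
      have "J (x, y) = 1 \<and> J (y, x) = 1" if "J \<in> H_diamond D" for J
      proof -
        have "(y, x) \<notin> D'\<^sup>*"
          using False sym_rtrancl[OF D'(3)] by (meson symE)
        then show ?thesis
          using H_diamond_bridge[OF less.prems that xy] H_diamond_bridge[OF less.prems that yx] False
          unfolding D'_def by (metis insert_commute)
      qed
      then have "H_diamond D = H_diamond D'"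
        using sub unfolding D'_def by blast
      then show ?thesis using m by (auto simp: is_haar_def)
    next
      case True
      define W where "W = fst ` D \<union> snd ` D"
      have W: "finite W" "D \<subseteq> W \<times> W" "x \<in> W" "y \<in> W"
        using less.prems(1) xy by (force simp: W_def)+
      then have W': "D' \<subseteq> W \<times> W" using D' by auto
      obtain l where l: "integer_flow D' l"
          "\<And>v. (\<Sum>u\<in>W. l (u, v)) = of_bool (v = y) - of_bool (v = x)"
        using flow_between[OF W(1) W' D'(3) True] by blast
      \<comment> \<open>The flow from \<open>x\<close> to \<open>y\<close> in \<open>D'\<close> is
        closed up by the deleted edge. The cycle \<open>k\<close> takes the value 1 on
        \<open>(y, x)\<close>, so the circle coordinate can be read off from that edge.\<close>
      define k where "k e = l e + edge_flow (y, x) e" for e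
      have k: "integer_flow D k" "\<And>v. (\<Sum>u\<in>W. k (u, v)) = 0"
      proof -
        show "integer_flow D k"
          unfolding k_def using integer_flow_mono[OF l(1) D'(1)] less.prems(2) yx
          by (intro integer_flow_add integer_flow_edge)
        show "(\<Sum>u\<in>W. k (u, v)) = 0" for v
          using W by (simp add: k_def sum.distrib sum_edge_flow l(2))
      qed
      have k1: "k (y, x) = 1" "k (x, y) = -1"
      proof -
        have "l (x, y) = 0" "l (y, x) = 0"
          using l(1) unfolding integer_flow_def D'_def by blast+
        then show "k (y, x) = 1" "k (x, y) = -1"
          using ne by (simp_all add: k_def edge_flow_def)
      qed
      have cyc: "(\<lambda>e. z powi k e) \<in> H_diamond D" if "norm z = 1" for z :: complex
        using cycle_in_H_diamond[OF W(1,2) k that] .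
      interpret m: prob_space m using m by (simp add: is_haar_def)
      interpret U: prob_space circle_measure by (rule prob_space_circle_measure)
      interpret P: pair_prob_space circle_measure m ..
      have sm [measurable_cong]: "sets m = sets borel" using m by (simp add: is_haar_def)
      define \<Phi> where "\<Phi> = (\<lambda>(z, J) e. z powi k e * J e :: complex)"
      have \<Phi> [measurable]: "\<Phi> \<in> borel_measurable (circle_measure \<Otimes>\<^sub>M m)"
      proof (rule measurable_to_fun)
        have [measurable]: "(\<lambda>z::complex. z powi n) \<in> borel_measurable borel" for n
          by (simp add: power_int_def)
        fix e
        have [measurable]: "(\<lambda>p. snd p e) \<in> borel_measurable (circle_measure \<Otimes>\<^sub>M m)"
          using measurable_snd[of circle_measure m] measurable_cong_sets[OF refl sm, of "circle_measure \<Otimes>\<^sub>M m"]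
          by (auto intro: measurable_fun_app)
        show "(\<lambda>p. \<Phi> p e) \<in> borel_measurable (circle_measure \<Otimes>\<^sub>M m)"
          unfolding \<Phi>_def by (simp add: case_prod_beta)
      qed
      define m' where "m' = distr (circle_measure \<Otimes>\<^sub>M m) borel \<Phi>"
      have "is_haar D m'"
        unfolding is_haar_def
      proof (intro conjI ballI)
        show "prob_space m'" unfolding m'_def by (intro P.prob_space_distr \<Phi>)
        show "sets m' = sets borel" by (simp add: m'_def)
        have "AE p in circle_measure \<Otimes>\<^sub>M m. \<Phi> p \<in> H_diamond D"
        proof (rule P.AE_pair_measure)
          show "{p \<in> space (circle_measure \<Otimes>\<^sub>M m). \<Phi> p \<in> H_diamond D} \<in> sets (circle_measure \<Otimes>\<^sub>M m)"
            by measurable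
          show "AE z in circle_measure. AE J in m. \<Phi> (z, J) \<in> H_diamond D"
            using AE_circle_measure
          proof eventually_elim
            case (elim z)
            show ?case
              using m less.prems sub cyc[OF elim] unfolding is_haar_def \<Phi>_def
              by (auto elim!: eventually_mono intro!: H_diamond_mult)
          qed
        qed
        then show "AE J in m'. J \<in> H_diamond D"
          unfolding m'_def by (subst AE_distr_iff) auto
        fix g assume g: "g \<in> H_diamond D"
        \<comment> \<open>Strip from \<open>g\<close> its circle coordinate \<open>u\<close>. What
          remains, \<open>g'\<close>, is 1 on the deleted edge, and translation by \<open>g\<close>
          is rotation of \<open>z\<close> by \<open>u\<close> together with translation of
          \<open>J\<close> by \<open>g'\<close>.\<close>
        define u where "u = g (y, x)"
        define g' where "g' e = g e * inverse u powi k e" for e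
        have gc: "g \<in> circle_forms D" using g by (simp add: H_diamond_def)
        have u: "norm u = 1" "u \<noteq> 0"
          using circle_formsD(1)[OF gc, of "(y, x)"] by (auto simp: u_def)
        have g': "g' \<in> H_diamond D'"
        proof -
          have "g' \<in> H_diamond D"
            using H_diamond_mult[OF less.prems(2) g cyc[of "inverse u"]] u
            by (simp add: g'_def[abs_def] norm_inverse)
          moreover have "g' (x, y) = 1" "g' (y, x) = 1"
            using k1 u circle_formsD(3)[OF gc less.prems(2), of x y]
            by (auto simp: g'_def power_int_minus u_def)
          ultimately show ?thesis using sub by (auto simp: D'_def)
        qed
        have [measurable]: "(\<lambda>J e. h e * J e) \<in> borel_measurable borel" for h :: "'v \<times> 'v \<Rightarrow> complex"
          by (rule measurable_to_fun) measurable
        have inv: "distr m borel (\<lambda>J e. g' e * J e) = m"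
          using m g' by (auto simp: is_haar_def)
        have eq: "g e * \<Phi> (z, J) e = \<Phi> (u * z, \<lambda>e. g' e * J e) e" for z J e
          using u by (simp add: \<Phi>_def g'_def power_int_mult_distrib power_int_inverse)
        have "distr m' borel (\<lambda>J e. g e * J e) =
            distr (circle_measure \<Otimes>\<^sub>M m) borel (\<lambda>p e. g e * \<Phi> p e)"
          unfolding m'_def by (subst distr_distr) (auto simp: comp_def)
        also have "\<dots> = distr (circle_measure \<Otimes>\<^sub>M m) borel
            (\<Phi> \<circ> (\<lambda>(z, J). (u * z, \<lambda>e. g' e * J e)))"
          by (intro distr_cong refl) (auto simp: eq fun_eq_iff)
        also have "\<dots> = distr (distr (circle_measure \<Otimes>\<^sub>M m) (circle_measure \<Otimes>\<^sub>M m)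
            (\<lambda>(z, J). (u * z, \<lambda>e. g' e * J e))) borel \<Phi>"
          by (subst distr_distr) auto
        also have "distr (circle_measure \<Otimes>\<^sub>M m) (circle_measure \<Otimes>\<^sub>M m) (\<lambda>(z, J). (u * z, \<lambda>e. g' e * J e))
           = distr (circle_measure \<Otimes>\<^sub>M m) (borel \<Otimes>\<^sub>M borel) (\<lambda>(z, J). (u * z, \<lambda>e. g' e * J e))"
          by (intro distr_cong sets_pair_measure_cong) (auto simp: sm)
        also have "\<dots> = distr circle_measure borel (\<lambda>z. u * z) \<Otimes>\<^sub>M distr m borel (\<lambda>J e. g' e * J e)"
          by (rule pair_measure_distr [symmetric]) (auto simp: inv intro: m.sigma_finite_measure_axioms)
        also have "\<dots> = circle_measure \<Otimes>\<^sub>M m"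
          by (simp add: inv circle_measure_rotate u)
        finally show "distr m' borel (\<lambda>J e. g e * J e) = m'"
          by (simp add: m'_def)
      qed
      then show ?thesis by blast
    qed
  qed
qed

lemma is_haar_diamond:
  fixes D :: "('v::countable \<times> 'v) set"
  assumes "finite D" "sym D" "irrefl D"
  shows "is_haar D (haar_diamond D)"
proof -
  have "haar_diamond D = (THE m. is_haar D m)"
    by (simp add: haar_diamond_def is_haar_def)
  then show ?thesis
    using ex_haar[OF assms] is_haar_unique by (metis theI)
qed

text \<open>A non-exact exponent pairs nontrivially with some cycle; translation by a suitable power
  of that cycle multiplies the character by -1, which invariance allows only if the integral is 0.
  For exact exponents the character is constantly 1 on coclosed forms.\<close>

lemma haar_character:
  fixes D :: "('v::countable \<times> 'v) set"
  assumes D: "finite D" "sym D" "irrefl D"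
  shows "(\<integral>J. (\<Prod>e\<in>orientation D. J e powi n e) \<partial>haar_diamond D) =
    of_bool (\<exists>h. \<forall>e\<in>orientation D. n e = ext_d D h e)"
proof -
  let ?m = "haar_diamond D" and ?\<chi> = "\<lambda>J. \<Prod>e\<in>orientation D. J e powi n e :: complex"
  have m: "is_haar D ?m" by (rule is_haar_diamond[OF D])
  interpret prob_space ?m using m by (simp add: is_haar_def)
  have sm [measurable_cong]: "sets ?m = sets borel" using m by (simp add: is_haar_def)
  have [measurable]: "?\<chi> \<in> borel_measurable borel"
    by (simp add: power_int_def)
  show ?thesis
  proof (cases "\<exists>h. \<forall>e\<in>orientation D. n e = ext_d D h e")
    case True
    then obtain h where h: "\<And>e. e \<in> orientation D \<Longrightarrow> n e = ext_d D h e" by auto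
    have "(\<integral>J. ?\<chi> J \<partial>?m) = (\<integral>J. 1 \<partial>?m)"
      using m H_diamond_exact[OF D, of _ h]
    proof (intro integral_cong_AE)
      show "AE J in ?m. ?\<chi> J = 1"
        using m H_diamond_exact[OF D, of _ h] by (auto simp: is_haar_def h elim!: eventually_mono)
    qed simp_all
    then show ?thesis using True by (simp add: prob_space)
  next
    case False
    define W where "W = fst ` D \<union> snd ` D"
    have W: "finite W" "D \<subseteq> W \<times> W"
      using D(1) by (force simp: W_def)+
    obtain k where k: "integer_flow D k" "\<And>v. (\<Sum>u\<in>W. k (u, v)) = 0"
        "(\<Sum>e\<in>orientation D. n e * k e) \<noteq> 0"
      using exact_if_orthogonal[OF W D(2,3)] False by blast
    let ?s = "\<Sum>e\<in>orientation D. n e * k e"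
    \<comment> \<open>The angle is chosen so that multiplication by the pairing \<open>?s\<close>
      turns it into pi, making the character of \<open>g\<close> equal to -1.\<close>
    define z where "z = cis (pi / of_int ?s)"
    define g where "g e = z powi k e" for e
    have z: "norm z = 1" "z \<noteq> 0" by (simp_all add: z_def)
    have g: "g \<in> H_diamond D"
      using cycle_in_H_diamond[OF W k(1,2) z(1)] by (simp add: g_def[abs_def])
    have "?\<chi> g = (\<Prod>e\<in>orientation D. z powi (n e * k e))"
      by (simp add: g_def power_int_mult [symmetric] mult.commute)
    also have "\<dots> = z powi ?s" using z by (simp add: power_int_sum)
    also have "\<dots> = cis (of_int ?s * (pi / of_int ?s))"
      unfolding z_def by (rule cis_power_int)
    also have "\<dots> = -1"
      using k(3) by (simp flip: of_int_sum of_int_mult)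
    finally have \<chi>g: "?\<chi> g = -1" .
    have [measurable]: "(\<lambda>J e. g e * J e) \<in> borel_measurable borel"
      by (rule measurable_to_fun) measurable
    have "(\<integral>J. ?\<chi> J \<partial>?m) = (\<integral>J. ?\<chi> J \<partial>distr ?m borel (\<lambda>J e. g e * J e))"
      using m g by (simp add: is_haar_def)
    also have "\<dots> = (\<integral>J. ?\<chi> (\<lambda>e. g e * J e) \<partial>?m)"
      by (rule integral_distr) measurable
    also have "\<dots> = (\<integral>J. ?\<chi> g * ?\<chi> J \<partial>?m)"
      by (simp add: power_int_mult_distrib prod.distrib)
    also have "\<dots> = - (\<integral>J. ?\<chi> J \<partial>?m)"
      by (simp add: \<chi>g)
    finally show ?thesis using False by simp
  qed
qed

section \<open>Fourier series of the weight\<close>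

text \<open>The summable bound gives uniform convergence of the partial sums, which on a probability
  space passes to the integrals. Unordered sums are used because the index sets consist of
  forms.\<close>

lemma has_sum_integral:
  fixes f :: "'a \<Rightarrow> 'b \<Rightarrow> 'c::{banach, second_countable_topology}"
  assumes "prob_space M" and [measurable]: "\<And>n. n \<in> A \<Longrightarrow> f n \<in> borel_measurable M" "S \<in> borel_measurable M"
    and bound: "\<And>n x. n \<in> A \<Longrightarrow> norm (f n x) \<le> b n" and b: "b summable_on A"
    and S: "\<And>x. ((\<lambda>n. f n x) has_sum S x) A"
  shows "((\<lambda>n. \<integral>x. f n x \<partial>M) has_sum (\<integral>x. S x \<partial>M)) A"
proof -
  interpret prob_space M by fact
  have ul: "uniform_limit UNIV (\<lambda>F x. \<Sum>n\<in>F. f n x) S (finite_subsets_at_top A)"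
    by (rule Weierstrass_m_test_general'[OF bound S b])
  have int: "integrable M (f n)" if "n \<in> A" for n
    using that bound[OF that] by (intro integrable_const_bound[of _ "b n"]) auto
  have SB: "norm (S x) \<le> infsum b A" for x
  proof -
    have "norm (infsum (\<lambda>n. f n x) A) \<le> infsum b A"
    proof (rule norm_infsum_le[OF has_sum_infsum has_sum_infsum])
      show "(\<lambda>n. f n x) summable_on A" using S by (rule has_sum_imp_summable)
    qed (use b bound in auto)
    then show ?thesis using S by (metis infsumI)
  qed
  have intS: "integrable M S"
    using SB by (intro integrable_const_bound[of _ "infsum b A"]) auto
  have "((\<lambda>F. \<Sum>n\<in>F. \<integral>x. f n x \<partial>M) \<longlongrightarrow> (\<integral>x. S x \<partial>M)) (finite_subsets_at_top A)"
  proof (rule tendstoI)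
    fix \<epsilon> :: real assume "\<epsilon> > 0"
    have "\<forall>\<^sub>F F in finite_subsets_at_top A. F \<subseteq> A \<and> finite F"
      by (rule eventually_finite_subsets_at_top_weakI) auto
    moreover have "\<forall>\<^sub>F F in finite_subsets_at_top A. \<forall>x\<in>UNIV. dist (\<Sum>n\<in>F. f n x) (S x) < \<epsilon> / 2"
      by (rule ul[unfolded uniform_limit_iff, rule_format]) (use \<open>\<epsilon> > 0\<close> in simp)
    ultimately show "\<forall>\<^sub>F F in finite_subsets_at_top A. dist (\<Sum>n\<in>F. \<integral>x. f n x \<partial>M) (\<integral>x. S x \<partial>M) < \<epsilon>"
    proof eventually_elim
      case (elim F)
      have i: "integrable M (\<lambda>x. \<Sum>n\<in>F. f n x)" using elim int by (intro Bochner_Integration.integrable_sum) auto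
      have "(\<Sum>n\<in>F. \<integral>x. f n x \<partial>M) - (\<integral>x. S x \<partial>M) = (\<integral>x. (\<Sum>n\<in>F. f n x) - S x \<partial>M)"
        using elim int i intS by (subst Bochner_Integration.integral_diff) (auto simp: Bochner_Integration.integral_sum subset_eq)
      also have "norm \<dots> \<le> (\<integral>x. norm ((\<Sum>n\<in>F. f n x) - S x) \<partial>M)"
        by (rule integral_norm_bound)
      also have "\<dots> \<le> (\<integral>x. \<epsilon> / 2 \<partial>M)"
        using elim i intS by (intro integral_mono) (auto simp: dist_norm less_imp_le)
      also have "\<dots> < \<epsilon>" using \<open>\<epsilon> > 0\<close> by (simp add: prob_space)
      finally show ?case by (simp add: dist_norm)
    qed
  qed
  then show ?thesis by (simp add: has_sum_def)
qed

text \<open>Total measurable functions of the spins need a value off the unit circle; here \<open>circ 0 = 1\<close>.\<close>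

definition circ :: "complex \<Rightarrow> complex" where
  "circ z = cis (Arg z)"

lemma norm_circ [simp]: "norm (circ z) = 1"
  by (simp add: circ_def)

lemma circ_nz [simp]: "circ z \<noteq> 0"
  by (simp add: circ_def)

lemma circ_eq [simp]: "norm z = 1 \<Longrightarrow> circ z = z"
  by (cases "z = 0") (simp_all add: circ_def cis_Arg sgn_eq)

lemma measurable_circ [measurable]: "circ \<in> borel_measurable borel"
proof -
  have "circ z = (if z = 0 then 1 else z /\<^sub>R norm z)" for z
    by (simp add: circ_def cis_Arg sgn_div_norm Arg_zero)
  then have "circ = (\<lambda>z. if z = 0 then 1 else z /\<^sub>R norm z)" by blast
  moreover have "(\<lambda>z::complex. if z = 0 then 1 else z /\<^sub>R norm z) \<in> borel_measurable borel" by measurable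
  ultimately show ?thesis by metis
qed

lemma circ_powi: "circ z powi n = cis (of_int n * Arg z)"
  by (simp add: circ_def cis_power_int)

text \<open>Evaluated through \<open>circ\<close>, the series is defined on the whole plane but
  depends only on the direction of \<open>z\<close>. The index runs over all integers so that
  products of such series expand into characters.\<close>

definition fourier :: "(int \<Rightarrow> real) \<Rightarrow> complex \<Rightarrow> complex" where
  "fourier a z = (\<Sum>\<^sub>\<infinity>n. of_real (a n) * circ z powi n)"

lemma fourier_has_sum:
  assumes "(\<lambda>n. \<bar>a n\<bar>) summable_on UNIV"
  shows "((\<lambda>n. of_real (a n) * circ z powi n) has_sum fourier a z) UNIV"
  unfolding fourier_def
  by (rule has_sum_infsum, rule abs_summable_summable) (simp add: norm_mult norm_power_int assms)

lemma continuous_on_power_int_sphere: "continuous_on (sphere 0 1) (\<lambda>z::complex. z powi n)"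
  by (intro continuous_intros) auto

lemma continuous_on_fourier:
  assumes "(\<lambda>n. \<bar>a n\<bar>) summable_on UNIV"
  shows "continuous_on (sphere 0 1) (fourier a)"
proof (rule uniform_limit_theorem)
  show "uniform_limit (sphere 0 1) (\<lambda>F z. \<Sum>n\<in>F. of_real (a n) * circ z powi n) (fourier a)
      (finite_subsets_at_top UNIV)"
    by (rule Weierstrass_m_test_general'[OF _ fourier_has_sum[OF assms] assms])
      (simp add: norm_mult norm_power_int)
  have "continuous_on (sphere 0 1) (\<lambda>z. \<Sum>n\<in>F. of_real (a n) * circ z powi n)" for F
  proof -
    have "continuous_on (sphere 0 1) (\<lambda>z::complex. \<Sum>n\<in>F. of_real (a n) * z powi n)"
      by (intro continuous_on_sum continuous_on_mult continuous_on_const continuous_on_power_int_sphere)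
    then show ?thesis by (rule continuous_on_eq) simp
  qed
  then show "\<forall>\<^sub>F F in finite_subsets_at_top UNIV. continuous_on (sphere 0 1) (\<lambda>z. \<Sum>n\<in>F. of_real (a n) * circ z powi n)"
    by simp
qed simp

lemma fourier_circ: "fourier a (circ z) = fourier a z"
  by (simp add: fourier_def)

lemma measurable_fourier:
  assumes "(\<lambda>n. \<bar>a n\<bar>) summable_on UNIV"
  shows "fourier a \<in> borel_measurable borel"
proof -
  have "circ \<in> borel \<rightarrow>\<^sub>M restrict_space borel (sphere 0 1)"
    by (rule measurable_restrict_space2) auto
  moreover have "fourier a \<in> restrict_space borel (sphere 0 1) \<rightarrow>\<^sub>M borel"
    by (intro borel_measurable_continuous_on_restrict continuous_on_fourier assms)
  ultimately have "(\<lambda>z. fourier a (circ z)) \<in> borel_measurable borel"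
    by (rule measurable_compose)
  then show ?thesis by (simp add: fourier_circ)
qed

lemma norm_fourier_le:
  assumes "(\<lambda>n. \<bar>a n\<bar>) summable_on UNIV"
  shows "norm (fourier a z) \<le> (\<Sum>\<^sub>\<infinity>n. \<bar>a n\<bar>)"
  unfolding fourier_def using assms
  by (intro order_trans[OF norm_infsum_bound]) (simp_all add: norm_mult norm_power_int)

text \<open>Folds a sum over the integers into pairs \<open>k\<close>, \<open>-k\<close>, the shape
  in which \<open>spin_weight\<close> presents its cosine series; the term at 0 is split
  off.\<close>

lemma has_sum_int_sums:
  fixes f :: "int \<Rightarrow> 'a::banach"
  assumes "(\<lambda>n. norm (f n)) summable_on UNIV"
  shows "(\<lambda>k. f (int (Suc k)) + f (- int (Suc k))) sums (infsum f UNIV - f 0)"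
proof -
  let ?p = "\<lambda>k. int (Suc k)" and ?m = "\<lambda>k. - int (Suc k)"
  have s: "f summable_on X" for X
    using assms by (rule summable_on_subset_banach[OF abs_summable_summable]) simp
  have un: "UNIV = {0} \<union> (range ?p \<union> range ?m)"
  proof (intro set_eqI iffI UNIV_I)
    fix n :: int
    show "n \<in> {0} \<union> (range ?p \<union> range ?m)"
    proof (cases n rule: int_cases3)
      case (pos k)
      then have "n = ?p (k - 1)" by simp
      then show ?thesis by blast
    next
      case (neg k)
      then have "n = ?m (k - 1)" by simp
      then show ?thesis by blast
    qed simp
  qed
  have "infsum f UNIV = f 0 + (infsum f (range ?p) + infsum f (range ?m))"
    by (subst un, subst infsum_Un_disjoint[OF s s], force, subst infsum_Un_disjoint[OF s s], force, simp)
  moreover have "(\<lambda>k. f (?p k)) sums infsum f (range ?p)"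
    using has_sum_infsum[OF s, of "range ?p"]
    by (subst (asm) has_sum_reindex) (auto simp: inj_def comp_def intro: has_sum_imp_sums)
  moreover have "(\<lambda>k. f (?m k)) sums infsum f (range ?m)"
    using has_sum_infsum[OF s, of "range ?m"]
    by (subst (asm) has_sum_reindex) (auto simp: inj_def comp_def intro: has_sum_imp_sums)
  ultimately show ?thesis
    using sums_add by fastforce
qed

section \<open>The weight and the derivative of the spin potential as Fourier series\<close>

locale height_pot =
  fixes V :: "int \<Rightarrow> ereal"
  assumes V: "height_potential V"
begin

definition c :: "int \<Rightarrow> real" where "c n = exp_neg (V n)"

definition wt :: "complex \<Rightarrow> real" where "wt z = spin_weight V (Arg z)"

lemma c_nonneg [simp]: "c n \<ge> 0"
  by (simp add: c_def exp_neg_def)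

lemma c_minus [simp]: "c (- n) = c n"
  using V by (simp add: c_def height_potential_def)

lemma summable_c2: "(\<lambda>n. (of_int n)\<^sup>2 * c n) summable_on UNIV"
  using V by (simp add: c_def height_potential_def)

text \<open>The bound is asked for nonzero \<open>n\<close> only: at 0 its right-hand side vanishes
  although \<open>a 0\<close> need not.\<close>

lemma abs_summable_c:
  assumes "\<And>n. n \<noteq> 0 \<Longrightarrow> \<bar>a n\<bar> \<le> (of_int n)\<^sup>2 * c n"
  shows "(\<lambda>n. \<bar>a n\<bar>) summable_on UNIV"
proof -
  have "(\<lambda>n. \<bar>a n\<bar>) summable_on (- {0})"
    by (rule summable_on_comparison_test[OF summable_on_subset[OF summable_c2]]) (use assms in auto)
  then have "(\<lambda>n. \<bar>a n\<bar>) summable_on insert 0 (- {0})"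
    by (simp add: summable_on_insert_iff)
  moreover have "insert 0 (- {0}) = (UNIV :: int set)" by auto
  ultimately show ?thesis by metis
qed

lemma int_le_square: "n \<noteq> 0 \<Longrightarrow> 1 \<le> (real_of_int n)\<^sup>2"
  by (metis abs_ge_self abs_power2 int_one_le_iff_zero_less of_int_1_le_iff of_int_power power2_eq_square zero_less_power2)

lemma abs_summable_c0: "(\<lambda>n. \<bar>c n\<bar>) summable_on UNIV"
proof (rule abs_summable_c)
  fix n :: int assume "n \<noteq> 0"
  then show "\<bar>c n\<bar> \<le> (of_int n)\<^sup>2 * c n"
    using mult_right_mono[OF int_le_square c_nonneg] by simp
qed

lemma abs_summable_c1: "(\<lambda>n. \<bar>of_int n * c n\<bar>) summable_on UNIV"
proof (intro abs_summable_c)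
  fix n :: int assume "n \<noteq> 0"
  then have "1 \<le> \<bar>real_of_int n\<bar>" by linarith
  then have "\<bar>real_of_int n\<bar> * 1 \<le> \<bar>real_of_int n\<bar> * \<bar>real_of_int n\<bar>"
    by (intro mult_left_mono) auto
  then have "\<bar>real_of_int n\<bar> \<le> (real_of_int n)\<^sup>2"
    by (simp add: power2_eq_square)
  then show "\<bar>of_int n * c n\<bar> \<le> (of_int n)\<^sup>2 * c n"
    by (simp add: abs_mult mult_right_mono)
qed

lemma abs_summable_c2: "(\<lambda>n. \<bar>(of_int n)\<^sup>2 * c n\<bar>) summable_on UNIV"
  by (intro abs_summable_c) simp

lemma summable_nat:
  fixes a :: "int \<Rightarrow> real"
  assumes "(\<lambda>n. \<bar>a n\<bar>) summable_on UNIV"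
  shows "summable (\<lambda>k. a (int (Suc k)))"
proof -
  have "a summable_on UNIV"
    using assms abs_summable_summable[of a UNIV] by simp
  then have "a summable_on range (\<lambda>k. int (Suc k))"
    by (rule summable_on_subset_banach) simp
  then show ?thesis
    by (subst (asm) summable_on_reindex) (auto simp: inj_def comp_def intro: summable_on_imp_summable)
qed

text \<open>Evenness of \<open>c\<close> combines the terms of \<open>n\<close> and
  \<open>-n\<close> into a cosine.\<close>

lemma fourier_c: "fourier c z = of_real (wt z)"
proof -
  have "(\<lambda>k. of_real (c (int (Suc k))) * circ z powi (int (Suc k)) +
      of_real (c (- int (Suc k))) * circ z powi (- int (Suc k))) sums (fourier c z - of_real (c 0))"
    using has_sum_int_sums[of "\<lambda>n. of_real (c n) * circ z powi n"] abs_summable_c0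
    by (simp add: norm_mult norm_power_int fourier_def)
  moreover have "of_real (c m) * circ z powi m + of_real (c (- m)) * circ z powi (- m) =
      of_real (2 * c m * cos (of_int m * Arg z))" for m
    by (simp only: circ_powi c_minus complex_eq_iff) (simp add: algebra_simps)
  ultimately have F: "(\<lambda>k. complex_of_real (2 * c (int (Suc k)) * cos (real (Suc k) * Arg z))) sums (fourier c z - of_real (c 0))"
    by (simp only: of_int_of_nat_eq)
  \<comment> \<open>The real series is the real part of a convergent complex one. This gives its
    summability, so that \<open>suminf\<close> is its sum rather than an unspecified value.\<close>
  have "(\<lambda>k. complex_of_real (2 * c (int (Suc k)) * cos (real (Suc k) * Arg z))) sums
      of_real (\<Sum>k. 2 * c (int (Suc k)) * cos (real (Suc k) * Arg z))" (is "_ sums of_real ?S")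
    using summable_Re[OF sums_summable[OF F]] by (intro sums_of_real summable_sums) simp
  then have "fourier c z - of_real (c 0) = of_real ?S"
    using F sums_unique2 by blast
  then show ?thesis
    by (simp add: wt_def spin_weight_def c_def diff_eq_eq add.commute)
qed

lemma wt_pos: "wt z > 0"
  using V by (simp add: wt_def height_potential_def)

lemma wt_circ [simp]: "wt (circ z) = wt z"
  using fourier_circ[of c z] by (simp add: fourier_c)

lemma measurable_wt [measurable]: "wt \<in> borel_measurable borel"
proof -
  have "wt = (\<lambda>z. Re (fourier c z))" by (simp add: fourier_c)
  then show ?thesis using measurable_fourier[OF abs_summable_c0] by simp
qed

lemma continuous_on_wt: "continuous_on (sphere 0 1) wt"
proof -
  have "wt = (\<lambda>z. Re (fourier c z))" by (simp add: fourier_c)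
  then show ?thesis using continuous_on_fourier[OF abs_summable_c0] by (simp add: continuous_on_Re)
qed

text \<open>A positive continuous function on the compact circle has a positive minimum; through
  \<open>circ\<close> the bound extends to the plane. It controls the later divisions by the
  weight.\<close>

lemma wt_lower: obtains \<delta> where "\<delta> > 0" "\<And>z. \<delta> \<le> wt z"
proof -
  have "\<exists>x\<in>sphere 0 1. \<forall>y\<in>sphere 0 1. wt x \<le> wt y"
    by (rule continuous_attains_inf) (auto intro: continuous_on_wt)
  then obtain x where x: "\<forall>y\<in>sphere 0 1. wt x \<le> wt y" by blast
  have "wt x \<le> wt z" for z
    using x[rule_format, of "circ z"] by simp
  then show thesis by (rule that[OF wt_pos])
qed

lemma wt_upper: obtains B where "\<And>z. wt z \<le> B"
proof (rule that)
  show "wt z \<le> (\<Sum>\<^sub>\<infinity>n. \<bar>c n\<bar>)" for z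
    using norm_fourier_le[OF abs_summable_c0, of z] wt_pos[of z] by (simp add: fourier_c)
qed

lemma spin_weight_deriv:
  "(spin_weight V has_real_derivative
    (\<Sum>k. - (2 * c (int (Suc k)) * real (Suc k) * sin (real (Suc k) * \<alpha>)))) (at \<alpha>)"
proof -
  let ?f = "\<lambda>k \<alpha>. 2 * exp_neg (V (int (Suc k))) * cos (real (Suc k) * \<alpha>)"
    and ?f' = "\<lambda>k \<alpha>. - (2 * c (int (Suc k)) * real (Suc k) * sin (real (Suc k) * \<alpha>))"
  have "((\<lambda>\<alpha>. \<Sum>k. ?f k \<alpha>) has_real_derivative (\<Sum>k. ?f' k \<alpha>)) (at \<alpha>)"
  proof (rule has_field_derivative_series'[where S = UNIV and ?x0.0 = 0])
    show "uniformly_convergent_on UNIV (\<lambda>n \<alpha>. \<Sum>i<n. ?f' i \<alpha>)"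
    proof (rule Weierstrass_m_test')
      show "summable (\<lambda>k. 2 * (of_int (int (Suc k)) * c (int (Suc k))))"
        by (intro summable_mult summable_nat[OF abs_summable_c1])
      show "norm (?f' k \<alpha>) \<le> 2 * (of_int (int (Suc k)) * c (int (Suc k)))" for k \<alpha>
        by (auto simp: abs_mult mult_ac intro!: mult_left_mono)
          (metis abs_sin_le_one c_nonneg mult.commute mult_left_mono mult.right_neutral mult_nonneg_nonneg of_nat_0_le_iff of_nat_Suc)
    qed
    show "summable (\<lambda>k. ?f k 0)"
      using summable_mult[OF summable_nat[OF abs_summable_c0], of 2] by (simp add: c_def)
    show "(?f k has_field_derivative ?f' k \<alpha>) (at \<alpha> within UNIV)" for k \<alpha>
      by (auto intro!: derivative_eq_intros simp: c_def)
  qed auto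
  then show ?thesis
    unfolding spin_weight_def[abs_def] by (auto intro!: derivative_eq_intros)
qed

definition dU :: "complex \<Rightarrow> real" where
  "dU z = deriv (spin_potential V) (Arg z)"

text \<open>U' is minus the logarithmic derivative of the weight, and the series with coefficients
  \<open>n * c n\<close> is \<open>- \<i>\<close> times the derivative of the weight, because the
  terms of \<open>n\<close> and \<open>-n\<close> combine into
  \<open>2 * \<i> * sin\<close>.\<close>

lemma dU_eq: "of_real (dU z) = - \<i> * fourier (\<lambda>n. of_int n * c n) z / of_real (wt z)"
proof -
  let ?D = "\<Sum>k. - (2 * c (int (Suc k)) * real (Suc k) * sin (real (Suc k) * Arg z))"
  let ?F = "fourier (\<lambda>n. of_int n * c n) z"
  have pos: "spin_weight V \<alpha> > 0" for \<alpha> using V by (simp add: height_potential_def)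
  have "(spin_potential V has_real_derivative - (?D / spin_weight V (Arg z))) (at (Arg z))"
    unfolding spin_potential_def[abs_def]
    using spin_weight_deriv[of "Arg z"] pos[of "Arg z"] by (auto intro!: derivative_eq_intros)
  then have dU: "dU z = - (?D / wt z)"
    unfolding dU_def wt_def by (rule DERIV_imp_deriv)
  have "(\<lambda>k. of_real (of_int (int (Suc k)) * c (int (Suc k))) * circ z powi (int (Suc k)) +
      of_real (of_int (- int (Suc k)) * c (- int (Suc k))) * circ z powi (- int (Suc k))) sums ?F"
    using has_sum_int_sums[of "\<lambda>n. of_real (of_int n * c n) * circ z powi n"] abs_summable_c1
    by (simp add: norm_mult norm_power_int fourier_def abs_mult)
  moreover have "of_real (of_int m * c m) * circ z powi m + of_real (of_int (- m) * c (- m)) * circ z powi (- m) =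
      - \<i> * of_real (- (2 * c m * of_int m * sin (of_int m * Arg z)))" for m
    by (simp only: circ_powi c_minus complex_eq_iff) (simp add: algebra_simps)
  ultimately have "(\<lambda>k. - \<i> * of_real (- (2 * c (int (Suc k)) * of_int (int (Suc k)) *
      sin (of_int (int (Suc k)) * Arg z)))) sums ?F"
    by (simp only:)
  then have F: "(\<lambda>k. - \<i> * of_real (- (2 * c (int (Suc k)) * real (Suc k) * sin (real (Suc k) * Arg z)))) sums ?F"
    by (simp only: of_int_of_nat_eq)
  then have "(\<lambda>k. \<i> * (- \<i> * of_real (- (2 * c (int (Suc k)) * real (Suc k) * sin (real (Suc k) * Arg z))))) sums (\<i> * ?F)"
    by (rule sums_mult)
  then have F': "(\<lambda>k. complex_of_real (- (2 * c (int (Suc k)) * real (Suc k) * sin (real (Suc k) * Arg z)))) sums (\<i> * ?F)"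
    by simp
  have S: "(\<lambda>k. complex_of_real (- (2 * c (int (Suc k)) * real (Suc k) * sin (real (Suc k) * Arg z)))) sums of_real ?D"
    using summable_Re[OF sums_summable[OF F']] by (intro sums_of_real summable_sums) simp
  have "of_real ?D = \<i> * ?F"
    by (rule sums_unique2[OF S F'])
  then show ?thesis unfolding dU of_real_minus of_real_divide by simp
qed

lemma measurable_dU [measurable]: "dU \<in> borel_measurable borel"
proof -
  have [measurable]: "fourier (\<lambda>n. of_int n * c n) \<in> borel_measurable borel"
    by (rule measurable_fourier[OF abs_summable_c1])
  have "dU = (\<lambda>z. Re (- \<i> * fourier (\<lambda>n. of_int n * c n) z / of_real (wt z)))"
    by (simp only: dU_eq [symmetric] Re_complex_of_real)
  moreover have "(\<lambda>z. Re (- \<i> * fourier (\<lambda>n. of_int n * c n) z / of_real (wt z))) \<in> borel_measurable borel"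
    by measurable
  ultimately show ?thesis by metis
qed

lemma dU_bounded: obtains B where "\<And>z. \<bar>dU z\<bar> \<le> B"
proof -
  obtain \<delta> where \<delta>: "\<delta> > 0" "\<And>z. \<delta> \<le> wt z" using wt_lower by metis
  let ?B = "\<Sum>\<^sub>\<infinity>n. \<bar>of_int n * c n\<bar>"
  have "\<bar>dU z\<bar> \<le> ?B / \<delta>" for z
  proof -
    have "\<bar>dU z\<bar> = norm (complex_of_real (dU z))" by simp
    also have "\<dots> = norm (fourier (\<lambda>n. of_int n * c n) z) / wt z"
      unfolding dU_eq using wt_pos[of z] by (simp add: norm_divide norm_mult)
    also have "\<dots> \<le> ?B / \<delta>"
      using \<delta> norm_fourier_le[OF abs_summable_c1] by (intro frac_le) (auto simp: infsum_nonneg)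
    finally show ?thesis .
  qed
  then show thesis by (rule that)
qed

text \<open>Reversing an edge inverts its spin. Oddness of U' therefore makes
  \<open>dU (J e)\<close> antisymmetric in the edge, just like the height gradient.\<close>

lemma dU_inverse:
  assumes "norm z = 1"
  shows "dU (inverse z) = - dU z"
proof -
  have F: "fourier a (inverse z) = fourier (\<lambda>n. a (- n)) z" for a
    unfolding fourier_def using assms
    by (intro infsum_reindex_bij_witness[of _ uminus uminus])
      (auto simp: norm_inverse power_int_minus power_int_inverse)
  have "wt (inverse z) = wt z"
    using F[of c] by (simp add: fourier_c)
  moreover have "fourier (\<lambda>n. of_int n * c n) (inverse z) = - fourier (\<lambda>n. of_int n * c n) z"
    unfolding F unfolding fourier_def by (simp add: infsum_uminus)
  ultimately have "complex_of_real (dU (inverse z)) = of_real (- dU z)"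
    unfolding of_real_minus dU_eq by simp
  then show ?thesis using of_real_eq_iff by blast
qed

end

section \<open>Duality on finite graphs\<close>

lemma prod_abs_summable_on_PiE:
  fixes a :: "'e \<Rightarrow> 'i::countable \<Rightarrow> 'c::{real_normed_field,banach,second_countable_topology}"
  assumes "finite A" "\<And>e. e \<in> A \<Longrightarrow> (\<lambda>n. norm (a e n)) summable_on UNIV"
  shows "(\<lambda>n. norm (\<Prod>e\<in>A. a e (n e))) summable_on (PiE A (\<lambda>_. UNIV))"
  unfolding abs_summable_equivalent
  by (rule abs_summable_on_prod_PiE) (use assms in \<open>auto simp flip: abs_summable_equivalent\<close>)

lemma fourier_prod_has_sum:
  assumes "finite A" "\<And>e. e \<in> A \<Longrightarrow> (\<lambda>n. \<bar>a e n\<bar>) summable_on UNIV"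
  shows "((\<lambda>n. \<Prod>e\<in>A. of_real (a e (n e)) * circ (J e) powi n e) has_sum (\<Prod>e\<in>A. fourier (a e) (J e)))
    (PiE A (\<lambda>_. UNIV))"
proof -
  let ?f = "\<lambda>e n. of_real (a e n) * circ (J e) powi n"
  have s: "(\<lambda>n. norm (?f e n)) summable_on UNIV" if "e \<in> A" for e
    using assms(2)[OF that] by (simp add: norm_mult norm_power_int)
  have "(\<lambda>n. \<Prod>e\<in>A. ?f e (n e)) summable_on (PiE A (\<lambda>_. UNIV))"
    by (rule abs_summable_summable, rule prod_abs_summable_on_PiE[OF assms(1) s])
  moreover have "infsum (\<lambda>n. \<Prod>e\<in>A. ?f e (n e)) (PiE A (\<lambda>_. UNIV)) = (\<Prod>e\<in>A. infsum (?f e) UNIV)"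
    by (rule infsum_prod_PiE_abs[OF assms(1) s])
  ultimately show ?thesis
    unfolding fourier_def using has_sum_infsum by fastforce
qed

lemma H_star_antisym:
  assumes "n \<in> H_star D" "sym D"
  shows "n (y, x) = - n (x, y)"
proof -
  obtain h where n: "n = ext_d D h" using assms(1) by (auto simp: H_star_def)
  have "(x, y) \<in> D \<longleftrightarrow> (y, x) \<in> D" using assms(2) by (meson symE)
  then show ?thesis by (simp add: n ext_d_def)
qed

text \<open>Antisymmetry recovers an exact form from one orientation per edge. This transports sums
  over \<open>H_star D\<close> to sums over functions on \<open>orientation D\<close>, where
  products of series expand.\<close>

lemma inj_on_restrict_H_star:
  fixes D :: "('v::countable \<times> 'v) set"
  assumes D: "sym D" "irrefl D"
  shows "inj_on (\<lambda>n. restrict n (orientation D)) (H_star D)"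
proof (rule inj_onI)
  fix n n' assume n: "n \<in> H_star D" "n' \<in> H_star D"
    and eq: "restrict n (orientation D) = restrict n' (orientation D)"
  have eq': "n e = n' e" if "e \<in> orientation D" for e
    using fun_cong[OF eq, of e] that by simp
  show "n = n'"
  proof
    fix e :: "'v \<times> 'v"
    obtain x y where e: "e = (x, y)" by (cases e)
    consider "(x, y) \<notin> D" | "(x, y) \<in> orientation D" | "(y, x) \<in> orientation D"
      using orientation_iff[OF D(2,1)] by blast
    then show "n e = n' e"
    proof cases
      case 1
      then show ?thesis using n by (auto simp: H_star_def ext_d_def e)
    next
      case 2
      then show ?thesis using eq' by (simp add: e)
    next
      case 3
      then show ?thesis
        using eq'[OF 3] H_star_antisym[OF n(1) D(1), of y x] H_star_antisym[OF n(2) D(1), of y x]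
        by (simp add: e)
    qed
  qed
qed

lemma restrict_H_star_image:
  fixes D :: "('v::countable \<times> 'v) set"
  shows "(\<lambda>n. restrict n (orientation D)) ` H_star D =
    {n \<in> PiE (orientation D) (\<lambda>_. UNIV). \<exists>h. \<forall>e\<in>orientation D. n e = ext_d D h e}"
proof (intro set_eqI iffI)
  fix n assume "n \<in> {n \<in> PiE (orientation D) (\<lambda>_. UNIV). \<exists>h. \<forall>e\<in>orientation D. n e = ext_d D h e}"
  then obtain h where n: "n \<in> PiE (orientation D) (\<lambda>_. UNIV)" and h: "\<forall>e\<in>orientation D. n e = ext_d D h e"
    by blast
  have "n = restrict (ext_d D h) (orientation D)"
    using n h by (auto simp: fun_eq_iff PiE_def extensional_def restrict_def)
  then show "n \<in> (\<lambda>n. restrict n (orientation D)) ` H_star D"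
    by (auto simp: H_star_def)
qed (auto simp: H_star_def)

text \<open>Expanding the product into characters, Haar integration keeps exactly the exact forms.\<close>

lemma duality:
  fixes D :: "('v::countable \<times> 'v) set"
  assumes D: "finite D" "sym D" "irrefl D"
    and a: "\<And>e. e \<in> orientation D \<Longrightarrow> (\<lambda>n. \<bar>a e n\<bar>) summable_on UNIV"
  shows "((\<lambda>n. complex_of_real (\<Prod>e\<in>orientation D. a e (n e))) has_sum
    (\<integral>J. (\<Prod>e\<in>orientation D. fourier (a e) (J e)) \<partial>haar_diamond D)) (H_star D)"
proof -
  let ?O = "orientation D" and ?m = "haar_diamond D"
  let ?P = "PiE ?O (\<lambda>_. UNIV :: int set)"
  have m: "is_haar D ?m" by (rule is_haar_diamond[OF D])
  have sm [measurable_cong]: "sets ?m = sets borel" and pm: "prob_space ?m"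
    using m by (simp_all add: is_haar_def)
  have fin: "finite ?O" by (rule finite_orientation[OF D(1)])
  have [measurable]: "(\<lambda>J. circ (J e) powi k) \<in> borel_measurable borel" for e :: "'v \<times> 'v" and k
    unfolding power_int_def by measurable
  have "((\<lambda>n. \<integral>J. (\<Prod>e\<in>?O. of_real (a e (n e)) * circ (J e) powi n e) \<partial>?m) has_sum
      (\<integral>J. (\<Prod>e\<in>?O. fourier (a e) (J e)) \<partial>?m)) ?P"
  proof (rule has_sum_integral[OF pm])
    show "(\<lambda>J. \<Prod>e\<in>?O. of_real (a e (n e)) * circ (J e) powi n e) \<in> borel_measurable ?m" for n
      by measurable
    show "(\<lambda>J. \<Prod>e\<in>?O. fourier (a e) (J e)) \<in> borel_measurable ?m"
      using measurable_fourier[OF a]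
      by (intro borel_measurable_prod) (auto intro: measurable_compose[OF measurable_component] simp: measurable_cong_sets[OF sm refl])
    show "norm (\<Prod>e\<in>?O. of_real (a e (n e)) * circ (J e) powi n e) \<le> (\<Prod>e\<in>?O. \<bar>a e (n e)\<bar>)" for n J
      by (simp add: prod_norm [symmetric] norm_mult norm_power_int)
    show "(\<lambda>n. \<Prod>e\<in>?O. \<bar>a e (n e)\<bar>) summable_on ?P"
      using prod_abs_summable_on_PiE[OF fin, of a] a by (simp add: abs_prod)
    show "((\<lambda>n. \<Prod>e\<in>?O. of_real (a e (n e)) * circ (J e) powi n e) has_sum (\<Prod>e\<in>?O. fourier (a e) (J e))) ?P" for J
      by (rule fourier_prod_has_sum[OF fin a])
  qed
  moreover have "(\<integral>J. (\<Prod>e\<in>?O. of_real (a e (n e)) * circ (J e) powi n e) \<partial>?m) =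
      (if \<exists>h. \<forall>e\<in>?O. n e = ext_d D h e then of_real (\<Prod>e\<in>?O. a e (n e)) else 0)" for n
  proof -
    have "(\<integral>J. (\<Prod>e\<in>?O. of_real (a e (n e)) * circ (J e) powi n e) \<partial>?m) =
      (\<integral>J. of_real (\<Prod>e\<in>?O. a e (n e)) * (\<Prod>e\<in>?O. circ (J e) powi n e) \<partial>?m)"
      by (simp add: prod.distrib)
    also have "\<dots> = of_real (\<Prod>e\<in>?O. a e (n e)) * (\<integral>J. (\<Prod>e\<in>?O. circ (J e) powi n e) \<partial>?m)"
      by simp
    \<comment> \<open>The Fourier series see \<open>circ (J e)\<close>, the characters see
      \<open>J e\<close>; the two agree because Haar measure is carried by unit spins.\<close>
    also have "(\<integral>J. (\<Prod>e\<in>?O. circ (J e) powi n e) \<partial>?m) = (\<integral>J. (\<Prod>e\<in>?O. J e powi n e) \<partial>?m)"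
    proof (rule integral_cong_AE)
      have "(\<Prod>e\<in>?O. circ (J e) powi n e) = (\<Prod>e\<in>?O. J e powi n e)" if "J \<in> H_diamond D" for J
        proof -
        have "J \<in> circle_forms D" using that by (simp add: H_diamond_def)
        then show ?thesis by (intro prod.cong refl) (simp add: circle_formsD(1))
      qed
      then show "AE J in ?m. (\<Prod>e\<in>?O. circ (J e) powi n e) = (\<Prod>e\<in>?O. J e powi n e)"
        using m by (auto simp: is_haar_def elim!: eventually_mono)
      show "(\<lambda>J. \<Prod>e\<in>?O. J e powi n e) \<in> borel_measurable ?m"
        unfolding power_int_def by measurable
    qed measurable
    also have "\<dots> = of_bool (\<exists>h. \<forall>e\<in>?O. n e = ext_d D h e)"
      by (rule haar_character[OF D])
    finally show ?thesis by simp
  qed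
  ultimately have "((\<lambda>n. if \<exists>h. \<forall>e\<in>?O. n e = ext_d D h e then complex_of_real (\<Prod>e\<in>?O. a e (n e)) else 0) has_sum
      (\<integral>J. (\<Prod>e\<in>?O. fourier (a e) (J e)) \<partial>?m)) ?P"
    by simp
  also have "?this \<longleftrightarrow> ((\<lambda>n. complex_of_real (\<Prod>e\<in>?O. a e (n e))) has_sum
      (\<integral>J. (\<Prod>e\<in>?O. fourier (a e) (J e)) \<partial>?m)) ((\<lambda>n. restrict n ?O) ` H_star D)"
    unfolding restrict_H_star_image by (rule has_sum_cong_neutral) auto
  also have "\<dots> \<longleftrightarrow> ?thesis"
    by (subst has_sum_reindex[OF inj_on_restrict_H_star[OF D(2,3)]]) (simp add: comp_def)
  finally show ?thesis .
qed

lemma exp_neg_sum: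
  assumes "finite A" "\<And>e. e \<in> A \<Longrightarrow> f e \<noteq> -\<infinity>"
  shows "exp_neg (\<Sum>e\<in>A. f e) = (\<Prod>e\<in>A. exp_neg (f e))"
proof -
  have *: "exp_neg (x + y) = exp_neg x * exp_neg y" if "x \<noteq> -\<infinity>" "y \<noteq> -\<infinity>" for x y
    using that by (cases x; cases y) (simp_all add: exp_neg_def exp_minus exp_diff divide_inverse mult.commute exp_add)
  have "(\<Sum>e\<in>A. f e) \<noteq> -\<infinity> \<and> exp_neg (\<Sum>e\<in>A. f e) = (\<Prod>e\<in>A. exp_neg (f e))"
    using assms by (induction A rule: finite_induct) (auto simp: * , simp add: exp_neg_def)
  then show ?thesis by simp
qed

lemma emeasure_distr_point_measure:
  fixes p :: "'a \<Rightarrow> real"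
  assumes p: "\<And>n. n \<in> H \<Longrightarrow> 0 \<le> p n" "p summable_on H"
    and f: "f \<in> H \<rightarrow> space N" and A: "A \<in> sets N"
  shows "emeasure (distr (point_measure H (\<lambda>n. ennreal (p n))) N f) A = ennreal (infsum p {n \<in> H. f n \<in> A})"
proof -
  let ?B = "{n \<in> H. f n \<in> A}"
  have "emeasure (distr (point_measure H (\<lambda>n. ennreal (p n))) N f) A =
      emeasure (point_measure H (\<lambda>n. ennreal (p n))) ?B"
    using A f by (subst emeasure_distr) (auto simp: space_point_measure intro!: arg_cong2[where f = emeasure])
  also have "\<dots> = (\<integral>\<^sup>+n\<in>?B. ennreal (p n) \<partial>count_space H)"
    unfolding point_measure_def by (rule emeasure_density) auto
  also have "\<dots> = (\<integral>\<^sup>+n. ennreal (p n) \<partial>count_space ?B)"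
    by (subst nn_integral_count_space_indicator, simp, subst (2) nn_integral_count_space_indicator, simp)
      (auto intro!: nn_integral_cong simp: indicator_def)
  also have "\<dots> = ennreal (infsum p ?B)"
  proof -
    have "p summable_on ?B" using p(2) by (rule summable_on_subset_banach) auto
    then have "(\<lambda>n. norm (p n)) summable_on ?B"
      by (rule summable_on_cong[THEN iffD1, rotated]) (simp add: p(1))
    then show ?thesis
      using p(1) unfolding abs_summable_equivalent
      by (subst nn_integral_conv_infsetsum) (auto simp: infsetsum_infsum)
  qed
  finally show ?thesis .
qed

abbreviation cyl :: "'e set \<Rightarrow> ('e \<Rightarrow> int) \<Rightarrow> ('e \<Rightarrow> int) set" where
  "cyl F a \<equiv> {n. \<forall>e\<in>F. n e = a e}"

lemma cylinder_sets:
  fixes F :: "'e::countable set"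
  assumes "finite F"
  shows "{n. \<forall>e\<in>F. n e = (a e :: int)} \<in> sets borel"
proof -
  have "{n \<in> space borel. \<forall>e\<in>F. n e = (a e :: int)} \<in> sets borel"
    using assms by measurable
  then show ?thesis by simp
qed

section \<open>Cylinder probabilities of the height measure as spin expectations\<close>

context height_pot
begin

text \<open>The spin observable dual to the event that the gradient on one edge equals
  \<open>n\<close>. For fixed \<open>z\<close> these values sum to 1 over \<open>n\<close>, but they
  are complex, so they do not themselves form a probability.\<close>

definition q :: "int \<Rightarrow> complex \<Rightarrow> complex" where
  "q n z = of_real (c n) * circ z powi n / of_real (wt z)"

definition height_prob :: "('v::countable \<times> 'v) set \<Rightarrow> ('v \<times> 'v \<Rightarrow> int) \<Rightarrow> real" where
  "height_prob D n = height_mass V D n / (\<Sum>\<^sub>\<infinity>n'\<in>H_star D. height_mass V D n')"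

lemma measurable_q [measurable]: "q n \<in> borel_measurable borel"
  unfolding q_def power_int_def by measurable

text \<open>Fourier coefficients that fix the gradient to \<open>a e\<close> on the edges of
  \<open>F\<close> and keep the full weight elsewhere; inserted into \<open>duality\<close> they
  produce the mass of a cylinder.\<close>

definition pin :: "'e set \<Rightarrow> ('e \<Rightarrow> int) \<Rightarrow> 'e \<Rightarrow> int \<Rightarrow> real" where
  "pin F a e = (if e \<in> F then (\<lambda>n. if n = a e then c n else 0) else c)"

lemma summable_pin: "(\<lambda>n. \<bar>pin F a e n\<bar>) summable_on UNIV"
  by (rule summable_on_comparison_test[OF abs_summable_c0]) (auto simp: pin_def)

lemma fourier_pin: "fourier (pin F a e) z = of_real (wt z) * (if e \<in> F then q (a e) z else 1)"
proof (cases "e \<in> F")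
  case True
  then have "((\<lambda>n. of_real (pin F a e n) * circ z powi n) has_sum of_real (c (a e)) * circ z powi a e) UNIV"
    by (intro has_sum_finite_neutralI[of "{a e}"]) (auto simp: pin_def)
  then have "fourier (pin F a e) z = of_real (c (a e)) * circ z powi a e"
    unfolding fourier_def by (rule infsumI)
  then show ?thesis using True wt_pos[of z] by (simp add: q_def)
qed (simp add: pin_def fourier_c)

lemma prod_fourier_pin:
  assumes "finite A" "F \<subseteq> A"
  shows "(\<Prod>e\<in>A. fourier (pin F a e) (J e)) = of_real (\<Prod>e\<in>A. wt (J e)) * (\<Prod>e\<in>F. q (a e) (J e))"
proof -
  have "(\<Prod>e\<in>A. if e \<in> F then q (a e) (J e) else 1) = (\<Prod>e\<in>F. q (a e) (J e))"
    using assms by (simp add: prod.If_cases Int_absorb1)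
  then show ?thesis by (simp add: fourier_pin prod.distrib)
qed

lemma prod_pin:
  assumes "finite A" "F \<subseteq> A"
  shows "(\<Prod>e\<in>A. pin F a e (n e)) = (if \<forall>e\<in>F. n e = a e then \<Prod>e\<in>A. c (n e) else 0)"
proof (cases "\<forall>e\<in>F. n e = a e")
  case True
  then show ?thesis by (auto simp: pin_def intro!: prod.cong)
next
  case False
  then obtain e where "e \<in> F" "n e \<noteq> a e" by auto
  then show ?thesis using assms False by (auto simp: pin_def intro!: prod_zero)
qed

lemma spin_density_eq: "spin_density V D J = (\<Prod>e\<in>orientation D. wt (J e))"
  by (simp add: spin_density_def wt_def)

lemma height_mass_eq:
  assumes "finite D"
  shows "height_mass V D n = (\<Prod>e\<in>orientation D. c (n e))"
  unfolding height_mass_def c_def using V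
  by (intro exp_neg_sum finite_orientation assms) (simp add: height_potential_def)

context
  fixes D :: "('v::countable \<times> 'v) set"
  assumes D: "finite D" "sym D" "irrefl D"
begin

lemma haar_prob: "prob_space (haar_diamond D)" "sets (haar_diamond D) = sets borel"
  using is_haar_diamond[OF D] by (simp_all add: is_haar_def)

text \<open>\<open>duality\<close> with the coefficients \<open>c\<close> on every edge. The common
  value normalises both models, and convergence of the height sum comes with it.\<close>

lemma partition_function:
  "(height_mass V D has_sum (\<integral>J. spin_density V D J \<partial>haar_diamond D)) (H_star D)"
proof -
  have "((\<lambda>n. complex_of_real (\<Prod>e\<in>orientation D. c (n e))) has_sum
      (\<integral>J. (\<Prod>e\<in>orientation D. fourier c (J e)) \<partial>haar_diamond D)) (H_star D)"
    by (rule duality[OF D abs_summable_c0])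
  also have "(\<integral>J. (\<Prod>e\<in>orientation D. fourier c (J e)) \<partial>haar_diamond D) =
      of_real (\<integral>J. spin_density V D J \<partial>haar_diamond D)"
    by (simp add: fourier_c spin_density_eq flip: of_real_prod)
  finally show ?thesis
    unfolding height_mass_eq[OF D(1), abs_def] by (simp only: has_sum_of_real_iff)
qed

lemma measurable_spin_density [measurable]: "spin_density V D \<in> borel_measurable (haar_diamond D)"
proof -
  have "(\<lambda>J. \<Prod>e\<in>orientation D. wt (J e)) \<in> borel_measurable borel" by measurable
  then show ?thesis
    by (simp add: spin_density_eq[abs_def] measurable_cong_sets[OF haar_prob(2) refl])
qed

lemma partition_function_pos: "(\<integral>J. spin_density V D J \<partial>haar_diamond D) > 0"
proof -
  interpret prob_space "haar_diamond D" by (rule haar_prob)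
  obtain \<delta> where \<delta>: "\<delta> > 0" "\<And>z. \<delta> \<le> wt z" using wt_lower by metis
  obtain B where B: "\<And>z. wt z \<le> B" using wt_upper by metis
  have "integrable (haar_diamond D) (spin_density V D)"
  proof (intro integrable_const_bound[of _ "\<Prod>e\<in>orientation D. B"] always_eventually allI)
    fix J
    show "norm (spin_density V D J) \<le> (\<Prod>e\<in>orientation D. B)"
      unfolding spin_density_eq real_norm_def abs_prod
      using B wt_pos by (intro prod_mono) (simp add: less_imp_le)
  qed measurable
  then have "(\<integral>J. \<delta> ^ card (orientation D) \<partial>haar_diamond D) \<le> (\<integral>J. spin_density V D J \<partial>haar_diamond D)"
  proof (rule integral_mono[rotated])
    show "\<delta> ^ card (orientation D) \<le> spin_density V D J" for J
      unfolding spin_density_eq prod_constant[symmetric]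
      using \<delta> by (intro prod_mono) (simp add: less_imp_le)
  qed simp_all
  moreover have "(\<integral>J. \<delta> ^ card (orientation D) \<partial>haar_diamond D) > 0"
    using \<delta> by (simp add: prob_space)
  ultimately show ?thesis by linarith
qed

lemma height_prob_nonneg: "height_prob D n \<ge> 0"
  unfolding height_prob_def using D(1)
  by (intro divide_nonneg_nonneg infsum_nonneg) (simp_all add: height_mass_eq prod_nonneg)

lemma height_prob_has_sum: "(height_prob D has_sum 1) (H_star D)"
proof -
  have "((\<lambda>n. height_mass V D n / (\<integral>J. spin_density V D J \<partial>haar_diamond D)) has_sum 1) (H_star D)"
    using has_sum_divide_const[OF partition_function, of "\<integral>J. spin_density V D J \<partial>haar_diamond D"]
      partition_function_pos by simp
  then show ?thesis
    unfolding height_prob_def[abs_def] infsumI[OF partition_function] .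
qed

lemma emeasure_height_measure:
  assumes "A \<in> sets borel"
  shows "emeasure (height_measure V D) A = ennreal (infsum (height_prob D) (H_star D \<inter> A))"
  unfolding height_measure_def height_prob_def[symmetric]
  using emeasure_distr_point_measure[OF height_prob_nonneg has_sum_imp_summable[OF height_prob_has_sum], of "\<lambda>n. n" borel, OF _ assms]
  by (simp add: Int_def)

lemma sets_height_measure [simp, measurable_cong]: "sets (height_measure V D) = sets borel"
  by (simp add: height_measure_def)

lemma space_height_measure [simp]: "space (height_measure V D) = UNIV"
  by (simp add: height_measure_def)

lemma prob_space_height_measure: "prob_space (height_measure V D)"
  using emeasure_height_measure[of UNIV] height_prob_has_sum
  by (intro prob_spaceI) (simp add: infsumI)

lemma measure_height_measure:
  assumes "A \<in> sets borel"
  shows "measure (height_measure V D) A = infsum (height_prob D) (H_star D \<inter> A)"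
  unfolding measure_def emeasure_height_measure[OF assms]
  by (intro enn2real_ennreal infsum_nonneg height_prob_nonneg)

lemma AE_height_measure:
  assumes "{n \<in> space borel. P n} \<in> sets borel" "\<And>n. n \<in> H_star D \<Longrightarrow> P n"
  shows "AE n in height_measure V D. P n"
  unfolding height_measure_def using assms
  by (subst AE_distr_iff) (auto simp: space_point_measure)

text \<open>Divide \<open>duality\<close> for the coefficients \<open>pin F a\<close> by the common
  partition function. On the height side the pinned sum is the mass of the cylinder; on the spin
  side every pinned edge has its factor \<open>wt\<close> replaced by \<open>wt * q\<close>.\<close>

lemma height_cylinder:
  assumes F: "F \<subseteq> orientation D"
  shows "complex_of_real (measure (height_measure V D) (cyl F a)) =
    (\<integral>J. (\<Prod>e\<in>F. q (a e) (J e)) \<partial>spin_measure V D)"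
proof -
  let ?O = "orientation D" and ?Z = "\<integral>J. spin_density V D J \<partial>haar_diamond D"
  let ?A = "cyl F a"
  have fin: "finite ?O" "finite F"
    using finite_orientation[OF D(1)] F finite_subset by blast+
  have "((\<lambda>n. complex_of_real (\<Prod>e\<in>?O. pin F a e (n e))) has_sum
      (\<integral>J. (\<Prod>e\<in>?O. fourier (pin F a e) (J e)) \<partial>haar_diamond D)) (H_star D)"
    by (rule duality[OF D summable_pin])
  also have "?this \<longleftrightarrow> ((\<lambda>n. complex_of_real (height_mass V D n)) has_sum
      (\<integral>J. (\<Prod>e\<in>?O. fourier (pin F a e) (J e)) \<partial>haar_diamond D)) (H_star D \<inter> ?A)"
    unfolding prod_pin[OF fin(1) F] height_mass_eq[OF D(1)] by (rule has_sum_cong_neutral) auto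
  finally have "((\<lambda>n. complex_of_real (height_mass V D n) / of_real ?Z) has_sum
      (\<integral>J. (\<Prod>e\<in>?O. fourier (pin F a e) (J e)) \<partial>haar_diamond D) / of_real ?Z) (H_star D \<inter> ?A)"
    by (rule has_sum_divide_const)
  moreover have "height_prob D n = height_mass V D n / ?Z" for n
    using partition_function by (simp add: height_prob_def infsumI)
  ultimately have "((\<lambda>n. complex_of_real (height_prob D n)) has_sum
      (\<integral>J. (\<Prod>e\<in>?O. fourier (pin F a e) (J e)) \<partial>haar_diamond D) / of_real ?Z) (H_star D \<inter> ?A)"
    by simp
  then have "complex_of_real (measure (height_measure V D) ?A) =
      (\<integral>J. (\<Prod>e\<in>?O. fourier (pin F a e) (J e)) \<partial>haar_diamond D) / of_real ?Z"
    unfolding measure_height_measure[OF cylinder_sets[OF fin(2)]]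
    by (intro has_sum_unique[OF has_sum_of_real[OF has_sum_infsum]]
        summable_on_subset_banach[OF has_sum_imp_summable[OF height_prob_has_sum]]) auto
  also have "\<dots> = (\<integral>J. (spin_density V D J / ?Z) *\<^sub>R (\<Prod>e\<in>F. q (a e) (J e)) \<partial>haar_diamond D)"
  proof -
    have "(\<Prod>e\<in>?O. fourier (pin F a e) (J e)) / of_real ?Z = (spin_density V D J / ?Z) *\<^sub>R (\<Prod>e\<in>F. q (a e) (J e))" for J
      unfolding prod_fourier_pin[OF fin(1) F] by (simp add: spin_density_eq scaleR_conv_of_real)
    then show ?thesis by (simp flip: integral_divide_zero)
  qed
  also have "\<dots> = (\<integral>J. (\<Prod>e\<in>F. q (a e) (J e)) \<partial>spin_measure V D)"
  proof -
    have "(\<lambda>J. \<Prod>e\<in>F. q (a e) (J e)) \<in> borel_measurable borel" by measurable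
    then have "(\<lambda>J. \<Prod>e\<in>F. q (a e) (J e)) \<in> borel_measurable (haar_diamond D)"
      by (simp add: measurable_cong_sets[OF haar_prob(2) refl])
    moreover have "0 \<le> spin_density V D J / ?Z" for J
      using partition_function_pos wt_pos by (intro divide_nonneg_pos) (auto simp: spin_density_eq less_imp_le intro!: prod_nonneg)
    ultimately show ?thesis
      unfolding spin_measure_def by (subst integral_density) simp_all
  qed
  finally show ?thesis .
qed

end

end

section \<open>Tori and limits\<close>

lemma Z2_facts: "sym Z2" "irrefl Z2"
  by (auto simp: Z2_def sym_def irrefl_def abs_minus_commute)

lemma mem_torus_box:
  "(a, b) \<in> torus_box N \<longleftrightarrow> - (2 ^ N) \<le> 2 * a \<and> 2 * a < 2 ^ N \<and> - (2 ^ N) \<le> 2 * b \<and> 2 * b < 2 ^ N"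
  by (auto simp: torus_box_def Let_def)

lemma finite_torus_box: "finite (torus_box N)"
proof -
  have "torus_box N \<subseteq> {- (2 ^ N)..2 ^ N} \<times> {- (2 ^ N)..2 ^ N}"
    by (auto simp: mem_torus_box)
  then show ?thesis by (rule finite_subset) simp
qed

lemma finite_torus: "finite (torus N)"
  using finite_torus_box[of N]
  by (intro finite_subset[of "torus N" "torus_box N \<times> torus_box N"]) (auto simp: torus_def)

lemma irrefl_torus: "irrefl (torus N)"
  by (auto simp: torus_def irrefl_def)

lemma sym_torus: "sym (torus N)"
proof (rule symI)
  fix x y assume "(x, y) \<in> torus N"
  then obtain z where z: "x \<in> torus_box N" "y \<in> torus_box N" "x \<noteq> y" "(x, z) \<in> Z2"
      "[fst z = fst y] (mod 2 ^ N)" "[snd z = snd y] (mod 2 ^ N)"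
    by (auto simp: torus_def)
  \<comment> \<open>The lift of the reversed edge: \<open>y\<close> displaced by the opposite of the
    step from \<open>x\<close> to \<open>z\<close>.\<close>
  define z' where "z' = (fst y + fst x - fst z, snd y + snd x - snd z)"
  have "(y, z') \<in> Z2"
    using z(4) by (auto simp: Z2_def z'_def)
  moreover have "[fst z' = fst x] (mod 2 ^ N)" "[snd z' = snd x] (mod 2 ^ N)"
    using z(5,6) by (auto simp: z'_def cong_iff_dvd_diff algebra_simps dvd_diff_commute)
  ultimately show "(y, x) \<in> torus N"
    unfolding torus_def using z(1-3) by blast
qed

lemmas torus_graph = finite_torus sym_torus irrefl_torus

lemma ex_box:
  assumes "finite (W :: point set)"
  obtains K :: nat where "\<And>a b. (a, b) \<in> W \<Longrightarrow> \<bar>a\<bar> \<le> int K \<and> \<bar>b\<bar> \<le> int K"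
proof -
  let ?f = "\<lambda>(a, b). nat \<bar>a\<bar> + nat \<bar>b\<bar>"
  have "\<bar>a\<bar> \<le> int (Max (?f ` W)) \<and> \<bar>b\<bar> \<le> int (Max (?f ` W))" if "(a, b) \<in> W" for a b
  proof -
    have "?f (a, b) \<le> Max (?f ` W)" using assms that by (intro Max_ge) auto
    then show ?thesis by auto
  qed
  then show thesis using that by blast
qed

lemma mem_torus_box_large:
  assumes "\<bar>a\<bar> \<le> int K" "\<bar>b\<bar> \<le> int K" "K + 1 \<le> N"
  shows "(a, b) \<in> torus_box N"
proof -
  \<comment> \<open>Doubling this gives \<open>2 * K < 2 ^ (K + 1)\<close>, which is why
    \<open>N \<ge> K + 1\<close> suffices.\<close>
  have "K < 2 ^ K" by (rule less_exp)
  moreover have "2 * 2 ^ K \<le> (2::nat) ^ N"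
    unfolding power_Suc[symmetric] using assms(3) by (intro power_increasing) auto
  ultimately have "2 * K < 2 ^ N" by linarith
  then have "2 * int K < 2 ^ N" by (metis of_nat_less_iff of_nat_mult of_nat_numeral of_nat_power)
  then show ?thesis using assms(1,2) by (auto simp: mem_torus_box)
qed

lemma Z2_in_torus:
  assumes "(x, y) \<in> Z2" "x \<in> torus_box N" "y \<in> torus_box N"
  shows "(x, y) \<in> torus N"
proof -
  have "x \<noteq> y" using assms(1) by (auto simp: Z2_def)
  moreover have "\<exists>z. (x, z) \<in> Z2 \<and> [fst z = fst y] (mod 2 ^ N) \<and> [snd z = snd y] (mod 2 ^ N)"
    using assms(1) by (intro exI[of _ y]) simp
  ultimately show ?thesis
    unfolding torus_def using assms(2,3) by blast
qed

lemma eventually_box: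
  assumes "finite W"
  shows "\<forall>\<^sub>F N in sequentially. W \<subseteq> torus_box N"
proof -
  obtain K :: nat where "\<And>a b. (a, b) \<in> W \<Longrightarrow> \<bar>a\<bar> \<le> int K \<and> \<bar>b\<bar> \<le> int K"
    using ex_box[OF assms] by blast
  then show ?thesis
    by (intro eventually_sequentiallyI[of "K + 1"]) (metis mem_torus_box_large subrelI)
qed

lemma eventually_torus:
  assumes "finite F" "F \<subseteq> Z2"
  shows "\<forall>\<^sub>F N in sequentially. F \<subseteq> torus N"
proof -
  have "\<forall>\<^sub>F N in sequentially. fst ` F \<union> snd ` F \<subseteq> torus_box N"
    using assms(1) by (intro eventually_box) auto
  then show ?thesis
  proof eventually_elim
    case (elim N)
    show ?case
    proof
      fix e assume "e \<in> F"
      then show "e \<in> torus N"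
        using elim assms(2) by (cases e) (force intro!: Z2_in_torus)
    qed
  qed
qed

text \<open>The orientation is decided by \<open>to_nat\<close> alone, so a lattice edge that occurs
  in a torus is oriented there in the same way.\<close>

lemma eventually_orientation_torus:
  assumes "finite F" "F \<subseteq> orientation Z2"
  shows "\<forall>\<^sub>F N in sequentially. F \<subseteq> orientation (torus N)"
proof -
  have "F \<subseteq> Z2" using assms(2) orientation_subset by blast
  from eventually_torus[OF assms(1) this] show ?thesis
    by eventually_elim (use assms(2) in \<open>auto simp: orientation_def\<close>)
qed

context height_pot
begin

text \<open>Summing \<open>q\<close> over the values on an edge gives 1, so the edges outside
  \<open>F\<close> are summed out pointwise in \<open>J\<close>. Both the consistency and the total
  mass 1 of the limiting cylinder probabilities come from here.\<close>

lemma q_prod_has_sum: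
  assumes "finite H" "F \<subseteq> H"
  shows "((\<lambda>b. \<Prod>e\<in>H. q (b e) (J e)) has_sum (\<Prod>e\<in>F. q (a e) (J e)))
    {b \<in> PiE H (\<lambda>_. UNIV). \<forall>e\<in>F. b e = a e}"
proof -
  let ?w = "complex_of_real (\<Prod>e\<in>H. wt (J e))"
  have w: "?w \<noteq> 0"
    using wt_pos assms(1) by (simp add: prod_zero_iff less_imp_neq[symmetric])
  have "((\<lambda>b. \<Prod>e\<in>H. of_real (pin F a e (b e)) * circ (J e) powi b e) has_sum
      (\<Prod>e\<in>H. fourier (pin F a e) (J e))) (PiE H (\<lambda>_. UNIV))"
    by (rule fourier_prod_has_sum[OF assms(1) summable_pin])
  then have "((\<lambda>b. (\<Prod>e\<in>H. of_real (pin F a e (b e)) * circ (J e) powi b e) / ?w) has_sum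
      (\<Prod>e\<in>H. fourier (pin F a e) (J e)) / ?w) (PiE H (\<lambda>_. UNIV))"
    by (rule has_sum_divide_const)
  also have "(\<Prod>e\<in>H. fourier (pin F a e) (J e)) / ?w = (\<Prod>e\<in>F. q (a e) (J e))"
    unfolding prod_fourier_pin[OF assms] using w by simp
  also have "((\<lambda>b. (\<Prod>e\<in>H. of_real (pin F a e (b e)) * circ (J e) powi b e) / ?w) has_sum
      (\<Prod>e\<in>F. q (a e) (J e))) (PiE H (\<lambda>_. UNIV)) \<longleftrightarrow> ?thesis"
  proof (rule has_sum_cong_neutral)
    fix b assume "b \<in> PiE H (\<lambda>_. UNIV) - {b \<in> PiE H (\<lambda>_. UNIV). \<forall>e\<in>F. b e = a e}"
    then have "(\<Prod>e\<in>H. pin F a e (b e)) = 0"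
      by (subst prod_pin[OF assms]) auto
    then show "(\<Prod>e\<in>H. of_real (pin F a e (b e)) * circ (J e) powi b e) / ?w = 0"
      by (simp add: prod.distrib flip: of_real_prod)
  next
    fix b assume "b \<in> PiE H (\<lambda>_. UNIV) \<inter> {b \<in> PiE H (\<lambda>_. UNIV). \<forall>e\<in>F. b e = a e}"
    then have "(\<Prod>e\<in>H. pin F a e (b e)) = (\<Prod>e\<in>H. c (b e))"
      by (subst prod_pin[OF assms]) auto
    then show "(\<Prod>e\<in>H. of_real (pin F a e (b e)) * circ (J e) powi b e) / ?w = (\<Prod>e\<in>H. q (b e) (J e))"
      by (simp add: prod.distrib q_def prod_dividef flip: of_real_prod)
  qed auto
  finally show ?thesis .
qed

lemma norm_q: "norm (q n z) = c n / wt z"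
  using wt_pos[of z] by (simp add: q_def norm_mult norm_divide norm_power_int)

lemma q_bound: obtains B where "\<And>n z. norm (q n z) \<le> B * c n" "B \<ge> 0"
proof -
  obtain \<delta> where \<delta>: "\<delta> > 0" "\<And>z. \<delta> \<le> wt z" using wt_lower by metis
  have "norm (q n z) \<le> 1 / \<delta> * c n" for n z
    using \<delta> frac_le[OF c_nonneg order_refl \<delta>(1) \<delta>(2), of n z] by (simp add: norm_q)
  then show thesis using that \<delta>(1) by (meson less_imp_le zero_less_divide_1_iff)
qed

text \<open>The bound is uniform in \<open>J\<close> and, for a fixed finite \<open>F\<close>,
  summable in \<open>a\<close>: the domination needed to exchange sums over gradients with spin
  integrals.\<close>

lemma norm_q_prod:
  "\<exists>B\<ge>0. \<forall>(F :: 'e set) a J. norm (\<Prod>e\<in>F. q (a e) (J e)) \<le> B ^ card F * (\<Prod>e\<in>F. c (a e))"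
proof -
  obtain B where B: "\<And>n z. norm (q n z) \<le> B * c n" "B \<ge> 0" using q_bound by metis
  have "norm (\<Prod>e\<in>F. q (a e) (J e)) \<le> B ^ card F * (\<Prod>e\<in>F. c (a e))"
    for F :: "'e set" and a J
  proof -
    have "norm (\<Prod>e\<in>F. q (a e) (J e)) \<le> (\<Prod>e\<in>F. B * c (a e))"
      unfolding prod_norm[symmetric] by (intro prod_mono) (simp add: B)
    then show ?thesis by (simp add: prod.distrib)
  qed
  then show ?thesis using B(2) by blast
qed

lemma summable_prod_c:
  assumes "finite H"
  shows "(\<lambda>b. \<Prod>e\<in>H. c (b e)) summable_on PiE H (\<lambda>_. UNIV)"
  using prod_abs_summable_on_PiE[OF assms, of "\<lambda>_. c"] abs_summable_c0 by (simp add: abs_prod)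

text \<open>Weak convergence is tested by functions continuous on the whole plane, whereas
  \<open>circ\<close> jumps at the origin. The Tietze extension keeps the values on the circle,
  where the spins live.\<close>

lemma q_extension:
  obtains g where "continuous_on UNIV (g :: complex \<Rightarrow> complex)" "bounded (range g)"
    "\<And>z. norm z = 1 \<Longrightarrow> g z = q n z"
proof -
  obtain B where B: "\<And>z. norm (q n z) \<le> B * c n" "B \<ge> 0" using q_bound by metis
  have "continuous_on (sphere 0 1) (\<lambda>z. of_real (c n) * z powi n / of_real (wt z))"
    using wt_pos by (intro continuous_intros continuous_on_power_int_sphere continuous_on_wt)
      (auto simp: less_imp_neq[symmetric])
  then have cont: "continuous_on (sphere 0 1) (q n)"
    by (rule continuous_on_eq) (simp add: q_def)
  obtain g where g: "continuous_on UNIV g" "\<And>z. z \<in> sphere 0 1 \<Longrightarrow> g z = q n z"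
      "\<And>z. z \<in> UNIV \<Longrightarrow> norm (g z) \<le> B * c n"
    using Tietze[OF cont, of UNIV "B * c n"] B by auto
  show thesis
  proof (rule that[OF g(1)])
    show "bounded (range g)" using g(3) by (auto simp: bounded_iff)
  qed (use g(2) in auto)
qed

end

section \<open>Cylinder probabilities in the limit of the tori\<close>

locale spin_lim = height_pot +
  fixes r :: "nat \<Rightarrow> nat" and \<mu> :: "(point \<times> point \<Rightarrow> complex) measure"
  assumes r: "strict_mono r" and \<mu>: "spin_limit V r \<mu>"
begin

sublocale M: prob_space \<mu>
  using \<mu> by (simp add: spin_limit_def)

lemma sets_\<mu> [simp, measurable_cong]: "sets \<mu> = sets borel"
  using \<mu> by (simp add: spin_limit_def)

lemma measurable_\<mu>: "f \<in> borel_measurable borel \<Longrightarrow> f \<in> borel_measurable \<mu>"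
  by (simp add: measurable_cong_sets[OF sets_\<mu> refl])

lemma measurable_\<mu>_component: "f \<in> borel_measurable borel \<Longrightarrow> (\<lambda>J. f (J e)) \<in> borel_measurable \<mu>"
  by (intro measurable_\<mu> measurable_compose[OF measurable_component])

lemma eventually_r: "eventually P sequentially \<Longrightarrow> \<forall>\<^sub>F k in sequentially. P (r k)"
  by (rule eventually_compose_filterlim[OF _ filterlim_subseq[OF r]])

text \<open>Candidate for the probability that the limiting gradient equals \<open>a\<close> on
  \<open>F\<close>, read off from the spin limit. \<open>Re\<close> only adjusts the type: on a
  torus that contains \<open>F\<close> the corresponding expectation is real by
  \<open>height_cylinder\<close>.\<close>

definition \<rho> :: "(point \<times> point) set \<Rightarrow> (point \<times> point \<Rightarrow> int) \<Rightarrow> real" where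
  "\<rho> F a = Re (\<integral>J. (\<Prod>e\<in>F. q (a e) (J e)) \<partial>\<mu>)"

text \<open>On a torus whose orientation contains \<open>F\<close>, the cylinder probability is the
  spin expectation of a bounded continuous local function, once \<open>q\<close> is replaced by its
  extension.\<close>

lemma \<rho>_limit:
  assumes F: "finite F" "F \<subseteq> orientation Z2"
  shows "(\<lambda>k. measure (height_measure V (torus (r k))) (cyl F a)) \<longlonglongrightarrow> \<rho> F a"
proof -
  have "\<exists>g. continuous_on UNIV (g :: complex \<Rightarrow> complex) \<and> bounded (range g) \<and> (\<forall>z. norm z = 1 \<longrightarrow> g z = q n z)" for n
    using q_extension by metis
  then obtain g where g: "\<And>n. continuous_on UNIV (g n :: complex \<Rightarrow> complex)" "\<And>n. bounded (range (g n))"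
      "\<And>n z. norm z = 1 \<Longrightarrow> g n z = q n z"
    by metis
  have [measurable]: "g n \<in> borel_measurable borel" for n
    by (rule borel_measurable_continuous_onI[OF g(1)])
  obtain B where B: "\<And>(F :: (point \<times> point) set) a J. norm (\<Prod>e\<in>F. q (a e) (J e)) \<le> B ^ card F * (\<Prod>e\<in>F. c (a e))"
    using norm_q_prod by blast
  define f where "f \<omega> = Re (\<Prod>e\<in>F. g (a e) (\<omega> e))" for \<omega> :: "point \<times> point \<Rightarrow> complex"
  have f_restrict: "f (restrict \<omega> F) = f \<omega>" for \<omega>
    by (auto simp: f_def intro!: arg_cong[where f = Re] prod.cong)
  have cont: "continuous_on UNIV f"
    unfolding f_def
    by (intro continuous_intros continuous_on_prod
        continuous_on_compose2[OF g(1)] continuous_on_product_coordinates) auto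
  have bdd: "bounded (range f)"
  proof -
    have "\<exists>B. \<forall>z. norm (g n z) \<le> B" for n
      using g(2)[of n] by (auto simp: bounded_iff)
    then obtain B where B: "\<And>n z. norm (g n z) \<le> B n" by metis
    have "\<bar>f \<omega>\<bar> \<le> (\<Prod>e\<in>F. B (a e))" for \<omega>
    proof -
      have "\<bar>f \<omega>\<bar> \<le> norm (\<Prod>e\<in>F. g (a e) (\<omega> e))"
        unfolding f_def by (rule abs_Re_le_cmod)
      also have "\<dots> \<le> (\<Prod>e\<in>F. B (a e))"
        unfolding prod_norm[symmetric] by (intro prod_mono) (simp add: B)
      finally show ?thesis .
    qed
    then show ?thesis by (auto simp: bounded_iff)
  qed
  have [measurable]: "f \<in> borel_measurable borel"
    by (rule borel_measurable_continuous_onI[OF cont])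
  have [measurable]: "(\<lambda>J. \<Prod>e\<in>F. q (a e) (J e)) \<in> borel_measurable borel" by measurable
  have f_eq: "f J = Re (\<Prod>e\<in>F. q (a e) (J e))" if "J \<in> H_diamond D" for J D
  proof -
    have "J \<in> circle_forms D" using that by (simp add: H_diamond_def)
    then show ?thesis unfolding f_def
      by (intro arg_cong[where f = Re] prod.cong refl g(3) circle_formsD(1))
  qed
  have "(\<lambda>k. \<integral>J. f (restrict J F) \<partial>spin_measure V (torus (r k))) \<longlonglongrightarrow> (\<integral>J. f (restrict J F) \<partial>\<mu>)"
    using \<mu> F cont bdd orientation_subset[of Z2] unfolding spin_limit_def local_weak_limit_def
    by (meson subset_trans)
  moreover have "(\<integral>J. f (restrict J F) \<partial>\<mu>) = \<rho> F a"
  proof -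
    have "(\<integral>J. f (restrict J F) \<partial>\<mu>) = (\<integral>J. Re (\<Prod>e\<in>F. q (a e) (J e)) \<partial>\<mu>)"
    proof (rule integral_cong_AE)
      show "AE J in \<mu>. f (restrict J F) = Re (\<Prod>e\<in>F. q (a e) (J e))"
        using \<mu> unfolding spin_limit_def f_restrict by (auto elim!: eventually_mono simp: f_eq)
    qed (auto simp: f_restrict intro!: measurable_\<mu>)
    also have "\<dots> = \<rho> F a"
      unfolding \<rho>_def
    proof (rule integral_Re)
      show "integrable \<mu> (\<lambda>J. \<Prod>e\<in>F. q (a e) (J e))"
        by (rule M.integrable_const_bound[OF always_eventually measurable_\<mu>]) (rule allI, rule B, measurable)
    qed
    finally show ?thesis .
  qed
  moreover have "\<forall>\<^sub>F k in sequentially. (\<integral>J. f (restrict J F) \<partial>spin_measure V (torus (r k))) =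
      measure (height_measure V (torus (r k))) (cyl F a)"
    using eventually_r[OF eventually_orientation_torus[OF F]]
  proof eventually_elim
    case (elim k)
    let ?D = "torus (r k)"
    let ?M = "spin_measure V ?D"
    have m: "is_haar ?D (haar_diamond ?D)" by (rule is_haar_diamond[OF torus_graph])
    then have s: "sets (haar_diamond ?D) = sets borel" by (simp add: is_haar_def)
    then have sM: "sets ?M = sets borel" by (simp add: spin_measure_def)
    have meas: "h \<in> borel_measurable borel \<Longrightarrow> h \<in> borel_measurable ?M" for h :: "_ \<Rightarrow> 'z::topological_space"
      by (simp add: measurable_cong_sets[OF sM refl])
    have AE: "AE J in ?M. J \<in> H_diamond ?D"
    proof -
      have "(\<lambda>J. ennreal (spin_density V ?D J / (\<integral>J'. spin_density V ?D J' \<partial>haar_diamond ?D)))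
          \<in> borel_measurable (haar_diamond ?D)"
        using measurable_spin_density[OF torus_graph] by measurable
      then show ?thesis
        unfolding spin_measure_def using m by (subst AE_density) (auto simp: is_haar_def elim!: eventually_mono)
    qed
    have eq: "(\<integral>J. (\<Prod>e\<in>F. q (a e) (J e)) \<partial>?M) = of_real (measure (height_measure V ?D) (cyl F a))"
      by (rule height_cylinder[OF torus_graph elim, symmetric])
    have "(\<integral>J. f (restrict J F) \<partial>?M) = (\<integral>J. Re (\<Prod>e\<in>F. q (a e) (J e)) \<partial>?M)"
    proof (rule integral_cong_AE)
      show "AE J in ?M. f (restrict J F) = Re (\<Prod>e\<in>F. q (a e) (J e))"
        using AE unfolding f_restrict by (auto elim!: eventually_mono simp: f_eq)
    qed (auto simp: f_restrict intro!: meas)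
    also have "\<dots> = measure (height_measure V ?D) (cyl F a)"
    proof -
      \<comment> \<open>The empty condition has height probability 1, so the same duality identity
        yields the total mass of the spin measure.\<close>
      have "(\<integral>J. (\<Prod>e\<in>{}. q (a e) (J e)) \<partial>?M) = of_real (measure (height_measure V ?D) {n. \<forall>e\<in>{}. n e = a e})"
        by (rule height_cylinder[OF torus_graph, symmetric]) simp
      then have "of_real (measure ?M (space ?M)) = complex_of_real 1"
        using prob_space.prob_space[OF prob_space_height_measure[OF torus_graph]]
        by (simp add: space_height_measure[OF torus_graph] scaleR_conv_of_real)
      then have "measure ?M (space ?M) = 1" by (simp only: of_real_eq_iff)
      \<comment> \<open>\<open>measure\<close> returns 0 on a set of infinite measure; the value 1
        excludes that case.\<close>
      then have "emeasure ?M (space ?M) = 1"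
        by (metis emeasure_eq_ennreal_measure ennreal_1 infinity_ennreal_def measure_def enn2real_top zero_neq_one)
      then interpret S: prob_space ?M by (rule prob_spaceI)
      have "integrable ?M (\<lambda>J. \<Prod>e\<in>F. q (a e) (J e))"
        by (rule S.integrable_const_bound[OF always_eventually meas]) (rule allI, rule B, measurable)
      then show ?thesis by (simp add: integral_Re eq)
    qed
    finally show ?case .
  qed
  ultimately show ?thesis
    by (simp add: tendsto_cong)
qed

lemma \<rho>_nonneg:
  assumes F: "finite F" "F \<subseteq> orientation Z2"
  shows "\<rho> F a \<ge> 0"
  by (rule LIMSEQ_le_const[OF \<rho>_limit[OF F, of a]]) auto

text \<open>Integrate the pointwise identity for \<open>q\<close>. The domination excludes a loss of
  mass although the gradients are unbounded.\<close>

lemma \<rho>_has_sum: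
  assumes H: "finite H" "F \<subseteq> H"
  shows "(\<rho> H has_sum \<rho> F a) {b \<in> PiE H (\<lambda>_. UNIV). \<forall>e\<in>F. b e = a e}"
proof -
  obtain B where B: "\<And>(F :: (point \<times> point) set) a J. norm (\<Prod>e\<in>F. q (a e) (J e)) \<le> B ^ card F * (\<Prod>e\<in>F. c (a e))"
    using norm_q_prod by blast
  have "((\<lambda>b. \<integral>J. (\<Prod>e\<in>H. q (b e) (J e)) \<partial>\<mu>) has_sum (\<integral>J. (\<Prod>e\<in>F. q (a e) (J e)) \<partial>\<mu>))
      {b \<in> PiE H (\<lambda>_. UNIV). \<forall>e\<in>F. b e = a e}"
  proof (rule has_sum_integral)
    show "prob_space \<mu>" by (rule M.prob_space_axioms)
    show "((\<lambda>b. \<Prod>e\<in>H. q (b e) (J e)) has_sum (\<Prod>e\<in>F. q (a e) (J e)))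
      {b \<in> PiE H (\<lambda>_. UNIV). \<forall>e\<in>F. b e = a e}" for J
      by (rule q_prod_has_sum[OF H])
    show "norm (\<Prod>e\<in>H. q (b e) (J e)) \<le> B ^ card H * (\<Prod>e\<in>H. c (b e))" for b J
      by (rule B)
    show "(\<lambda>b. B ^ card H * (\<Prod>e\<in>H. c (b e))) summable_on {b \<in> PiE H (\<lambda>_. UNIV). \<forall>e\<in>F. b e = a e}"
      by (intro summable_on_cmult_right summable_on_subset_banach[OF summable_prod_c[OF H(1)]]) auto
  qed (intro measurable_\<mu>, measurable)+
  then show ?thesis
    unfolding \<rho>_def by (rule has_sum_Re)
qed

end

section \<open>Existence of the height limit\<close>

definition box :: "nat \<Rightarrow> point set" where
  "box K = {(a, b). \<bar>a\<bar> \<le> int K \<and> \<bar>b\<bar> \<le> int K}"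

lemma finite_box: "finite (box K)"
proof -
  have "box K \<subseteq> {- int K..int K} \<times> {- int K..int K}" by (auto simp: box_def)
  then show ?thesis by (rule finite_subset) simp
qed

text \<open>Walk towards the origin along the first coordinate and then along the second; the path
  never leaves the box.\<close>

lemma box_const:
  assumes edge: "\<And>x y. (x, y) \<in> Z2 \<Longrightarrow> x \<in> box K \<Longrightarrow> y \<in> box K \<Longrightarrow> \<phi> x = \<phi> y"
    and v: "v \<in> box K"
  shows "\<phi> v = \<phi> (0, 0)"
  using v
proof (induction "nat \<bar>fst v\<bar> + nat \<bar>snd v\<bar>" arbitrary: v rule: less_induct)
  case less
  obtain a b where v: "v = (a, b)" by (cases v)
  have step: "\<phi> v = \<phi> (0, 0)" if "(v, w) \<in> Z2" "w \<in> box K" "nat \<bar>fst w\<bar> + nat \<bar>snd w\<bar> < nat \<bar>fst v\<bar> + nat \<bar>snd v\<bar>" for w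
    using edge[OF that(1) less.prems that(2)] less.hyps[OF that(3,2)] by simp
  consider "a > 0" | "a < 0" | "a = 0" "b > 0" | "a = 0" "b < 0" | "a = 0" "b = 0" by linarith
  then show ?case
  proof cases
    case 1 then show ?thesis using less.prems by (intro step[of "(a - 1, b)"]) (auto simp: v Z2_def box_def)
  next
    case 2 then show ?thesis using less.prems by (intro step[of "(a + 1, b)"]) (auto simp: v Z2_def box_def)
  next
    case 3 then show ?thesis using less.prems by (intro step[of "(a, b - 1)"]) (auto simp: v Z2_def box_def)
  next
    case 4 then show ?thesis using less.prems by (intro step[of "(a, b + 1)"]) (auto simp: v Z2_def box_def)
  qed (simp add: v)
qed

text \<open>Almost sure exactness is at hand for finite sets of edges only. Potentials on nested
  boxes differ by a constant on the smaller box, so normalising them at the origin makes them agree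
  and glue together.\<close>

lemma exact_if_box_exact:
  assumes off: "\<And>e. e \<notin> Z2 \<Longrightarrow> n e = 0" and anti: "\<And>x y. n (y, x) = - n (x, y)"
    and ex: "\<And>K. \<exists>h. \<forall>e\<in>orientation Z2 \<inter> (box K \<times> box K). n e = ext_d Z2 h e"
  shows "n \<in> H_star Z2"
proof -
  obtain h where h: "\<And>K. \<forall>e\<in>orientation Z2 \<inter> (box K \<times> box K). n e = ext_d Z2 (h K) e"
    using ex by metis
  have h_edge: "n (x, y) = h K y - h K x" if xy: "(x, y) \<in> Z2" "x \<in> box K" "y \<in> box K" for K x y
  proof (cases "(x, y) \<in> orientation Z2")
    case True
    then show ?thesis using h[of K] that by (auto simp: ext_d_def)
  next
    case False
    then have "(y, x) \<in> orientation Z2" using orientation_iff[OF Z2_facts(2,1) xy(1)] by blast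
    moreover from this have "(y, x) \<in> Z2" using orientation_subset by blast
    ultimately have "n (y, x) = h K x - h K y"
      using bspec[OF h[of K], of "(y, x)"] that by (simp add: ext_d_def)
    then show ?thesis using anti[of x y] by linarith
  qed
  have compat: "h K v - h K (0, 0) = h M v - h M (0, 0)" if "v \<in> box K" "K \<le> M" for K M v
  proof -
    have "h K v - h M v = h K (0, 0) - h M (0, 0)"
    proof (rule box_const[where \<phi> = "\<lambda>v. h K v - h M v", OF _ that(1)])
      fix x y assume xy: "(x, y) \<in> Z2" "x \<in> box K" "y \<in> box K"
      then have "x \<in> box M" "y \<in> box M" using that(2) by (auto simp: box_def)
      then show "h K x - h M x = h K y - h M y"
        using h_edge[OF xy(1), of K] h_edge[OF xy(1), of M] xy(2,3) by linarith
    qed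
    then show ?thesis by linarith
  qed
  define s where "s v = nat \<bar>fst v\<bar> + nat \<bar>snd v\<bar>" for v :: point
  have s: "v \<in> box (s v)" for v by (cases v) (auto simp: box_def s_def)
  define H where "H v = h (s v) v - h (s v) (0, 0)" for v
  have "n e = ext_d Z2 H e" for e
  proof (cases "e \<in> Z2")
    case True
    obtain x y where e: "e = (x, y)" by (cases e)
    define M where "M = max (s x) (s y)"
    have "H x = h M x - h M (0, 0)" "H y = h M y - h M (0, 0)"
      unfolding H_def M_def by (intro compat s max.cobounded1 max.cobounded2)+
    moreover have "x \<in> box M" "y \<in> box M"
      using s[of x] s[of y] by (auto simp: box_def M_def)
    ultimately show ?thesis
      using h_edge[of x y M] True by (simp add: e ext_d_def)
  qed (cases e, simp add: off ext_d_def)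
  then have "n = ext_d Z2 H" by blast
  then show ?thesis by (auto simp: H_star_def)
qed

text \<open>A Scheffe-type argument: finitely many cylinders carry nearly all the mass of
  \<open>L\<close>, hence of \<open>M k\<close> for large \<open>k\<close>, and on them the
  convergence is that of a finite sum. Any bounded \<open>g\<close> is allowed, as the restrictions
  range over a countable discrete set.\<close>

lemma cylinder_convergence:
  fixes M :: "nat \<Rightarrow> ('e::countable \<Rightarrow> int) measure"
  assumes M: "\<And>k. prob_space (M k)" "\<And>k. sets (M k) = sets borel"
    and L: "prob_space L" "sets L = sets borel" and F: "finite F"
    and conv: "\<And>a. (\<lambda>k. measure (M k) (cyl F a)) \<longlonglongrightarrow> measure L (cyl F a)"
    and total: "((\<lambda>a. measure L (cyl F a)) has_sum 1) (PiE F (\<lambda>_. UNIV))"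
    and g: "\<And>b. \<bar>g b\<bar> \<le> (B::real)"
  shows "(\<lambda>k. \<integral>n. g (restrict n F) \<partial>M k) \<longlonglongrightarrow> (\<integral>n. g (restrict n F) \<partial>L)"
proof -
  let ?P = "PiE F (\<lambda>_. UNIV :: int set)" and ?C = "\<lambda>a. {n :: 'e \<Rightarrow> int. \<forall>e\<in>F. n e = a e}"
  have B: "B \<ge> 0" using g[of undefined] by linarith
  have cnt: "countable ?P" using F by (intro countable_PiE) auto
  have eqC: "restrict n F = a \<longleftrightarrow> n \<in> ?C a" if "a \<in> ?P" for n a
    using that by (auto simp: fun_eq_iff restrict_def PiE_def extensional_def)
  have meas: "(\<lambda>n. restrict n F) \<in> borel \<rightarrow>\<^sub>M count_space ?P"
  proof (subst measurable_count_space_eq_countable[OF cnt], intro conjI ballI)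
    fix a assume "a \<in> ?P"
    then have "(\<lambda>n. restrict n F) -` {a} \<inter> space borel = ?C a" using eqC by auto
    then show "(\<lambda>n. restrict n F) -` {a} \<inter> space borel \<in> sets borel"
      by (simp only: cylinder_sets[OF F])
  qed auto
  have gm: "(\<lambda>n. h (restrict n F)) \<in> borel_measurable borel" for h :: "('e \<Rightarrow> int) \<Rightarrow> real"
    using measurable_compose[OF meas, of h borel] by simp
  have approx: "\<bar>(\<integral>n. g (restrict n F) \<partial>N) - (\<Sum>a\<in>A. g a * measure N (?C a))\<bar> \<le> B * (1 - (\<Sum>a\<in>A. measure N (?C a)))"
    if N: "prob_space N" "sets N = sets borel" and A: "finite A" "A \<subseteq> ?P" for N A
  proof -
    interpret N: prob_space N by fact
    have gmN: "(\<lambda>n. h (restrict n F)) \<in> borel_measurable N" for h :: "('e \<Rightarrow> int) \<Rightarrow> real"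
      using gm[of h] by (simp add: measurable_cong_sets[OF N(2) refl])
    have bint: "integrable N (\<lambda>n. h (restrict n F))" if "\<And>b. \<bar>h b\<bar> \<le> C" for h :: "('e \<Rightarrow> int) \<Rightarrow> real" and C
      using that by (intro N.integrable_const_bound[of _ C] gmN) auto
    have single: "(\<integral>n. (if restrict n F = a then c else 0) \<partial>N) = c * measure N (?C a)" if "a \<in> ?P" for a c
    proof -
      have "(\<integral>n. (if restrict n F = a then c else 0) \<partial>N) = (\<integral>n. c * indicator (?C a) n \<partial>N)"
        by (intro Bochner_Integration.integral_cong refl) (auto simp: eqC[OF that] indicator_def)
      also have "\<dots> = c * measure N (?C a)"
        using cylinder_sets[OF F, of a] by (simp add: N(2) sets_eq_imp_space_eq[OF N(2)])
      finally show ?thesis .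
    qed
    have fin_sum: "(\<integral>n. (\<Sum>a\<in>A. if restrict n F = a then h a else 0) \<partial>N) = (\<Sum>a\<in>A. h a * measure N (?C a))" for h
    proof (subst Bochner_Integration.integral_sum)
      show "integrable N (\<lambda>n. if restrict n F = a then h a else 0)" for a
        by (rule bint[of "\<lambda>b. if b = a then h a else 0" "\<bar>h a\<bar>"]) auto
    qed (use A single in \<open>auto intro!: sum.cong\<close>)
    have sum_eq: "(\<Sum>a\<in>A. if restrict n F = a then h a else 0) = (if restrict n F \<in> A then h (restrict n F) else 0)" for n h
      using A(1) by (simp add: sum.delta)
    have i1: "integrable N (\<lambda>n. g (restrict n F))" using g by (rule bint)
    have i2: "integrable N (\<lambda>n. if restrict n F \<in> A then g (restrict n F) else 0)"
      by (rule bint[of "\<lambda>b. if b \<in> A then g b else 0" B]) (use g B in auto)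
    have i3: "integrable N (\<lambda>n. if restrict n F \<in> A then 1 else 0 :: real)"
      by (rule bint[of "\<lambda>b. if b \<in> A then 1 else 0" 1]) auto
    have "\<bar>(\<integral>n. g (restrict n F) \<partial>N) - (\<Sum>a\<in>A. g a * measure N (?C a))\<bar> =
        \<bar>\<integral>n. g (restrict n F) - (if restrict n F \<in> A then g (restrict n F) else 0) \<partial>N\<bar>"
      unfolding fin_sum[symmetric] sum_eq by (simp add: i1 i2)
    also have "\<dots> \<le> (\<integral>n. \<bar>g (restrict n F) - (if restrict n F \<in> A then g (restrict n F) else 0)\<bar> \<partial>N)"
      by (rule integral_abs_bound)
    also have "\<dots> \<le> (\<integral>n. B * (1 - (if restrict n F \<in> A then 1 else 0)) \<partial>N)"
      using i1 i2 i3 g B by (intro integral_mono) auto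
    also have "\<dots> = B * (1 - (\<Sum>a\<in>A. 1 * measure N (?C a)))"
      unfolding fin_sum[symmetric] sum_eq using i3 by (simp add: N.prob_space)
    finally show ?thesis by simp
  qed
  show ?thesis
  proof (rule LIMSEQ_I)
    fix \<epsilon> :: real assume \<epsilon>: "\<epsilon> > 0"
    \<comment> \<open>The summand 1 in the denominator covers \<open>B = 0\<close>. Truncation costs
      less than \<open>\<epsilon> / 4\<close> for \<open>L\<close>; for \<open>M k\<close>, together
      with the comparison of the finite sums, it costs less than
      \<open>\<epsilon> / 2\<close>.\<close>
    define \<delta> where "\<delta> = \<epsilon> / (4 * (B + 1))"
    have \<delta>: "\<delta> > 0" "B * \<delta> < \<epsilon> / 4" using \<epsilon> B by (auto simp: \<delta>_def field_simps)
    obtain A where A: "finite A" "A \<subseteq> ?P" "dist (\<Sum>a\<in>A. measure L (?C a)) 1 \<le> \<delta>"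
      using has_sum_finite_approximation[OF total \<delta>(1)] by blast
    let ?E = "\<lambda>N. \<integral>n. g (restrict n F) \<partial>N" and ?S = "\<lambda>N. \<Sum>a\<in>A. g a * measure N (?C a)"
      and ?T = "\<lambda>N. \<Sum>a\<in>A. measure N (?C a)"
    have "(\<lambda>k. \<bar>?S (M k) - ?S L\<bar> + B * (1 - ?T (M k))) \<longlonglongrightarrow> \<bar>?S L - ?S L\<bar> + B * (1 - ?T L)"
      by (intro tendsto_intros conv)
    moreover have TL: "B * (1 - ?T L) \<le> B * \<delta>"
      using A(3) B by (intro mult_left_mono) (auto simp: dist_real_def)
    ultimately have "\<forall>\<^sub>F k in sequentially. \<bar>?S (M k) - ?S L\<bar> + B * (1 - ?T (M k)) < \<epsilon> / 2"
      using \<delta>(2) \<epsilon> by (intro order_tendstoD(2)) auto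
    then obtain k0 where k0: "\<And>k. k \<ge> k0 \<Longrightarrow> \<bar>?S (M k) - ?S L\<bar> + B * (1 - ?T (M k)) < \<epsilon> / 2"
      by (auto simp: eventually_sequentially)
    have "norm (?E (M k) - ?E L) < \<epsilon>" if "k \<ge> k0" for k
      using k0[OF that] approx[OF M[of k] A(1,2)] approx[OF L A(1,2)] TL \<delta>(2) \<epsilon> unfolding real_norm_def
      by linarith
    then show "\<exists>k0. \<forall>k\<ge>k0. norm (?E (M k) - ?E L) < \<epsilon>" by blast
  qed
qed

section \<open>The infinite-volume height measure from its cylinder probabilities\<close>

context spin_lim
begin

lemma \<rho>_empty: "\<rho> {} a = 1"
  by (simp add: \<rho>_def M.prob_space scaleR_conv_of_real)

lemma \<rho>_total:
  assumes "finite F"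
  shows "(\<rho> F has_sum 1) (PiE F (\<lambda>_. UNIV))"
  using \<rho>_has_sum[OF assms, of "{}"] by (simp add: \<rho>_empty)

text \<open>If \<open>F\<close> lies in a torus, an exact form of the torus has exact values on
  \<open>F\<close>, so the finite-volume probabilities vanish eventually.\<close>

lemma \<rho>_not_exact:
  assumes F: "finite F" "F \<subseteq> orientation Z2" and a: "\<not> (\<exists>h. \<forall>e\<in>F. a e = ext_d Z2 h e)"
  shows "\<rho> F a = 0"
proof (rule LIMSEQ_unique[OF \<rho>_limit[OF F, of a]], rule tendsto_eventually)
  show "\<forall>\<^sub>F k in sequentially. measure (height_measure V (torus (r k))) (cyl F a) = 0"
    using eventually_r[OF eventually_orientation_torus[OF F]]
  proof eventually_elim
    case (elim k)
    have "H_star (torus (r k)) \<inter> (cyl F a) = {}"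
    proof -
      have False if "n = ext_d (torus (r k)) h" "\<forall>e\<in>F. n e = a e" for n h
      proof -
        have "a e = ext_d Z2 h e" if "e \<in> F" for e
        proof -
          have "e \<in> torus (r k)" "e \<in> Z2"
            using that elim F(2) orientation_subset by blast+
          then show ?thesis
            using \<open>n = _\<close> \<open>\<forall>e\<in>F. n e = a e\<close> that by (cases e) (force simp: ext_d_def)
        qed
        then show False using a by blast
      qed
      then show ?thesis by (auto simp: H_star_def)
    qed
    then show ?case
      by (simp add: measure_height_measure[OF torus_graph cylinder_sets[OF F(1)]])
  qed
qed

text \<open>The finite-dimensional laws are transported to the reals, which form a Polish space.\<close>

definition fd :: "(point \<times> point) set \<Rightarrow> (point \<times> point \<Rightarrow> real) measure" where
  "fd F = distr (point_measure (PiE F (\<lambda>_. UNIV)) (\<lambda>b. ennreal (\<rho> F b))) (PiM F (\<lambda>_. borel))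
     (\<lambda>b. restrict (\<lambda>e. real_of_int (b e)) F)"

lemma emeasure_fd:
  assumes F: "finite F" "F \<subseteq> orientation Z2" and A: "A \<in> sets (PiM F (\<lambda>_. borel))"
  shows "emeasure (fd F) A = ennreal (infsum (\<rho> F) {b \<in> PiE F (\<lambda>_. UNIV). restrict (\<lambda>e. real_of_int (b e)) F \<in> A})"
  unfolding fd_def
  by (rule emeasure_distr_point_measure[OF \<rho>_nonneg[OF F] has_sum_imp_summable[OF \<rho>_total[OF F(1)]] _ A])
    (auto simp: space_PiM)

lemma sets_fd: "sets (fd F) = sets (PiM F (\<lambda>_. borel))"
  by (simp add: fd_def)

lemma space_fd: "space (fd F) = space (PiM F (\<lambda>_. borel))"
  by (simp add: fd_def)

text \<open>The fibres of the restriction from \<open>H\<close> to \<open>J\<close> partition the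
  functions on \<open>H\<close>, and \<open>\<rho>_has_sum\<close> evaluates the sum over one
  fibre.\<close>

lemma projective_fd: "polish_projective (orientation Z2) fd"
proof (intro polish_projective.intro projective_family.intro)
  fix F assume F: "finite F" "F \<subseteq> orientation Z2"
  show "prob_space (fd F)"
  proof
    have "{b \<in> PiE F (\<lambda>_. UNIV). restrict (\<lambda>e. real_of_int (b e)) F \<in> space (PiM F (\<lambda>_. borel))} = PiE F (\<lambda>_. UNIV)"
      by (auto simp: space_PiM)
    then show "emeasure (fd F) (space (fd F)) = 1"
      unfolding space_fd using \<rho>_total[OF F(1)] by (simp add: emeasure_fd[OF F] infsumI)
  qed
next
  fix J H :: "(point \<times> point) set" assume JH: "J \<subseteq> H" and H: "finite H" "H \<subseteq> orientation Z2"
  have J: "finite J" "J \<subseteq> orientation Z2" using JH H finite_subset by blast+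
  have rm: "(\<lambda>f. restrict f J) \<in> fd H \<rightarrow>\<^sub>M PiM J (\<lambda>_. borel)"
    unfolding measurable_cong_sets[OF sets_fd refl] using JH by (rule measurable_restrict_subset)
  show "fd J = distr (fd H) (PiM J (\<lambda>_. borel)) (\<lambda>f. restrict f J)"
  proof (rule measure_eqI)
    fix A assume "A \<in> sets (fd J)"
    then have A: "A \<in> sets (PiM J (\<lambda>_. borel))" by (simp add: sets_fd)
    let ?r = "\<lambda>F b. restrict (\<lambda>e. real_of_int (b e)) F"
    let ?X = "{a \<in> PiE J (\<lambda>_. UNIV). ?r J a \<in> A}"
    let ?Y = "\<lambda>a. {b \<in> PiE H (\<lambda>_. UNIV). \<forall>e\<in>J. b e = a e}"
    let ?Z = "{b \<in> PiE H (\<lambda>_. UNIV). ?r J b \<in> A}"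
    have inj: "inj_on snd (Sigma ?X ?Y)"
    proof (rule inj_onI)
      fix p p' assume "p \<in> Sigma ?X ?Y" "p' \<in> Sigma ?X ?Y" "snd p = snd p'"
      then have p: "fst p \<in> PiE J (\<lambda>_. UNIV)" "fst p' \<in> PiE J (\<lambda>_. UNIV)"
          "\<forall>e\<in>J. snd p e = fst p e" "\<forall>e\<in>J. snd p e = fst p' e"
        by (auto simp: mem_Times_iff Sigma_def)
      have "fst p = fst p'"
        by (rule PiE_ext[OF p(1,2)]) (use p(3,4) in metis)
      then show "p = p'" using \<open>snd p = snd p'\<close> by (rule prod_eqI)
    qed
    have img: "snd ` Sigma ?X ?Y = ?Z"
    proof (intro set_eqI iffI)
      fix b assume b: "b \<in> ?Z"
      have "?r J (restrict b J) = ?r J b" by (auto simp: fun_eq_iff)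
      then have "(restrict b J, b) \<in> Sigma ?X ?Y" using b by simp
      then show "b \<in> snd ` Sigma ?X ?Y" by (rule rev_image_eqI) simp
    next
      fix b assume "b \<in> snd ` Sigma ?X ?Y"
      then obtain a where a: "a \<in> ?X" "b \<in> ?Y a" by auto
      have "?r J b = ?r J a" by (rule restrict_ext) (use a(2) in simp)
      then show "b \<in> ?Z" using a by simp
    qed
    have sumZ: "\<rho> H summable_on ?Z"
      by (rule summable_on_subset_banach[OF has_sum_imp_summable[OF \<rho>_total[OF H(1)]]]) auto
    have eqf: "\<rho> H \<circ> snd = (\<lambda>(a, b). \<rho> H b)" by (simp add: fun_eq_iff)
    from sumZ have sumS: "(\<lambda>(a, b). \<rho> H b) summable_on Sigma ?X ?Y"
      unfolding img[symmetric] summable_on_reindex[OF inj] by (simp only: eqf)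
    have "infsum (\<rho> H) ?Z = infsum (\<lambda>(a, b). \<rho> H b) (Sigma ?X ?Y)"
      unfolding img[symmetric] infsum_reindex[OF inj] by (simp only: eqf)
    also have "\<dots> = infsum (\<lambda>a. infsum (\<rho> H) (?Y a)) ?X"
      by (rule infsum_Sigma'_banach[OF sumS, symmetric])
    also have "\<dots> = infsum (\<rho> J) ?X"
      by (intro infsum_cong infsumI \<rho>_has_sum[OF H(1) JH])
    finally have eq: "infsum (\<rho> H) ?Z = infsum (\<rho> J) ?X" .
    have "(\<lambda>f. restrict f J) -` A \<inter> space (fd H) \<in> sets (PiM H (\<lambda>_. borel))"
      using measurable_sets[OF rm A] by (simp add: sets_fd)
    then have "emeasure (distr (fd H) (PiM J (\<lambda>_. borel)) (\<lambda>f. restrict f J)) A =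
        ennreal (infsum (\<rho> H) {b \<in> PiE H (\<lambda>_. UNIV). ?r H b \<in> (\<lambda>f. restrict f J) -` A \<inter> space (fd H)})"
      using A rm by (subst emeasure_distr) (auto simp: emeasure_fd[OF H])
    also have "{b \<in> PiE H (\<lambda>_. UNIV). ?r H b \<in> (\<lambda>f. restrict f J) -` A \<inter> space (fd H)} = ?Z"
      using JH by (auto simp: space_fd space_PiM Int_absorb1)
    finally show "emeasure (fd J) A = emeasure (distr (fd H) (PiM J (\<lambda>_. borel)) (\<lambda>f. restrict f J)) A"
      unfolding eq emeasure_fd[OF J A] by (rule sym)
  qed (simp add: sets_fd)
qed

lemma ex_cylinder_measure:
  "\<exists>\<nu>. prob_space \<nu> \<and> sets \<nu> = sets borel \<and>
    (\<forall>F a. finite F \<longrightarrow> F \<subseteq> orientation Z2 \<longrightarrow> measure \<nu> (cyl F a) = \<rho> F a) \<and>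
    (AE n in \<nu>. (\<forall>e. e \<notin> Z2 \<longrightarrow> n e = 0) \<and> (\<forall>x y. n (y, x) = - n (x, y)))"
proof -
  let ?I = "orientation Z2"
  interpret P: polish_projective ?I fd by (rule projective_fd)
  \<comment> \<open>Only oriented edges carry coordinates of the projective limit.
    \<open>ext\<close> returns to the integers by the floor, fills reversed edges by the sign and
    puts 0 elsewhere, so support and antisymmetry hold for every sample.\<close>
  define ext :: "(point \<times> point \<Rightarrow> real) \<Rightarrow> point \<times> point \<Rightarrow> int" where
    "ext \<omega> e = (if e \<in> ?I then \<lfloor>\<omega> e\<rfloor> else if prod.swap e \<in> ?I then - \<lfloor>\<omega> (prod.swap e)\<rfloor> else 0)" for \<omega> e
  have m0: "(\<lambda>\<omega>. f (\<omega> e)) \<in> borel_measurable P.lim" if "e \<in> ?I" "f \<in> borel_measurable borel" for e and f :: "real \<Rightarrow> int"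
    using that by (intro measurable_compose[OF _ that(2)])
      (simp add: measurable_cong_sets[OF P.sets_lim refl] measurable_component_singleton)
  have fl: "(\<lambda>x::real. g \<lfloor>x\<rfloor>) \<in> borel_measurable borel" for g :: "int \<Rightarrow> int"
    by (rule measurable_compose[OF measurable_real_floor]) simp
  have ext_meas: "ext \<in> borel_measurable P.lim"
  proof (rule measurable_to_fun)
    fix e
    show "(\<lambda>\<omega>. ext \<omega> e) \<in> borel_measurable P.lim"
    proof -
      consider "e \<in> ?I" | "e \<notin> ?I" "prod.swap e \<in> ?I" | "e \<notin> ?I" "prod.swap e \<notin> ?I" by blast
      then show ?thesis
      proof cases
        case 1 then show ?thesis unfolding ext_def using m0[OF 1 fl[of "\<lambda>x. x"]] by simp
      next
        case 2 then show ?thesis unfolding ext_def using m0[OF 2(2) fl[of "\<lambda>x. - x"]] by simp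
      next
        case 3 then show ?thesis unfolding ext_def by simp
      qed
    qed
  qed
  define \<nu> where "\<nu> = distr P.lim borel ext"
  have prob: "prob_space \<nu>" unfolding \<nu>_def by (rule P.P.prob_space_distr[OF ext_meas])
  have sets: "sets \<nu> = sets borel" by (simp add: \<nu>_def)
  have cyl: "measure \<nu> (cyl F a) = \<rho> F a" if F: "finite F" "F \<subseteq> ?I" for F a
  proof -
    let ?X = "{x \<in> space (PiM F (\<lambda>_. borel :: real measure)). \<forall>e\<in>F. \<lfloor>x e\<rfloor> = a e}"
    have X: "?X \<in> sets (PiM F (\<lambda>_. borel))"
      using F(1) by measurable
    have "measure \<nu> (cyl F a) = measure P.lim (ext -` (cyl F a) \<inter> space P.lim)"
      unfolding \<nu>_def by (rule measure_distr[OF ext_meas]) (simp add: cylinder_sets[OF F(1)])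
    also have "ext -` (cyl F a) \<inter> space P.lim = P.emb ?I F ?X"
      using F(2) by (auto simp: prod_emb_def space_PiM ext_def subset_eq)
    also have "measure P.lim \<dots> = measure (fd F) ?X"
      by (rule P.measure_lim_emb[OF F(2,1) X])
    also have "\<dots> = infsum (\<rho> F) {b \<in> PiE F (\<lambda>_. UNIV). restrict (\<lambda>e. real_of_int (b e)) F \<in> ?X}"
      unfolding measure_def emeasure_fd[OF F X] by (intro enn2real_ennreal infsum_nonneg \<rho>_nonneg F)
    also have "{b \<in> PiE F (\<lambda>_. UNIV). restrict (\<lambda>e. real_of_int (b e)) F \<in> ?X} = {b \<in> PiE F (\<lambda>_. UNIV). \<forall>e\<in>F. b e = a e}"
      by (auto simp: space_PiM)
    also have "infsum (\<rho> F) \<dots> = \<rho> F a"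
      by (rule infsumI[OF \<rho>_has_sum[OF F(1) order_refl]])
    finally show ?thesis .
  qed
  have "AE n in \<nu>. \<forall>e. (e \<notin> Z2 \<longrightarrow> n e = 0) \<and> n (prod.swap e) = - n e"
  proof -
    have mS: "{n \<in> space borel. \<forall>e. (e \<notin> Z2 \<longrightarrow> n e = 0) \<and> n (prod.swap e) = - n e} \<in> sets (borel :: (point \<times> point \<Rightarrow> int) measure)"
    proof (intro sets.sets_Collect_countable_All sets.sets_Collect_conj sets.sets_Collect_imp sets.sets_Collect_const)
      fix e
      show "{n \<in> space borel. n e = 0} \<in> sets (borel :: (point \<times> point \<Rightarrow> int) measure)"
        using cylinder_sets[of "{e}" "\<lambda>_. 0"] by simp
      \<comment> \<open>On a diagonal pair the condition says \<open>n e = 0\<close>; otherwise it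
        is a countable union of cylinders, one for each value \<open>j\<close> of
        \<open>n e\<close>.\<close>
      have "{n \<in> space borel. n (prod.swap e) = - n e} = (if prod.swap e = e then {n. \<forall>d\<in>{e}. n d = 0}
          else (\<Union>j::int. {n. \<forall>d\<in>{e, prod.swap e}. n d = (if d = e then j else - j)}))" (is "?L = ?R")
        by (cases "prod.swap e = e") auto
      moreover have "?R \<in> sets (borel :: (point \<times> point \<Rightarrow> int) measure)"
      proof (cases "prod.swap e = e")
        case True
        then show ?thesis by (simp only: if_True simp_thms) (intro cylinder_sets finite.intros)
      next
        case False
        then show ?thesis
          by (simp only: if_False) (intro sets.countable_UN'' cylinder_sets finite.intros countableI_type)
      qed
      ultimately show "?L \<in> sets (borel :: (point \<times> point \<Rightarrow> int) measure)" by (simp only:)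
    qed
    have ext_prop: "(e \<notin> Z2 \<longrightarrow> ext \<omega> e = 0) \<and> ext \<omega> (prod.swap e) = - ext \<omega> e" for \<omega> e
    proof -
      obtain x y where e: "e = (x, y)" by (cases e)
      consider "(x, y) \<notin> Z2" "(y, x) \<notin> Z2" | "(x, y) \<in> Z2" "(y, x) \<in> Z2"
        using Z2_facts(1) by (meson symE)
      then show ?thesis
      proof cases
        case 1
        then have "(x, y) \<notin> ?I" "(y, x) \<notin> ?I" using orientation_subset by blast+
        then show ?thesis by (simp add: ext_def e)
      next
        case 2
        then show ?thesis
          using orientation_iff[OF Z2_facts(2,1) 2(1)] by (simp add: ext_def e)
      qed
    qed
    show ?thesis
      unfolding \<nu>_def AE_distr_iff[OF ext_meas mS] by (intro AE_I2 allI ext_prop)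
  qed
  then have "AE n in \<nu>. (\<forall>e. e \<notin> Z2 \<longrightarrow> n e = 0) \<and> (\<forall>x y. n (y, x) = - n (x, y))"
  proof (rule eventually_mono)
    fix n :: "point \<times> point \<Rightarrow> int" assume n: "\<forall>e. (e \<notin> Z2 \<longrightarrow> n e = 0) \<and> n (prod.swap e) = - n e"
    have "n (y, x) = - n (x, y)" for x y
      using n[rule_format, of "(x, y)"] unfolding swap_simp by (rule conjunct2)
    moreover have "\<forall>e. e \<notin> Z2 \<longrightarrow> n e = 0"
      using n by blast
    ultimately show "(\<forall>e. e \<notin> Z2 \<longrightarrow> n e = 0) \<and> (\<forall>x y. n (y, x) = - n (x, y))" by blast
  qed
  with prob sets cyl show ?thesis by blast
qed

lemma AE_exact_box:
  assumes \<nu>: "prob_space \<nu>" "sets \<nu> = sets borel" and F: "finite F" "F \<subseteq> orientation Z2"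
    and cyl: "\<And>a. measure \<nu> (cyl F a) = \<rho> F a"
  shows "AE n in \<nu>. \<exists>h. \<forall>e\<in>F. n e = ext_d Z2 h e"
proof -
  interpret prob_space \<nu> by fact
  let ?X = "{a \<in> PiE F (\<lambda>_. UNIV). \<not> (\<exists>h. \<forall>e\<in>F. a e = ext_d Z2 h e)}"
  have "countable ?X"
    by (rule countable_subset[OF _ countable_PiE[OF F(1), of "\<lambda>_. UNIV :: int set"]]) auto
  have "AE n in \<nu>. \<forall>a\<in>?X. \<not> (\<forall>e\<in>F. n e = a e)"
  proof (subst AE_ball_countable[OF \<open>countable ?X\<close>], intro ballI)
    fix a assume a: "a \<in> ?X"
    have "cyl F a \<in> null_sets \<nu>"
      using cylinder_sets[OF F(1), of a] \<rho>_not_exact[OF F, of a] a cyl[of a]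
      by (intro null_setsI) (auto simp: emeasure_eq_measure \<nu>(2))
    then show "AE n in \<nu>. \<not> (\<forall>e\<in>F. n e = a e)"
      using AE_not_in by fastforce
  qed
  then show ?thesis
  proof eventually_elim
    case (elim n)
    show ?case
    proof (rule ccontr)
      assume "\<not> ?case"
      then have "restrict n F \<in> ?X" by auto
      from bspec[OF elim this] show False by simp
    qed
  qed
qed

lemma ex_height_limit: "\<exists>\<nu>. height_limit V r \<nu>"
proof -
  obtain \<nu> where \<nu>: "prob_space \<nu>" "sets \<nu> = sets borel"
    and cyl: "\<And>F a. finite F \<Longrightarrow> F \<subseteq> orientation Z2 \<Longrightarrow> measure \<nu> (cyl F a) = \<rho> F a"
    and AE: "AE n in \<nu>. (\<forall>e. e \<notin> Z2 \<longrightarrow> n e = 0) \<and> (\<forall>x y. n (y, x) = - n (x, y))"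
    using ex_cylinder_measure by blast
  have "AE n in \<nu>. \<forall>K. \<exists>h. \<forall>e\<in>orientation Z2 \<inter> (box K \<times> box K). n e = ext_d Z2 h e"
    unfolding AE_all_countable
    by (intro allI AE_exact_box[OF \<nu>] cyl) (auto simp: finite_box)
  with AE have exact: "AE n in \<nu>. n \<in> H_star Z2"
  proof eventually_elim
    case (elim n)
    show ?case by (rule exact_if_box_exact) (use elim in blast)+
  qed
  have "local_weak_limit (\<lambda>k. height_measure V (torus (r k))) \<nu>"
    unfolding local_weak_limit_def
  proof (intro allI impI)
    fix F :: "(point \<times> point) set" and f :: "(point \<times> point \<Rightarrow> int) \<Rightarrow> real"
    assume F: "finite F" "F \<subseteq> Z2" and f: "continuous_on UNIV f" "bounded (range f)"
    obtain B where B: "\<And>b. \<bar>f b\<bar> \<le> B" using f(2) by (auto simp: bounded_iff)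
    \<comment> \<open>\<open>F\<close> may contain either or both orientations of an edge.
      \<open>G\<close> collects the oriented representatives, and \<open>\<psi>\<close> restores the
      values on \<open>F\<close> by antisymmetry.\<close>
    define G where "G = {e \<in> orientation Z2. e \<in> F \<or> prod.swap e \<in> F}"
    have "G \<subseteq> F \<union> prod.swap ` F"
    proof
      fix e assume "e \<in> G"
      moreover have "e = prod.swap (prod.swap e)" by simp
      ultimately show "e \<in> F \<union> prod.swap ` F" unfolding G_def by blast
    qed
    then have G: "finite G" "G \<subseteq> orientation Z2"
      using F(1) finite_subset[of G] by (auto simp: G_def)
    define \<psi> :: "(point \<times> point \<Rightarrow> int) \<Rightarrow> point \<times> point \<Rightarrow> int" where
      "\<psi> b = restrict (\<lambda>e. if e \<in> orientation Z2 then b e else - b (prod.swap e)) F" for b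
    have \<psi>: "restrict n F = \<psi> (restrict n G)" if anti: "\<And>x y. n (y, x) = - n (x, y)" for n
    proof
      fix e :: "point \<times> point"
      obtain x y where e: "e = (x, y)" by (cases e)
      show "restrict n F e = \<psi> (restrict n G) e"
      proof (cases "e \<in> F")
        case True
        then have "(x, y) \<in> Z2" using F(2) e by blast
        then show ?thesis
          using True orientation_iff[OF Z2_facts(2,1), of x y] anti[of y x]
          by (cases "(x, y) \<in> orientation Z2") (simp_all add: \<psi>_def G_def e)
      qed (simp add: \<psi>_def)
    qed
    have fm: "(\<lambda>n. f (restrict n F)) \<in> borel_measurable borel"
    proof (rule measurable_compose[OF _ borel_measurable_continuous_onI[OF f(1)]], rule measurable_to_fun)
      show "(\<lambda>n. restrict n F e) \<in> borel_measurable borel" for e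
        by (cases "e \<in> F") (auto intro: measurable_component)
    qed
    have gm: "(\<lambda>n. f (\<psi> (restrict n G))) \<in> borel_measurable borel"
    proof (rule measurable_compose[OF _ borel_measurable_continuous_onI[OF f(1)]], rule measurable_to_fun)
      fix e
      have mc: "(\<lambda>n. g (n d)) \<in> borel_measurable borel" for g :: "int \<Rightarrow> int" and d :: "point \<times> point"
        by (rule measurable_compose[OF measurable_component borel_measurable_continuous_onI]) simp
      show "(\<lambda>n. \<psi> (restrict n G) e) \<in> borel_measurable borel"
        using mc[of "\<lambda>x. x" e] mc[of uminus "prod.swap e"]
        by (cases "e \<in> F"; cases "e \<in> orientation Z2"; cases "e \<in> G"; cases "prod.swap e \<in> G")
          (simp_all add: \<psi>_def)
    qed
    have "(\<lambda>k. \<integral>n. f (\<psi> (restrict n G)) \<partial>height_measure V (torus (r k))) \<longlonglongrightarrow> (\<integral>n. f (\<psi> (restrict n G)) \<partial>\<nu>)"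
    proof (rule cylinder_convergence[where g = "\<lambda>b. f (\<psi> b)"])
      show "(\<lambda>k. measure (height_measure V (torus (r k))) (cyl G a)) \<longlonglongrightarrow> measure \<nu> (cyl G a)" for a
        unfolding cyl[OF G] by (rule \<rho>_limit[OF G])
      show "((\<lambda>a. measure \<nu> (cyl G a)) has_sum 1) (PiE G (\<lambda>_. UNIV))"
        unfolding cyl[OF G] using \<rho>_total[OF G(1)] by simp
    qed (use B G \<nu> prob_space_height_measure[OF torus_graph] sets_height_measure[OF torus_graph] in auto)
    moreover have "(\<integral>n. f (\<psi> (restrict n G)) \<partial>height_measure V (torus (r k))) =
        (\<integral>n. f (restrict n F) \<partial>height_measure V (torus (r k)))" for k
    proof (rule integral_cong_AE)
      have "{n \<in> space borel. f (\<psi> (restrict n G)) = f (restrict n F)} \<in> sets borel"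
        by (rule measurable_equality_set[OF gm fm])
      then show "AE n in height_measure V (torus (r k)). f (\<psi> (restrict n G)) = f (restrict n F)"
      proof (rule AE_height_measure[OF torus_graph])
        fix n assume n: "n \<in> H_star (torus (r k))"
        show "f (\<psi> (restrict n G)) = f (restrict n F)"
        proof -
          have "restrict n F = \<psi> (restrict n G)" by (rule \<psi>) (rule H_star_antisym[OF n sym_torus])
          then show ?thesis by (simp only:)
        qed
      qed
    qed (use fm gm in \<open>simp_all add: measurable_cong_sets[OF sets_height_measure[OF torus_graph] refl]\<close>)
    moreover have "(\<integral>n. f (\<psi> (restrict n G)) \<partial>\<nu>) = (\<integral>n. f (restrict n F) \<partial>\<nu>)"
    proof (rule integral_cong_AE)
      show "AE n in \<nu>. f (\<psi> (restrict n G)) = f (restrict n F)"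
        using AE
      proof eventually_elim
        case (elim n)
        have "restrict n F = \<psi> (restrict n G)" by (rule \<psi>) (use elim in blast)
        then show ?case by (simp only:)
      qed
    qed (use fm gm in \<open>simp_all add: measurable_cong_sets[OF \<nu>(2) refl]\<close>)
    ultimately show "(\<lambda>k. \<integral>n. f (restrict n F) \<partial>height_measure V (torus (r k))) \<longlonglongrightarrow> (\<integral>n. f (restrict n F) \<partial>\<nu>)"
      by simp
  qed
  then show ?thesis
    using \<nu> exact unfolding height_limit_def by blast
qed

end

section \<open>Lattice symmetries\<close>

definition emap :: "('v \<Rightarrow> 'v) \<Rightarrow> 'v \<times> 'v \<Rightarrow> 'v \<times> 'v" where
  "emap \<sigma> e = (\<sigma> (fst e), \<sigma> (snd e))"

lemma emap_pair [simp]: "emap \<sigma> (x, y) = (\<sigma> x, \<sigma> y)"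
  by (simp add: emap_def)

lemma inj_emap: "bij \<sigma> \<Longrightarrow> inj (emap \<sigma>)"
  by (auto simp: inj_def emap_def bij_def prod_eq_iff)

lemma emap_in_iff:
  assumes \<sigma>: "bij \<sigma>" and D: "finite D" and aut: "\<And>e. e \<in> D \<Longrightarrow> emap \<sigma> e \<in> D"
  shows "emap \<sigma> e \<in> D \<longleftrightarrow> e \<in> D"
proof -
  have inj: "inj (emap \<sigma>)" by (rule inj_emap[OF \<sigma>])
  have "emap \<sigma> ` D = D"
    using D aut by (intro card_subset_eq) (auto simp: card_image inj_on_subset[OF inj])
  then show ?thesis
    using inj_image_mem_iff[OF inj, of e D] by simp
qed

text \<open>A symmetry need not respect the chosen orientation; \<open>\<tau>\<close> corrects the
  image of an edge by a swap, which a symmetric \<open>f\<close> does not see.\<close>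

lemma prod_orientation_emap:
  fixes D :: "('v::countable \<times> 'v) set" and f :: "'v \<times> 'v \<Rightarrow> real"
  assumes \<sigma>: "bij \<sigma>" and D: "finite D" "sym D" "irrefl D" and aut: "\<And>e. e \<in> D \<Longrightarrow> emap \<sigma> e \<in> D"
    and f: "\<And>x y. f (y, x) = f (x, y)"
  shows "(\<Prod>e\<in>orientation D. f (emap \<sigma> e)) = (\<Prod>e\<in>orientation D. f e)"
proof -
  let ?O = "orientation D"
  define \<tau> where "\<tau> e = (if emap \<sigma> e \<in> ?O then emap \<sigma> e else prod.swap (emap \<sigma> e))" for e
  have swap: "prod.swap e \<in> ?O \<longleftrightarrow> e \<notin> ?O" if "e \<in> D" for e
    using orientation_iff[OF D(3,2), of "fst e" "snd e"] that by (cases e) simp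
  have inj: "inj (emap \<sigma>)" by (rule inj_emap[OF \<sigma>])
  have "\<tau> ` ?O \<subseteq> ?O"
  proof
    fix d assume "d \<in> \<tau> ` ?O"
    then obtain e where e: "e \<in> ?O" "d = \<tau> e" by blast
    then have "emap \<sigma> e \<in> D" using aut orientation_subset by blast
    then show "d \<in> ?O" using swap[of "emap \<sigma> e"] e by (auto simp: \<tau>_def)
  qed
  moreover have "inj_on \<tau> ?O"
  proof (rule inj_onI)
    fix e e' assume e: "e \<in> ?O" "e' \<in> ?O" "\<tau> e = \<tau> e'"
    have sw: "prod.swap (emap \<sigma> d) = emap \<sigma> (prod.swap d)" for d by (simp add: emap_def prod.swap_def)
    have "emap \<sigma> e = emap \<sigma> e' \<or> emap \<sigma> e = emap \<sigma> (prod.swap e') \<or> emap \<sigma> (prod.swap e) = emap \<sigma> e'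
        \<or> emap \<sigma> (prod.swap e) = emap \<sigma> (prod.swap e')"
      using e(3) unfolding \<tau>_def sw by (simp split: if_splits)
    then have "e = e' \<or> e = prod.swap e' \<or> prod.swap e = e' \<or> prod.swap e = prod.swap e'"
      using injD[OF inj] by blast
    moreover have "e \<noteq> prod.swap e'" "e' \<noteq> prod.swap e"
      using swap e(1,2) orientation_subset by (metis subsetD)+
    ultimately show "e = e'" by (metis swap_swap)
  qed
  ultimately have bij: "bij_betw \<tau> ?O ?O"
    using finite_orientation[OF D(1)] by (simp add: bij_betw_def card_image card_subset_eq)
  have "f (prod.swap e) = f e" for e by (cases e) (simp only: swap_simp f)
  then have "(\<Prod>e\<in>?O. f (emap \<sigma> e)) = (\<Prod>e\<in>?O. f (\<tau> e))"
    by (intro prod.cong refl) (simp add: \<tau>_def)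
  also have "\<dots> = (\<Prod>e\<in>?O. f e)"
    by (rule prod.reindex_bij_betw[OF bij])
  finally show ?thesis .
qed

text \<open>Pulling back along \<open>\<sigma>\<close> permutes the exact forms and, by evenness of
  \<open>c\<close>, preserves their mass.\<close>

lemma (in height_pot) height_measure_emap:
  fixes D :: "('v::countable \<times> 'v) set"
  assumes \<sigma>: "bij \<sigma>" and D: "finite D" "sym D" "irrefl D" and aut: "\<And>e. e \<in> D \<Longrightarrow> emap \<sigma> e \<in> D"
    and F: "finite F"
  shows "measure (height_measure V D) {n. \<forall>e\<in>F. n (emap \<sigma> e) = a e} = measure (height_measure V D) (cyl F a)"
proof -
  let ?H = "H_star D" and ?T = "\<lambda>n :: 'v \<times> 'v \<Rightarrow> int. n \<circ> emap \<sigma>"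
  let ?C = "cyl F a" and ?C' = "{n. \<forall>e\<in>F. n (emap \<sigma> e) = a e}"
  have iff: "emap \<sigma> e \<in> D \<longleftrightarrow> e \<in> D" for e by (rule emap_in_iff[OF \<sigma> D(1) aut])
  have T_ext: "?T (ext_d D h) = ext_d D (h \<circ> \<sigma>)" for h
    using iff by (auto simp: fun_eq_iff ext_d_def)
  have surj: "?T ` ?H = ?H"
  proof
    show "?T ` ?H \<subseteq> ?H" using T_ext by (auto simp: H_star_def)
    show "?H \<subseteq> ?T ` ?H"
    proof
      fix n assume "n \<in> ?H"
      then obtain h where "n = ext_d D h" by (auto simp: H_star_def)
      also have "\<dots> = ?T (ext_d D (h \<circ> inv \<sigma>))"
        unfolding T_ext using \<sigma> by (simp add: comp_assoc bij_is_inj)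
      finally show "n \<in> ?T ` ?H" by (auto simp: H_star_def)
    qed
  qed
  have semap: "surj (emap \<sigma>)"
  proof (rule surjI)
    show "emap \<sigma> (emap (inv \<sigma>) e) = e" for e
      using \<sigma> by (cases e) (simp add: bij_is_surj surj_f_inv_f)
  qed
  have inj: "inj_on ?T X" for X
  proof (rule inj_onI)
    fix n n' :: "'v \<times> 'v \<Rightarrow> int" assume "?T n = ?T n'"
    then have "n (emap \<sigma> e) = n' (emap \<sigma> e)" for e by (metis comp_apply)
    then show "n = n'" using surjD[OF semap] by (metis ext)
  qed
  have Cs: "?C \<in> sets borel" "?C' \<in> sets borel"
  proof -
    show "?C \<in> sets borel" by (rule cylinder_sets[OF F])
    have "?C' = {n. \<forall>d\<in>emap \<sigma> ` F. n d = a (inv (emap \<sigma>) d)}"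
      using inj_emap[OF \<sigma>] by simp
    also have "\<dots> \<in> sets borel" using F by (intro cylinder_sets) simp
    finally show "?C' \<in> sets borel" .
  qed
  have mass: "height_prob D (?T n) = height_prob D n" if "n \<in> ?H" for n
  proof -
    have "(\<Prod>e\<in>orientation D. c (n (emap \<sigma> e))) = (\<Prod>e\<in>orientation D. c (n e))"
    proof (rule prod_orientation_emap[OF \<sigma> D aut])
      show "c (n (y, x)) = c (n (x, y))" for x y
        unfolding H_star_antisym[OF that D(2), of x y] by simp
    qed
    then show ?thesis by (simp add: height_prob_def height_mass_eq[OF D(1)])
  qed
  have "?H \<inter> ?C = ?T ` (?H \<inter> ?C')"
  proof
    show "?T ` (?H \<inter> ?C') \<subseteq> ?H \<inter> ?C" using surj by auto
    show "?H \<inter> ?C \<subseteq> ?T ` (?H \<inter> ?C')"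
    proof
      fix n assume n: "n \<in> ?H \<inter> ?C"
      then have "n \<in> ?T ` ?H" unfolding surj by blast
      then obtain m where m: "m \<in> ?H" "n = ?T m" by blast
      then have "m \<in> ?C'" using n by simp
      then show "n \<in> ?T ` (?H \<inter> ?C')" using m by blast
    qed
  qed
  then have "infsum (height_prob D) (?H \<inter> ?C) = infsum (height_prob D \<circ> ?T) (?H \<inter> ?C')"
    by (simp only: infsum_reindex[OF inj])
  also have "\<dots> = infsum (height_prob D) (?H \<inter> ?C')"
    by (intro infsum_cong) (auto simp: mass)
  finally show ?thesis
    by (simp add: measure_height_measure[OF D Cs(1)] measure_height_measure[OF D Cs(2)])
qed

section \<open>Translations and the transposition of the torus\<close>

definition shift :: "point \<Rightarrow> point \<Rightarrow> point" where
  "shift v x = (fst x + fst v, snd x + snd v)"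

text \<open>The representative modulo \<open>2 ^ N\<close> in the centred window of
  \<open>torus_box N\<close>: the usual remainder, moved by half a period.\<close>

definition wrap :: "nat \<Rightarrow> int \<Rightarrow> int" where
  "wrap N a = (a + 2 ^ N div 2) mod 2 ^ N - 2 ^ N div 2"

text \<open>Extended by the identity outside the box to be a bijection of the whole lattice, as
  \<open>height_measure_emap\<close> demands.\<close>

definition torus_shift :: "nat \<Rightarrow> point \<Rightarrow> point \<Rightarrow> point" where
  "torus_shift N v x = (if x \<in> torus_box N then (wrap N (fst x + fst v), wrap N (snd x + snd v)) else x)"

lemma even_pow: "N \<ge> 1 \<Longrightarrow> 2 * (2 ^ N div 2) = (2::int) ^ N"
  by (cases N) auto

lemma wrap_cong: "[wrap N a = a] (mod 2 ^ N)"
proof -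
  have "[(a + 2 ^ N div 2) mod 2 ^ N - 2 ^ N div 2 = (a + 2 ^ N div 2) - 2 ^ N div 2] (mod 2 ^ N)"
    by (rule cong_diff) (simp_all add: cong_def)
  then show ?thesis by (simp add: wrap_def)
qed

lemma wrap_range:
  assumes "N \<ge> 1"
  shows "- (2 ^ N) \<le> 2 * wrap N a" "2 * wrap N a < 2 ^ N"
proof -
  define h :: int where "h = 2 ^ N div 2"
  have h: "0 \<le> (a + h) mod 2 ^ N" "(a + h) mod 2 ^ N < 2 ^ N" "2 * h = 2 ^ N" "wrap N a = (a + h) mod 2 ^ N - h"
    using even_pow[OF assms] by (simp_all add: wrap_def h_def)
  show "- (2 ^ N) \<le> 2 * wrap N a" using h by linarith
  show "2 * wrap N a < 2 ^ N" using h by linarith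
qed

text \<open>The window is half-open and of length \<open>m\<close>, so the difference is a multiple
  of \<open>m\<close> that is smaller than \<open>m\<close> in absolute value.\<close>

lemma cong_box_eq:
  fixes a b m :: int
  assumes "[a = b] (mod m)" "- m \<le> 2 * a" "2 * a < m" "- m \<le> 2 * b" "2 * b < m"
  shows "a = b"
proof -
  have "m dvd a - b" using assms(1) by (simp add: cong_iff_dvd_diff)
  then show ?thesis using assms(2-) zdvd_imp_le[of m "\<bar>a - b\<bar>"] by (cases "a = b") auto
qed

lemma wrap_id:
  assumes "N \<ge> 1" "- (2 ^ N) \<le> 2 * a" "2 * a < 2 ^ N"
  shows "wrap N a = a"
  by (rule cong_box_eq[OF wrap_cong wrap_range[OF assms(1)] assms(2,3)])

lemma torus_shift_box: "N \<ge> 1 \<Longrightarrow> x \<in> torus_box N \<Longrightarrow> torus_shift N v x \<in> torus_box N"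
  by (simp add: torus_shift_def mem_torus_box wrap_range)

lemma torus_shift_cong:
  assumes "x \<in> torus_box N"
  shows "[fst (torus_shift N v x) = fst x + fst v] (mod 2 ^ N)" "[snd (torus_shift N v x) = snd x + snd v] (mod 2 ^ N)"
  using assms by (simp_all add: torus_shift_def wrap_cong)

lemma torus_shift_inj:
  assumes N: "N \<ge> 1" and x: "x \<in> torus_box N" "y \<in> torus_box N" and eq: "torus_shift N v x = torus_shift N v y"
  shows "x = y"
proof -
  have "[fst x + fst v = fst y + fst v] (mod 2 ^ N)" "[snd x + snd v = snd y + snd v] (mod 2 ^ N)"
    using torus_shift_cong[OF x(1), of v] torus_shift_cong[OF x(2), of v] eq by (metis cong_sym cong_trans)+
  then have "[fst x = fst y] (mod 2 ^ N)" "[snd x = snd y] (mod 2 ^ N)"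
    by (simp_all add: cong_add_rcancel)
  then show ?thesis
    using x cong_box_eq[of "fst x" "fst y" "2 ^ N"] cong_box_eq[of "snd x" "snd y" "2 ^ N"]
    by (cases x; cases y) (simp add: mem_torus_box)
qed

lemma bij_torus_shift:
  assumes N: "N \<ge> 1"
  shows "bij (torus_shift N v)"
proof -
  have "inj_on (torus_shift N v) (torus_box N)"
    using torus_shift_inj[OF N] by (intro inj_onI)
  then have "bij_betw (torus_shift N v) (torus_box N) (torus_box N)"
    using torus_shift_box[OF N] finite_torus_box by (simp add: bij_betw_def card_image card_subset_eq image_subset_iff)
  moreover have "bij_betw (torus_shift N v) (- torus_box N) (- torus_box N)"
    by (rule bij_betw_cong[THEN iffD1, OF _ bij_betw_id]) (simp add: torus_shift_def)
  ultimately have "bij_betw (torus_shift N v) (torus_box N \<union> - torus_box N) (torus_box N \<union> - torus_box N)"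
    by (rule bij_betw_combine) simp
  then show ?thesis by simp
qed

lemma torus_shift_aut:
  assumes N: "N \<ge> 1" and e: "e \<in> torus N"
  shows "emap (torus_shift N v) e \<in> torus N"
proof -
  let ?s = "torus_shift N v"
  obtain x y where e': "e = (x, y)" by (cases e)
  obtain z where z: "x \<in> torus_box N" "y \<in> torus_box N" "x \<noteq> y" "(x, z) \<in> Z2"
      "[fst z = fst y] (mod 2 ^ N)" "[snd z = snd y] (mod 2 ^ N)"
    using e unfolding e' torus_def by blast
  \<comment> \<open>The lattice step from \<open>x\<close> to \<open>z\<close>, moved so as to start
    at the shifted \<open>x\<close>; its end is congruent to the shifted \<open>y\<close>.\<close>
  define w where "w = (fst z - fst x + fst (?s x), snd z - snd x + snd (?s x))"
  have "(?s x, w) \<in> Z2" using z(4) by (auto simp: Z2_def w_def)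
  moreover have "[fst w = fst (?s y)] (mod 2 ^ N)"
  proof -
    have "[fst w = fst y - fst x + (fst x + fst v)] (mod 2 ^ N)"
      unfolding w_def fst_conv by (intro cong_add cong_diff z cong_refl torus_shift_cong(1)[OF z(1)])
    then show ?thesis
      using cong_sym[OF torus_shift_cong(1)[OF z(2), of v]] by (simp add: cong_trans)
  qed
  moreover have "[snd w = snd (?s y)] (mod 2 ^ N)"
  proof -
    have "[snd w = snd y - snd x + (snd x + snd v)] (mod 2 ^ N)"
      unfolding w_def snd_conv by (intro cong_add cong_diff z cong_refl torus_shift_cong(2)[OF z(1)])
    then show ?thesis
      using cong_sym[OF torus_shift_cong(2)[OF z(2), of v]] by (simp add: cong_trans)
  qed
  moreover have "?s x \<noteq> ?s y" using torus_shift_inj[OF N z(1,2)] z(3) by blast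
  ultimately show ?thesis
    unfolding e' emap_pair torus_def using torus_shift_box[OF N] z(1,2) by blast
qed

text \<open>Transposition carries horizontal edges to vertical ones; together with the shifts it is
  all the symmetry that the variance estimates use.\<close>

lemma transpose_aut:
  assumes e: "e \<in> torus N"
  shows "emap prod.swap e \<in> torus N"
proof -
  obtain x y where e': "e = (x, y)" by (cases e)
  obtain z where z: "x \<in> torus_box N" "y \<in> torus_box N" "x \<noteq> y" "(x, z) \<in> Z2"
      "[fst z = fst y] (mod 2 ^ N)" "[snd z = snd y] (mod 2 ^ N)"
    using e unfolding e' torus_def by blast
  have "(prod.swap x, prod.swap z) \<in> Z2" using z(4) by (auto simp: Z2_def)
  moreover have "prod.swap x \<in> torus_box N" "prod.swap y \<in> torus_box N"
    using z(1,2) by (cases x; cases y; simp add: mem_torus_box)+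
  moreover have "[fst (prod.swap z) = fst (prod.swap y)] (mod 2 ^ N)" "[snd (prod.swap z) = snd (prod.swap y)] (mod 2 ^ N)"
    using z(5,6) by simp_all
  moreover have "prod.swap x \<noteq> prod.swap y" using z(3) by (metis swap_swap)
  ultimately show ?thesis unfolding e' emap_pair torus_def by blast
qed

section \<open>Identification and invariance of the height limit\<close>

locale height_lim = spin_lim +
  fixes \<nu> :: "(point \<times> point \<Rightarrow> int) measure"
  assumes \<nu>: "height_limit V r \<nu>"
begin

sublocale N: prob_space \<nu>
  using \<nu> by (simp add: height_limit_def)

lemma sets_\<nu> [simp, measurable_cong]: "sets \<nu> = sets borel"
  using \<nu> by (simp add: height_limit_def)

lemma space_\<nu> [simp]: "space \<nu> = UNIV"
  using sets_eq_imp_space_eq[OF sets_\<nu>] by simp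

lemma AE_exact: "AE n in \<nu>. n \<in> H_star Z2"
  using \<nu> by (simp add: height_limit_def)

text \<open>The integers are discrete, so the indicator of a cylinder is a continuous local function
  and weak convergence applies to it directly.\<close>

lemma \<nu>_cylinder_limit:
  assumes F: "finite F" "F \<subseteq> Z2"
  shows "(\<lambda>k. measure (height_measure V (torus (r k))) (cyl F a)) \<longlonglongrightarrow> measure \<nu> (cyl F a)"
proof -
  let ?C = "cyl F a"
  define f where "f n = (\<Prod>e\<in>F. if n e = a e then 1 else (0::real))" for n
  have f_eq: "f (restrict n F) = indicator ?C n" for n
    using F(1) by (auto simp: f_def indicator_def)
  have "continuous_on UNIV f"
    unfolding f_def
    by (intro continuous_on_prod continuous_on_compose2[OF Topological_Spaces.continuous_on_discrete[of UNIV] continuous_on_product_coordinates]) auto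
  moreover have "\<bar>f n\<bar> \<le> 1" for n
    unfolding f_def abs_prod by (intro prod_le_1) auto
  then have "bounded (range f)" by (auto simp: bounded_iff)
  ultimately have "(\<lambda>k. \<integral>n. f (restrict n F) \<partial>height_measure V (torus (r k))) \<longlonglongrightarrow> (\<integral>n. f (restrict n F) \<partial>\<nu>)"
    using \<nu> F unfolding height_limit_def local_weak_limit_def by blast
  then show ?thesis
    unfolding f_eq using cylinder_sets[OF F(1), of a]
    by (simp add: space_height_measure[OF torus_graph] sets_height_measure[OF torus_graph])
qed

text \<open>Ties an arbitrary height limit, and not only the one constructed above, to the spin
  limit.\<close>

lemma \<nu>_cylinder:
  assumes "finite F" "F \<subseteq> orientation Z2"
  shows "measure \<nu> (cyl F a) = \<rho> F a"
proof (rule LIMSEQ_unique[OF \<nu>_cylinder_limit \<rho>_limit[OF assms]])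
  show "finite F" "F \<subseteq> Z2" using assms orientation_subset by blast+
qed

text \<open>The lattice symmetry \<sigma> is replaced on large tori by automorphisms
  \<open>\<tau> N\<close> that agree with it on the finite set \<open>F\<close>.\<close>

lemma \<nu>_invariant:
  assumes F: "finite F" "F \<subseteq> Z2" "emap \<sigma> ` F \<subseteq> Z2" "inj (emap \<sigma>)"
    and \<tau>: "\<forall>\<^sub>F N in sequentially. bij (\<tau> N) \<and> (\<forall>e\<in>torus N. emap (\<tau> N) e \<in> torus N) \<and> (\<forall>e\<in>F. emap (\<tau> N) e = emap \<sigma> e)"
  shows "measure \<nu> {n. \<forall>e\<in>F. n (emap \<sigma> e) = a e} = measure \<nu> (cyl F a)"
proof -
  have eq: "{n :: point \<times> point \<Rightarrow> int. \<forall>e\<in>F. n (emap \<sigma> e) = a e} = {n. \<forall>d\<in>emap \<sigma> ` F. n d = a (inv (emap \<sigma>) d)}"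
    using F(4) by simp
  have "(\<lambda>k. measure (height_measure V (torus (r k))) {n. \<forall>e\<in>F. n (emap \<sigma> e) = a e})
      \<longlonglongrightarrow> measure \<nu> {n. \<forall>e\<in>F. n (emap \<sigma> e) = a e}"
    unfolding eq by (rule \<nu>_cylinder_limit) (use F in auto)
  moreover have "\<forall>\<^sub>F k in sequentially. measure (height_measure V (torus (r k))) {n. \<forall>e\<in>F. n (emap \<sigma> e) = a e} =
      measure (height_measure V (torus (r k))) (cyl F a)"
    using eventually_r[OF \<tau>]
  proof eventually_elim
    case (elim k)
    have "{n :: point \<times> point \<Rightarrow> int. \<forall>e\<in>F. n (emap \<sigma> e) = a e} = {n. \<forall>e\<in>F. n (emap (\<tau> (r k)) e) = a e}"
      using elim by simp
    then show ?case
      using height_measure_emap[OF _ torus_graph _ F(1), of "\<tau> (r k)" "r k" a] elim by simp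
  qed
  ultimately have "(\<lambda>k. measure (height_measure V (torus (r k))) (cyl F a))
      \<longlonglongrightarrow> measure \<nu> {n. \<forall>e\<in>F. n (emap \<sigma> e) = a e}"
    by (rule Lim_transform_eventually)
  then show ?thesis
    using \<nu>_cylinder_limit[OF F(1,2), of a] LIMSEQ_unique by blast
qed

lemma \<nu>_shift:
  assumes F: "finite F" "F \<subseteq> Z2"
  shows "measure \<nu> {n. \<forall>e\<in>F. n (emap (shift v) e) = a e} = measure \<nu> (cyl F a)"
proof (rule \<nu>_invariant[OF F])
  show "emap (shift v) ` F \<subseteq> Z2"
    using F(2) by (force simp: Z2_def shift_def emap_def)
  show "inj (emap (shift v))"
    by (auto simp: inj_def emap_def shift_def prod_eq_iff)
  \<comment> \<open>As soon as the box contains the ends of the edges and their translates, the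
    torus shift moves them without wrapping.\<close>
  let ?W = "fst ` F \<union> snd ` F"
  have "\<forall>\<^sub>F N in sequentially. ?W \<union> shift v ` ?W \<subseteq> torus_box N"
    using F(1) by (intro eventually_box) simp
  moreover have "\<forall>\<^sub>F N in sequentially. N \<ge> (1::nat)" by (rule eventually_ge_at_top)
  ultimately show "\<forall>\<^sub>F N in sequentially. bij (torus_shift N v) \<and> (\<forall>e\<in>torus N. emap (torus_shift N v) e \<in> torus N)
      \<and> (\<forall>e\<in>F. emap (torus_shift N v) e = emap (shift v) e)"
  proof eventually_elim
    case (elim N)
    have eq: "torus_shift N v x = shift v x" if "x \<in> ?W" for x
    proof -
      have "x \<in> torus_box N" "shift v x \<in> torus_box N" using elim(1) that by blast+
      then show ?thesis
        using wrap_id[OF elim(2)] by (simp add: torus_shift_def shift_def mem_torus_box)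
    qed
    have "emap (torus_shift N v) e = emap (shift v) e" if "e \<in> F" for e
      using that eq[of "fst e"] eq[of "snd e"] by (simp add: emap_def)
    then show ?case
      using bij_torus_shift[OF elim(2)] torus_shift_aut[OF elim(2)] by blast
  qed
qed

lemma \<nu>_transpose:
  assumes F: "finite F" "F \<subseteq> Z2"
  shows "measure \<nu> {n. \<forall>e\<in>F. n (emap prod.swap e) = a e} = measure \<nu> (cyl F a)"
proof (rule \<nu>_invariant[OF F])
  show "emap prod.swap ` F \<subseteq> Z2"
    using F(2) by (force simp: Z2_def emap_def)
  show "inj (emap (prod.swap :: point \<Rightarrow> point))"
    by (auto simp: inj_def emap_def prod_eq_iff)
  show "\<forall>\<^sub>F N in sequentially. bij (prod.swap :: point \<Rightarrow> point) \<and> (\<forall>e\<in>torus N. emap prod.swap e \<in> torus N)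
      \<and> (\<forall>e\<in>F. emap prod.swap e = emap prod.swap e)"
    using transpose_aut by simp
qed

definition cov :: "point \<times> point \<Rightarrow> point \<times> point \<Rightarrow> real" where
  "cov e e' = (\<integral>n. of_int (n e) * of_int (n e') \<partial>\<nu>)"

text \<open>Cylinder probabilities determine the joint law of the two gradients. The case
  \<open>e = e'\<close> is separate, since a cylinder then prescribes a single value.\<close>

lemma cov_emap:
  assumes "\<And>a. measure \<nu> {n. \<forall>d\<in>{e, e'}. n (emap \<sigma> d) = a d} = measure \<nu> {n. \<forall>d\<in>{e, e'}. n d = a d}"
  shows "cov (emap \<sigma> e) (emap \<sigma> e') = cov e e'"
proof -
  let ?P = "\<lambda>d d' (n :: point \<times> point \<Rightarrow> int). (n d, n d')"
  have set_eq: "?P d d' -` {(i, j)} = {n. n d = i \<and> n d' = j}" for d d' i j by auto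
  have cyl: "{n. n d = i \<and> n d' = j} \<in> sets (borel :: (point \<times> point \<Rightarrow> int) measure)" for d d' and i j :: int
  proof (cases "d = d'")
    case True
    then show ?thesis
      using cylinder_sets[of "{d}" "\<lambda>_. i"] by (cases "i = j") auto
  next
    case False
    then have "{n. n d = i \<and> n d' = j} = {n. \<forall>c\<in>{d, d'}. n c = (if c = d then i else j)}" by auto
    then show ?thesis by (simp only: cylinder_sets finite.intros)
  qed
  have meas: "?P d d' \<in> \<nu> \<rightarrow>\<^sub>M count_space UNIV" for d d'
    by (subst measurable_count_space_eq_countable) (auto simp: set_eq cyl)
  have pair: "measure \<nu> {n. n (emap \<sigma> e) = i \<and> n (emap \<sigma> e') = j} = measure \<nu> {n. n e = i \<and> n e' = j}" for i j
  proof (cases "e = e'")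
    case True
    show ?thesis
    proof (cases "i = j")
      case True
      then show ?thesis using assms[of "\<lambda>_. i"] \<open>e = e'\<close> by simp
    next
      case False
      then have E: "{n :: point \<times> point \<Rightarrow> int. n d = i \<and> n d = j} = {}" for d by auto
      show ?thesis unfolding \<open>e = e'\<close> E ..
    qed
  next
    case False
    then show ?thesis using assms[of "\<lambda>d. if d = e then i else j"] by simp
  qed
  have "distr \<nu> (count_space UNIV) (?P (emap \<sigma> e) (emap \<sigma> e')) = distr \<nu> (count_space UNIV) (?P e e')"
  proof (rule measure_eqI_countable[of _ UNIV])
    fix p :: "int \<times> int"
    show "emeasure (distr \<nu> (count_space UNIV) (?P (emap \<sigma> e) (emap \<sigma> e'))) {p} =
        emeasure (distr \<nu> (count_space UNIV) (?P e e')) {p}"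
      using pair[of "fst p" "snd p"]
      by (cases p) (simp add: emeasure_distr[OF meas] set_eq N.emeasure_eq_measure)
  qed auto
  then have "(\<integral>p. of_int (fst p) * of_int (snd p) \<partial>distr \<nu> (count_space UNIV) (?P (emap \<sigma> e) (emap \<sigma> e'))) =
      (\<integral>p. real_of_int (fst p) * of_int (snd p) \<partial>distr \<nu> (count_space UNIV) (?P e e'))"
    by simp
  then show ?thesis
    unfolding cov_def by (simp add: integral_distr[OF meas])
qed

lemma cov_shift: "e \<in> Z2 \<Longrightarrow> e' \<in> Z2 \<Longrightarrow> cov (emap (shift v) e) (emap (shift v) e') = cov e e'"
  by (rule cov_emap, rule \<nu>_shift[of "{e, e'}" v]) simp_all

lemma cov_transpose: "e \<in> Z2 \<Longrightarrow> e' \<in> Z2 \<Longrightarrow> cov (emap prod.swap e) (emap prod.swap e') = cov e e'"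
  by (rule cov_emap, rule \<nu>_transpose[of "{e, e'}"]) simp_all

end

section \<open>Moments and the main inequality\<close>

text \<open>\<open>T k\<close> is the slope: \<open>G k = k * T k - 2 * P k\<close>, where
  \<open>P\<close> is bounded by the sum \<open>A\<close> of the weighted series. Letting
  \<open>k\<close> grow at fixed \<open>L\<close> in \<open>ub\<close> forces \<open>T\<close> to 0.
  Then \<open>k * T k\<close> is \<open>k\<close> times a tail of the series, at most
  \<open>2 * A\<close>, and \<open>2 * \<bar>P k\<bar>\<close> adds another \<open>2 * A\<close>;
  hence the factor 4.\<close>

lemma variance_bounded:
  fixes a G :: "nat \<Rightarrow> real"
  assumes G0: "G 0 = 0" and GS: "\<And>k. G (Suc k) = G k + a 0 + 2 * (\<Sum>m<k. a (Suc m))"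
    and pos: "\<And>k. G k \<ge> 0" and C: "C \<ge> 0"
    and ub: "\<And>L k. L \<ge> 1 \<Longrightarrow> G k \<le> C * (2 * real L + real k / real L)"
    and sm: "summable (\<lambda>m. real (Suc m) * \<bar>a (Suc m)\<bar>)"
  shows "G k \<le> 4 * (\<Sum>m. real (Suc m) * \<bar>a (Suc m)\<bar>)"
proof -
  let ?b = "\<lambda>m. real (Suc m) * \<bar>a (Suc m)\<bar>"
  define A where "A = (\<Sum>m. ?b m)"
  define T where "T k = a 0 + 2 * (\<Sum>m<k. a (Suc m))" for k
  define P where "P k = (\<Sum>m<k. real (Suc m) * a (Suc m))" for k
  have G_eq: "G k = real k * T k - 2 * P k" for k
    by (induction k) (simp_all add: G0 GS T_def P_def algebra_simps)
  have finA: "sum ?b X \<le> A" if "finite X" for X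
    unfolding A_def using sm that by (intro sum_le_suminf) auto
  have A0: "A \<ge> 0" using finA[of "{}"] by simp
  have PA: "\<bar>P k\<bar> \<le> A" for k
  proof -
    have "\<bar>P k\<bar> \<le> (\<Sum>m<k. ?b m)"
      unfolding P_def by (rule order_trans[OF sum_abs]) (simp add: abs_mult)
    then show ?thesis using finA[of "{..<k}"] by simp
  qed
  \<comment> \<open>In the tail \<open>m \<ge> k\<close> the factor \<open>k\<close> is at most the
    weight \<open>Suc m\<close>.\<close>
  have diff: "real k * \<bar>T M - T k\<bar> \<le> 2 * A" if "k \<le> M" for k M
  proof -
    have "T M - T k = 2 * (\<Sum>m\<in>{k..<M}. a (Suc m))"
      using that by (simp add: T_def sum_diff_nat_ivl[of 0 k M "\<lambda>m. a (Suc m)", symmetric] atLeast0LessThan right_diff_distrib)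
    then have "real k * \<bar>T M - T k\<bar> = 2 * (real k * \<bar>\<Sum>m\<in>{k..<M}. a (Suc m)\<bar>)"
      by (simp add: abs_mult)
    also have "\<dots> \<le> 2 * (real k * (\<Sum>m\<in>{k..<M}. \<bar>a (Suc m)\<bar>))"
      by (intro mult_left_mono sum_abs) auto
    also have "\<dots> \<le> 2 * sum ?b {k..<M}"
      unfolding sum_distrib_left[of "real k"] by (intro mult_left_mono sum_mono mult_right_mono) auto
    also have "\<dots> \<le> 2 * A" using finA[of "{k..<M}"] by simp
    finally show ?thesis .
  qed
  have T_small: "real M * \<bar>T M\<bar> \<le> C * (2 * real L + real M / real L) + 2 * A" if "L \<ge> 1" for M L
  proof -
    have "real M * T M = G M + 2 * P M" using G_eq[of M] by simp
    then have "\<bar>real M * T M\<bar> \<le> C * (2 * real L + real M / real L) + 2 * A"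
      using ub[OF that, of M] pos[of M] PA[of M] A0 by linarith
    then show ?thesis by (simp add: abs_mult)
  qed
  have "T \<longlonglongrightarrow> 0"
  proof (rule LIMSEQ_I)
    fix \<epsilon> :: real assume \<epsilon>: "\<epsilon> > 0"
    \<comment> \<open>\<open>L\<close> is fixed before \<open>M\<close>: it makes the slope
      \<open>C / L\<close> small, and a large \<open>M\<close> then absorbs the constant
      \<open>2 * C * L + 2 * A\<close>.\<close>
    obtain L :: nat where L: "L \<ge> 1" "C / real L < \<epsilon> / 2"
    proof -
      obtain L0 :: nat where "real L0 > 2 * C / \<epsilon>" using reals_Archimedean2 by blast
      then have "2 * C < \<epsilon> * real (Suc L0)" using \<epsilon> by (simp add: field_simps)
      then have "C / real (Suc L0) < \<epsilon> / 2" by (simp add: field_simps)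
      then show thesis by (intro that[of "Suc L0"]) auto
    qed
    define X where "X = C * (2 * real L) + 2 * A"
    obtain M0 :: nat where M0: "real M0 > 2 * X / \<epsilon>" using reals_Archimedean2 by blast
    have "norm (T M - 0) < \<epsilon>" if "M \<ge> Suc M0" for M
    proof -
      define u where "u = \<epsilon> * real M"
      define w where "w = real M * (C / real L)"
      have "2 * X < \<epsilon> * real M0" using M0 \<epsilon> by (simp add: field_simps)
      also have "\<dots> \<le> u" unfolding u_def using that \<epsilon> by (intro mult_left_mono) auto
      finally have "2 * X < u" .
      moreover have "real M * \<bar>T M\<bar> \<le> X + w"
        using T_small[OF L(1), of M] unfolding X_def w_def by (simp add: algebra_simps)
      moreover have "2 * w \<le> u"
        using mult_left_mono[OF less_imp_le[OF L(2)], of "real M"] unfolding u_def w_def by (simp add: mult.commute)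
      ultimately have "real M * \<bar>T M\<bar> < u" by linarith
      then have "real M * \<bar>T M\<bar> < \<epsilon> * real M" unfolding u_def .
      then have "real M * \<bar>T M\<bar> < real M * \<epsilon>" by (simp only: mult.commute)
      then show ?thesis using that by (simp add: mult_less_cancel_left)
    qed
    then show "\<exists>M0. \<forall>M\<ge>M0. norm (T M - 0) < \<epsilon>" by blast
  qed
  \<comment> \<open>At fixed \<open>k\<close> the bound on \<open>T M - T k\<close> survives the
    limit in \<open>M\<close>, where \<open>T M\<close> disappears.\<close>
  then have "(\<lambda>M. real k * \<bar>T M - T k\<bar>) \<longlonglongrightarrow> real k * \<bar>0 - T k\<bar>"
    by (intro tendsto_intros)
  then have "real k * \<bar>0 - T k\<bar> \<le> 2 * A"
    by (rule LIMSEQ_le_const2) (use diff in blast)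
  then have "real k * T k \<le> 2 * A"
    by (smt (verit, best) abs_ge_self abs_minus mult_left_mono of_nat_0_le_iff diff_0)
  then show ?thesis
    unfolding A_def[symmetric] using G_eq[of k] PA[of k] by linarith
qed

section \<open>Straight paths and the height function\<close>

definition hz :: "int \<Rightarrow> int \<Rightarrow> point \<times> point" where "hz x y = ((x, y), (x + 1, y))"

definition vt :: "int \<Rightarrow> int \<Rightarrow> point \<times> point" where "vt x y = ((x, y), (x, y + 1))"

lemma hz_vt_Z2 [simp]: "hz x y \<in> Z2" "vt x y \<in> Z2"
  by (simp_all add: hz_def vt_def Z2_def)

lemma hz_eq_iff [simp]: "hz a b = hz c d \<longleftrightarrow> a = c \<and> b = d" "hz a b \<noteq> prod.swap (hz c d)"
  by (auto simp: hz_def)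

lemma horiz_edge_hz: "horiz_edge i = hz (int i) 0"
  by (simp add: horiz_edge_def hz_def)

lemma emap_hz: "emap (shift (x, y)) (hz a b) = hz (a + x) (b + y)" "emap prod.swap (hz a b) = vt b a"
  by (simp_all add: hz_def vt_def shift_def)

lemma telescope_hz: "n = ext_d Z2 h \<Longrightarrow> (\<Sum>i<k. n (hz (x + int i) y)) = h (x + int k, y) - h (x, y)"
proof (induction k)
  case (Suc k)
  then have "n (hz (x + int k) y) = h (x + int (Suc k), y) - h (x + int k, y)"
    using hz_vt_Z2(1)[of "x + int k" y] by (simp add: ext_d_def hz_def add_ac)
  then show ?case using Suc by simp
qed simp

lemma telescope_vt: "n = ext_d Z2 h \<Longrightarrow> (\<Sum>i<k. n (vt x (y + int i))) = h (x, y + int k) - h (x, y)"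
proof (induction k)
  case (Suc k)
  then have "n (vt x (y + int k)) = h (x, y + int (Suc k)) - h (x, y + int k)"
    using hz_vt_Z2(2)[of x "y + int k"] by (simp add: ext_d_def vt_def add_ac)
  then show ?case using Suc by simp
qed simp

text \<open>Two potentials of the same form differ by a constant since the lattice is connected; the
  normalisation at the origin makes the definite description legitimate.\<close>

lemma height_fun_exact:
  assumes "n \<in> H_star Z2"
  shows "n = ext_d Z2 (height_fun n)"
proof -
  obtain h0 where h0: "n = ext_d Z2 h0" using assms by (auto simp: H_star_def)
  have "\<exists>!h. h (0, 0) = 0 \<and> ext_d Z2 h = n"
  proof (rule ex1I[of _ "\<lambda>v. h0 v - h0 (0, 0)"])
    show "h0 (0, 0) - h0 (0, 0) = 0 \<and> ext_d Z2 (\<lambda>v. h0 v - h0 (0, 0)) = n"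
      by (auto simp: h0 ext_d_def)
    fix h assume h: "h (0, 0) = 0 \<and> ext_d Z2 h = n"
    show "h = (\<lambda>v. h0 v - h0 (0, 0))"
    proof
      fix v :: point
      define K where "K = nat \<bar>fst v\<bar> + nat \<bar>snd v\<bar>"
      have "v \<in> box K" by (cases v) (auto simp: box_def K_def)
      then have "h v - h0 v = h (0, 0) - h0 (0, 0)"
      proof (rule box_const[where \<phi> = "\<lambda>v. h v - h0 v", rotated])
        fix x y assume "(x, y) \<in> Z2"
        moreover have "ext_d Z2 h (x, y) = ext_d Z2 h0 (x, y)" using h h0 by simp
        ultimately show "h x - h0 x = h y - h0 y" by (simp add: ext_d_def)
      qed
      then show "h v = h0 v - h0 (0, 0)" using h by linarith
    qed
  qed
  from theI'[OF this] show ?thesis unfolding height_fun_def by simp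
qed

section \<open>Moments of the height gradient in terms of spins\<close>

context height_lim
begin

lemma \<rho>_bound:
  assumes B: "\<And>J. norm (\<Prod>e\<in>F. q (a e) (J e)) \<le> B ^ card F * (\<Prod>e\<in>F. c (a e))"
  shows "\<bar>\<rho> F a\<bar> \<le> B ^ card F * (\<Prod>e\<in>F. c (a e))"
proof -
  have "(\<lambda>J. \<Prod>e\<in>F. q (a e) (J e)) \<in> borel_measurable \<mu>"
    by (intro borel_measurable_prod measurable_\<mu>_component measurable_q)
  then have int: "integrable \<mu> (\<lambda>J. \<Prod>e\<in>F. q (a e) (J e))"
    by (intro M.integrable_const_bound[of _ "B ^ card F * (\<Prod>e\<in>F. c (a e))"] AE_I2 B)
  have "\<bar>\<rho> F a\<bar> \<le> norm (\<integral>J. (\<Prod>e\<in>F. q (a e) (J e)) \<partial>\<mu>)"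
    unfolding \<rho>_def by (rule abs_Re_le_cmod)
  also have "\<dots> \<le> (\<integral>J. norm (\<Prod>e\<in>F. q (a e) (J e)) \<partial>\<mu>)"
    by (rule integral_norm_bound)
  also have "\<dots> \<le> (\<integral>J. B ^ card F * (\<Prod>e\<in>F. c (a e)) \<partial>\<mu>)"
    using int B by (intro integral_mono integrable_norm) simp_all
  finally show ?thesis by (simp add: M.prob_space)
qed

text \<open>Sum \<open>g\<close> against the cylinder probabilities and move the sum under the spin
  integral: on each edge it resums to the Fourier series of \<open>g * c\<close> divided by the
  weight.\<close>

lemma moment:
  assumes F: "finite F" "F \<subseteq> orientation Z2"
    and g: "\<And>e. e \<in> F \<Longrightarrow> (\<lambda>m. \<bar>g e m * c m\<bar>) summable_on UNIV"
  shows "integrable \<nu> (\<lambda>n. \<Prod>e\<in>F. g e (n e))" (is ?int)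
    and "(\<integral>n. (\<Prod>e\<in>F. g e (n e)) \<partial>\<nu>) =
      Re (\<integral>J. (\<Prod>e\<in>F. fourier (\<lambda>m. g e m * c m) (J e) / of_real (wt (J e))) \<partial>\<mu>)" (is ?eq)
proof -
  let ?P = "PiE F (\<lambda>_. UNIV :: int set)" and ?X = "\<lambda>n :: point \<times> point \<Rightarrow> int. restrict n F"
  let ?G = "\<lambda>a. \<Prod>e\<in>F. g e (a e)"
  obtain B where B1: "\<And>(F :: (point \<times> point) set) a J. norm (\<Prod>e\<in>F. q (a e) (J e)) \<le> B ^ card F * (\<Prod>e\<in>F. c (a e))"
      and B0: "B \<ge> 0"
    using norm_q_prod by blast
  have B: "\<And>a J. norm (\<Prod>e\<in>F. q (a e) (J e)) \<le> B ^ card F * (\<Prod>e\<in>F. c (a e))"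
    "\<And>a. \<bar>\<rho> F a\<bar> \<le> B ^ card F * (\<Prod>e\<in>F. c (a e))" "B \<ge> 0"
    by (rule B1, rule \<rho>_bound, rule B1, rule B0)
  have cnt: "countable ?P" using F by (intro countable_PiE) auto
  have eqC: "?X -` {a} = (cyl F a)" if "a \<in> ?P" for a
    using that by (auto simp: fun_eq_iff restrict_def PiE_def extensional_def)
  have meas: "?X \<in> \<nu> \<rightarrow>\<^sub>M count_space ?P"
    by (subst measurable_count_space_eq_countable[OF cnt]) (simp add: eqC cylinder_sets[OF F(1)])
  have D: "distr \<nu> (count_space ?P) ?X = density (count_space ?P) (\<lambda>a. ennreal (\<rho> F a))"
  proof (rule measure_eqI_countable[OF _ _ cnt])
    fix a assume a: "a \<in> ?P"
    have "emeasure (distr \<nu> (count_space ?P) ?X) {a} = ennreal (\<rho> F a)"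
      using a by (simp add: emeasure_distr[OF meas] eqC N.emeasure_eq_measure \<nu>_cylinder[OF F])
    also have "\<dots> = emeasure (density (count_space ?P) (\<lambda>a. ennreal (\<rho> F a))) {a}"
      using a by (simp add: emeasure_density)
    finally show "emeasure (distr \<nu> (count_space ?P) ?X) {a} = emeasure (density (count_space ?P) (\<lambda>a. ennreal (\<rho> F a))) {a}" .
  qed auto
  have sumb: "(\<lambda>a. B ^ card F * (\<Prod>e\<in>F. \<bar>g e (a e) * c (a e)\<bar>)) summable_on ?P"
    using prod_abs_summable_on_PiE[OF F(1), of "\<lambda>e m. g e m * c m"] g
    by (intro summable_on_cmult_right) (simp add: abs_prod)
  have bd: "\<bar>?G a\<bar> * (B ^ card F * (\<Prod>e\<in>F. c (a e))) = B ^ card F * (\<Prod>e\<in>F. \<bar>g e (a e) * c (a e)\<bar>)" for a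
    by (simp add: abs_prod abs_mult prod.distrib)
  have "(\<lambda>a. norm (\<rho> F a * ?G a)) summable_on ?P"
  proof (rule summable_on_comparison_test[OF sumb])
    show "norm (\<rho> F a * ?G a) \<le> B ^ card F * (\<Prod>e\<in>F. \<bar>g e (a e) * c (a e)\<bar>)" for a
      unfolding bd[symmetric] using mult_right_mono[OF B(2)[of a], of "\<bar>?G a\<bar>"] by (simp add: abs_mult mult.commute)
  qed auto
  then have summ: "Infinite_Set_Sum.abs_summable_on (\<lambda>a. \<rho> F a * ?G a) ?P"
    by (simp only: abs_summable_equivalent)
  have Xr: "?G (?X n) = ?G n" for n by (intro prod.cong) auto
  have "integrable (distr \<nu> (count_space ?P) ?X) ?G"
    unfolding D using summ \<rho>_nonneg[OF F]
    by (subst integrable_density) (auto simp: Infinite_Set_Sum.abs_summable_on_def)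
  then show ?int
    using integrable_distr_eq[OF meas, of ?G] by (simp add: Xr cong: prod.cong)
  have "(\<integral>n. ?G n \<partial>\<nu>) = (\<integral>a. ?G a \<partial>distr \<nu> (count_space ?P) ?X)"
    by (subst integral_distr[OF meas]) (simp_all add: Xr cong: prod.cong)
  also have "\<dots> = infsum (\<lambda>a. \<rho> F a * ?G a) ?P"
    unfolding D using \<rho>_nonneg[OF F] summ
    by (subst integral_density) (auto simp: infsetsum_def[symmetric] infsetsum_infsum)
  also have "\<dots> = Re (\<integral>J. (\<Prod>e\<in>F. fourier (\<lambda>m. g e m * c m) (J e) / of_real (wt (J e))) \<partial>\<mu>)"
  proof -
    have "((\<lambda>a. \<integral>J. of_real (?G a) * (\<Prod>e\<in>F. q (a e) (J e)) \<partial>\<mu>) has_sum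
        (\<integral>J. (\<Prod>e\<in>F. fourier (\<lambda>m. g e m * c m) (J e) / of_real (wt (J e))) \<partial>\<mu>)) ?P"
    proof (rule has_sum_integral[OF M.prob_space_axioms])
      have [measurable]: "fourier (\<lambda>m. g e m * c m) \<in> borel_measurable borel" if "e \<in> F" for e
        by (rule measurable_fourier[OF g[OF that]])
      show "(\<lambda>J. \<Prod>e\<in>F. fourier (\<lambda>m. g e m * c m) (J e) / of_real (wt (J e))) \<in> borel_measurable \<mu>"
        by (intro borel_measurable_prod measurable_\<mu>_component) measurable
      show "(\<lambda>J. of_real (?G a) * (\<Prod>e\<in>F. q (a e) (J e))) \<in> borel_measurable \<mu>" for a
        by (intro borel_measurable_times borel_measurable_prod measurable_\<mu>_component borel_measurable_const) measurable
      show "norm (of_real (?G a) * (\<Prod>e\<in>F. q (a e) (J e))) \<le> B ^ card F * (\<Prod>e\<in>F. \<bar>g e (a e) * c (a e)\<bar>)" for a J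
        unfolding bd[symmetric] norm_mult norm_of_real by (intro mult_left_mono B) simp
      show "(\<lambda>a. B ^ card F * (\<Prod>e\<in>F. \<bar>g e (a e) * c (a e)\<bar>)) summable_on ?P" by (rule sumb)
      fix J :: "point \<times> point \<Rightarrow> complex"
      have "((\<lambda>a. (\<Prod>e\<in>F. of_real (g e (a e) * c (a e)) * circ (J e) powi a e) / (\<Prod>e\<in>F. of_real (wt (J e)))) has_sum
          (\<Prod>e\<in>F. fourier (\<lambda>m. g e m * c m) (J e)) / (\<Prod>e\<in>F. of_real (wt (J e)))) ?P"
        by (intro has_sum_divide_const fourier_prod_has_sum[OF F(1), of "\<lambda>e m. g e m * c m"] g)
      also have "(\<lambda>a. (\<Prod>e\<in>F. of_real (g e (a e) * c (a e)) * circ (J e) powi a e) / (\<Prod>e\<in>F. of_real (wt (J e)))) =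
          (\<lambda>a. of_real (?G a) * (\<Prod>e\<in>F. q (a e) (J e)))"
        by (simp add: fun_eq_iff q_def prod_dividef prod.distrib)
      finally show "((\<lambda>a. of_real (?G a) * (\<Prod>e\<in>F. q (a e) (J e))) has_sum
          (\<Prod>e\<in>F. fourier (\<lambda>m. g e m * c m) (J e) / of_real (wt (J e)))) ?P"
        by (simp add: prod_dividef)
    qed
    moreover have "Re (\<integral>J. of_real (?G a) * (\<Prod>e\<in>F. q (a e) (J e)) \<partial>\<mu>) = \<rho> F a * ?G a" for a
      unfolding integral_mult_right_zero \<rho>_def by (simp del: of_real_prod)
    ultimately show ?thesis
      by (metis (no_types, lifting) has_sum_Re infsumI infsum_cong)
  qed
  finally show ?eq .
qed

lemma fourier_dU: "fourier (\<lambda>m. of_int m * c m) z / of_real (wt z) = \<i> * of_real (dU z)"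
  unfolding dU_eq by simp

definition dcov :: "point \<times> point \<Rightarrow> point \<times> point \<Rightarrow> real" where
  "dcov e e' = (\<integral>J. dU (J e) * dU (J e') \<partial>\<mu>)"

lemma integrable_dU: "integrable \<mu> (\<lambda>J. dU (J e) * dU (J e'))"
proof -
  obtain B where B: "\<And>z. \<bar>dU z\<bar> \<le> B" using dU_bounded by metis
  show ?thesis
  proof (rule M.integrable_const_bound[of _ "B * B"])
    show "AE J in \<mu>. norm (dU (J e) * dU (J e')) \<le> B * B"
      using B order_trans[OF abs_ge_zero B] by (auto simp: abs_mult intro!: mult_mono)
  qed (intro borel_measurable_times measurable_\<mu>_component measurable_dU)
qed

text \<open>Each of the two distinct edges contributes its own factor \<open>\<i> * dU\<close>, and
  the product of the two imaginary units is the minus sign.\<close>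

lemma cov_oriented:
  assumes e: "e \<in> orientation Z2" "e' \<in> orientation Z2" "e \<noteq> e'"
  shows "integrable \<nu> (\<lambda>n. of_int (n e) * of_int (n e') :: real)" "cov e e' = - dcov e e'"
proof -
  have F: "finite {e, e'}" "{e, e'} \<subseteq> orientation Z2" using e by auto
  note m = moment[OF F, of "\<lambda>_. of_int", OF abs_summable_c1]
  show "integrable \<nu> (\<lambda>n. of_int (n e) * of_int (n e') :: real)"
    using m(1) e(3) by simp
  have "cov e e' = Re (\<integral>J. (\<i> * of_real (dU (J e))) * (\<i> * of_real (dU (J e'))) \<partial>\<mu>)"
    unfolding cov_def using m(2) e(3) by (simp add: fourier_dU)
  also have "(\<lambda>J. (\<i> * of_real (dU (J e))) * (\<i> * of_real (dU (J e')))) = (\<lambda>J. complex_of_real (- (dU (J e) * dU (J e'))))"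
    by (simp add: fun_eq_iff complex_eq_iff)
  also have "Re (\<integral>J. complex_of_real (- (dU (J e) * dU (J e'))) \<partial>\<mu>) = - dcov e e'"
    unfolding integral_complex_of_real by (simp add: dcov_def)
  finally show "cov e e' = - dcov e e'" .
qed

text \<open>On a single edge the moment is the series with coefficients \<open>n^2 * c n\<close>
  over the weight, not a square of \<open>dU\<close>. The numerator converges absolutely and the
  weight stays away from 0, so one constant serves all edges.\<close>

lemma second_moment:
  "\<exists>K. \<forall>e\<in>orientation Z2. integrable \<nu> (\<lambda>n. of_int (n e) * of_int (n e) :: real) \<and> cov e e \<le> K"
proof -
  obtain \<delta> where \<delta>: "\<delta> > 0" "\<And>z. \<delta> \<le> wt z" using wt_lower by metis
  let ?K = "(\<Sum>\<^sub>\<infinity>m. \<bar>(of_int m)\<^sup>2 * c m\<bar>) / \<delta>"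
  have *: "integrable \<nu> (\<lambda>n. of_int (n e) * of_int (n e) :: real) \<and> cov e e \<le> ?K" if e: "e \<in> orientation Z2" for e
  proof -
    have F: "finite {e}" "{e} \<subseteq> orientation Z2" using e by auto
    note m = moment[OF F, of "\<lambda>_ m. (of_int m)\<^sup>2", OF abs_summable_c2]
    let ?f = "\<lambda>J. fourier (\<lambda>m. (of_int m)\<^sup>2 * c m) (J e) / of_real (wt (J e))"
    have bd: "norm (?f J) \<le> ?K" for J
    proof -
      have "norm (?f J) = norm (fourier (\<lambda>m. (of_int m)\<^sup>2 * c m) (J e)) / wt (J e)"
        using wt_pos[of "J e"] by (simp add: norm_divide)
      also have "\<dots> \<le> ?K"
        using \<delta> norm_fourier_le[OF abs_summable_c2] by (intro frac_le) (auto intro: infsum_nonneg)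
      finally show ?thesis .
    qed
    have [measurable]: "fourier (\<lambda>m. (of_int m)\<^sup>2 * c m) \<in> borel_measurable borel"
      by (rule measurable_fourier[OF abs_summable_c2])
    have int: "integrable \<mu> ?f"
    proof (rule M.integrable_const_bound[of _ ?K])
      show "?f \<in> borel_measurable \<mu>"
        by (rule measurable_\<mu>_component[of "\<lambda>z. fourier (\<lambda>m. (of_int m)\<^sup>2 * c m) z / of_real (wt z)"]) measurable
    qed (use bd in simp)
    have "cov e e = Re (\<integral>J. ?f J \<partial>\<mu>)"
      unfolding cov_def using m(2) by (simp add: power2_eq_square)
    also have "\<dots> = (\<integral>J. Re (?f J) \<partial>\<mu>)"
      using int by (simp only: integral_Re)
    also have "\<dots> \<le> (\<integral>J. ?K \<partial>\<mu>)"
      using int by (intro integral_mono integrable_Re order_trans[OF complex_Re_le_cmod bd]) simp_all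
    also have "\<dots> = ?K" by (simp add: M.prob_space)
    finally show ?thesis using m(1) by (simp add: power2_eq_square)
  qed
  then show ?thesis by blast
qed

text \<open>The moment formula is available on \<open>orientation Z2\<close> only, while the
  coordinate directions followed by a path need not agree with the orientation by
  \<open>to_nat\<close>. \<open>sg\<close> below is the sign picked up in passing to the
  representative.\<close>

definition rep :: "point \<times> point \<Rightarrow> point \<times> point" where
  "rep e = (if e \<in> orientation Z2 then e else prod.swap e)"

definition sg :: "point \<times> point \<Rightarrow> real" where
  "sg e = (if e \<in> orientation Z2 then 1 else -1)"

lemma sg_square [simp]: "sg e * sg e = 1"
  by (simp add: sg_def)

lemma rep_oriented: "e \<in> Z2 \<Longrightarrow> rep e \<in> orientation Z2"
  using orientation_iff[OF Z2_facts(2,1), of "fst e" "snd e"] by (cases e) (auto simp: rep_def)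

lemma AE_n_rep: "AE n in \<nu>. \<forall>e\<in>Z2. real_of_int (n e) = sg e * of_int (n (rep e))"
  using AE_exact
proof eventually_elim
  case (elim n)
  show ?case
  proof
    fix e :: "point \<times> point"
    have "n e = - n (prod.swap e)"
      using H_star_antisym[OF elim Z2_facts(1), of "fst e" "snd e"] by (simp add: prod.swap_def)
    then show "real_of_int (n e) = sg e * of_int (n (rep e))"
      by (cases "e \<in> orientation Z2") (simp_all add: sg_def rep_def)
  qed
qed

lemma AE_J_rep: "AE J in \<mu>. \<forall>e\<in>Z2. dU (J e) = sg e * dU (J (rep e))"
proof -
  have "AE J in \<mu>. J \<in> H_diamond Z2" using \<mu> by (simp add: spin_limit_def)
  then show ?thesis
  proof eventually_elim
    case (elim J)
    then have J: "J \<in> circle_forms Z2" by (simp add: H_diamond_def)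
    show ?case
    proof
      fix e :: "point \<times> point"
      have "J e = inverse (J (prod.swap e))"
        using circle_formsD(3)[OF J Z2_facts(1), of "fst e" "snd e"] by (simp add: prod.swap_def)
      then have "dU (J e) = - dU (J (prod.swap e))"
        using dU_inverse[OF circle_formsD(1)[OF J], of "prod.swap e"] by metis
      then show "dU (J e) = sg e * dU (J (rep e))"
        by (cases "e \<in> orientation Z2") (simp_all add: sg_def rep_def)
    qed
  qed
qed

lemma measurable_n [measurable]: "(\<lambda>n. real_of_int (n e)) \<in> borel_measurable \<nu>"
proof -
  have "(\<lambda>n :: point \<times> point \<Rightarrow> int. real_of_int (n e)) \<in> borel_measurable borel"
    by (rule measurable_compose[OF measurable_component borel_measurable_continuous_onI])
      (rule Topological_Spaces.continuous_on_discrete)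
  then show ?thesis by (simp only: measurable_cong_sets[OF sets_\<nu> refl])
qed

lemma integrable_pair:
  assumes "e \<in> Z2" "e' \<in> Z2"
  shows "integrable \<nu> (\<lambda>n. of_int (n e) * of_int (n e') :: real)"
proof -
  have "integrable \<nu> (\<lambda>n. of_int (n (rep e)) * of_int (n (rep e')) :: real)"
  proof (cases "rep e = rep e'")
    case True
    obtain K where "\<forall>e\<in>orientation Z2. integrable \<nu> (\<lambda>n. of_int (n e) * of_int (n e) :: real) \<and> cov e e \<le> K"
      using second_moment by blast
    from bspec[OF this rep_oriented[OF assms(1)]] show ?thesis
      unfolding True[symmetric] by (rule conjunct1)
  next
    case False
    then show ?thesis by (intro cov_oriented(1) rep_oriented assms)
  qed
  then have "integrable \<nu> (\<lambda>n. (sg e * sg e') * (of_int (n (rep e)) * of_int (n (rep e'))) :: real)"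
    by simp
  moreover have "AE n in \<nu>. (sg e * sg e') * (of_int (n (rep e)) * of_int (n (rep e'))) = real_of_int (n e) * of_int (n e')"
    using AE_n_rep by eventually_elim (use assms in simp)
  ultimately show ?thesis
    by (subst (asm) integrable_cong_AE) simp_all
qed

lemma cov_rep:
  assumes "e \<in> Z2" "e' \<in> Z2"
  shows "cov e e' = sg e * sg e' * cov (rep e) (rep e')" "dcov e e' = sg e * sg e' * dcov (rep e) (rep e')"
proof -
  have "cov e e' = (\<integral>n. (sg e * sg e') * (of_int (n (rep e)) * of_int (n (rep e'))) \<partial>\<nu>)"
    unfolding cov_def
  proof (rule integral_cong_AE)
    show "AE n in \<nu>. real_of_int (n e) * of_int (n e') = (sg e * sg e') * (of_int (n (rep e)) * of_int (n (rep e')))"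
      using AE_n_rep by eventually_elim (use assms in simp)
  qed measurable
  then show "cov e e' = sg e * sg e' * cov (rep e) (rep e')"
    by (simp add: cov_def)
  have m: "(\<lambda>J. dU (J e) * dU (J e')) \<in> borel_measurable \<mu>" for e e'
    using integrable_dU by (rule borel_measurable_integrable)
  have "dcov e e' = (\<integral>J. (sg e * sg e') * (dU (J (rep e)) * dU (J (rep e'))) \<partial>\<mu>)"
    unfolding dcov_def
  proof (rule integral_cong_AE)
    show "AE J in \<mu>. dU (J e) * dU (J e') = (sg e * sg e') * (dU (J (rep e)) * dU (J (rep e')))"
      using AE_J_rep by eventually_elim (use assms in simp)
  qed (intro m borel_measurable_times borel_measurable_const)+
  then show "dcov e e' = sg e * sg e' * dcov (rep e) (rep e')"
    by (simp add: dcov_def)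
qed

lemma cov_eq:
  assumes "e \<in> Z2" "e' \<in> Z2" "e' \<noteq> e" "e' \<noteq> prod.swap e"
  shows "cov e e' = - dcov e e'"
proof -
  have "rep e \<noteq> rep e'"
    using assms(3,4) unfolding rep_def by (metis swap_swap)
  then show ?thesis
    using cov_oriented(2)[OF rep_oriented rep_oriented] assms(1,2) by (simp add: cov_rep)
qed

lemma sq_sum:
  assumes "finite A" "\<And>i. i \<in> A \<Longrightarrow> f i \<in> Z2"
  shows "integrable \<nu> (\<lambda>n. (\<Sum>i\<in>A. real_of_int (n (f i)))\<^sup>2)"
    "(\<integral>n. (\<Sum>i\<in>A. real_of_int (n (f i)))\<^sup>2 \<partial>\<nu>) = (\<Sum>i\<in>A. \<Sum>j\<in>A. cov (f i) (f j))"
proof -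
  have sq: "(\<Sum>i\<in>A. real_of_int (n (f i)))\<^sup>2 = (\<Sum>i\<in>A. \<Sum>j\<in>A. of_int (n (f i)) * of_int (n (f j)))" for n
    by (simp add: power2_eq_square sum_product)
  have i: "integrable \<nu> (\<lambda>n. real_of_int (n (f i)) * of_int (n (f j)))" if "i \<in> A" "j \<in> A" for i j
    by (intro integrable_pair assms that)
  show "integrable \<nu> (\<lambda>n. (\<Sum>i\<in>A. real_of_int (n (f i)))\<^sup>2)"
    unfolding sq by (intro Bochner_Integration.integrable_sum i)
  have "(\<integral>n. (\<Sum>i\<in>A. \<Sum>j\<in>A. real_of_int (n (f i)) * of_int (n (f j))) \<partial>\<nu>) =
      (\<Sum>i\<in>A. \<integral>n. (\<Sum>j\<in>A. real_of_int (n (f i)) * of_int (n (f j))) \<partial>\<nu>)"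
    by (intro Bochner_Integration.integral_sum Bochner_Integration.integrable_sum i)
  also have "\<dots> = (\<Sum>i\<in>A. \<Sum>j\<in>A. cov (f i) (f j))"
    unfolding cov_def by (intro sum.cong refl Bochner_Integration.integral_sum i)
  finally show "(\<integral>n. (\<Sum>i\<in>A. real_of_int (n (f i)))\<^sup>2 \<partial>\<nu>) = (\<Sum>i\<in>A. \<Sum>j\<in>A. cov (f i) (f j))"
    unfolding sq .
qed

text \<open>The off-diagonal part is minus a square on the spin side, hence only the diagonal contributes.\<close>

lemma quadratic_bound:
  "\<exists>C\<ge>0. \<forall>(A :: 'i set) f. finite A \<longrightarrow> (\<forall>i\<in>A. f i \<in> Z2) \<longrightarrow>
      (\<forall>i\<in>A. \<forall>j\<in>A. i \<noteq> j \<longrightarrow> f j \<noteq> f i \<and> f j \<noteq> prod.swap (f i)) \<longrightarrow>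
      (\<integral>n. (\<Sum>i\<in>A. real_of_int (n (f i)))\<^sup>2 \<partial>\<nu>) \<le> C * real (card A)"
proof -
  obtain K where K: "\<And>e. e \<in> orientation Z2 \<Longrightarrow> cov e e \<le> K" using second_moment by blast
  obtain B where B: "\<And>z. \<bar>dU z\<bar> \<le> B" using dU_bounded by metis
  \<comment> \<open>Bounds \<open>cov e e + dcov e e\<close>, all that remains after the spin-side
    double sum has been added to that of the heights.\<close>
  define C where "C = \<bar>K\<bar> + B * B"
  have diag: "cov e e + dcov e e \<le> C" if "e \<in> Z2" for e
  proof -
    have "cov e e \<le> K"
      using K[OF rep_oriented[OF that]] cov_rep(1)[OF that that] by simp
    moreover have "dcov e e \<le> (\<integral>J. B * B \<partial>\<mu>)"
    proof -
      have "dU z * dU z \<le> B * B" for z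
        using mult_mono[OF B[of z] B[of z] order_trans[OF abs_ge_zero B[of z]] abs_ge_zero]
        by (simp only: abs_mult_self_eq)
      then show ?thesis
        unfolding dcov_def by (intro integral_mono integrable_dU) simp_all
    qed
    ultimately show ?thesis by (simp add: C_def M.prob_space)
  qed
  have main: "(\<integral>n. (\<Sum>i\<in>A. real_of_int (n (f i)))\<^sup>2 \<partial>\<nu>) \<le> C * real (card A)"
    if A: "finite A" "\<And>i. i \<in> A \<Longrightarrow> f i \<in> Z2"
      and dist: "\<And>i j. i \<in> A \<Longrightarrow> j \<in> A \<Longrightarrow> i \<noteq> j \<Longrightarrow> f j \<noteq> f i \<and> f j \<noteq> prod.swap (f i)"
    for A :: "'i set" and f
  proof -
    have "(\<integral>J. (\<Sum>i\<in>A. dU (J (f i)))\<^sup>2 \<partial>\<mu>) = (\<integral>J. (\<Sum>i\<in>A. \<Sum>j\<in>A. dU (J (f i)) * dU (J (f j))) \<partial>\<mu>)"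
      by (simp add: power2_eq_square sum_product)
    also have "\<dots> = (\<Sum>i\<in>A. \<integral>J. (\<Sum>j\<in>A. dU (J (f i)) * dU (J (f j))) \<partial>\<mu>)"
      by (intro Bochner_Integration.integral_sum Bochner_Integration.integrable_sum integrable_dU)
    also have "\<dots> = (\<Sum>i\<in>A. \<Sum>j\<in>A. dcov (f i) (f j))"
      unfolding dcov_def by (intro sum.cong refl Bochner_Integration.integral_sum integrable_dU)
    finally have "(\<integral>J. (\<Sum>i\<in>A. dU (J (f i)))\<^sup>2 \<partial>\<mu>) = (\<Sum>i\<in>A. \<Sum>j\<in>A. dcov (f i) (f j))" .
    moreover have "(\<integral>J. (\<Sum>i\<in>A. dU (J (f i)))\<^sup>2 \<partial>\<mu>) \<ge> 0"
      by (rule Bochner_Integration.integral_nonneg) simp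
    ultimately have "(\<Sum>i\<in>A. \<Sum>j\<in>A. dcov (f i) (f j)) \<ge> 0" by linarith
    moreover have "(\<Sum>i\<in>A. \<Sum>j\<in>A. cov (f i) (f j) + dcov (f i) (f j)) =
        (\<Sum>i\<in>A. \<Sum>j\<in>A. if i = j then cov (f i) (f i) + dcov (f i) (f i) else 0)"
    proof (intro sum.cong refl)
      fix i j assume ij: "i \<in> A" "j \<in> A"
      show "cov (f i) (f j) + dcov (f i) (f j) = (if i = j then cov (f i) (f i) + dcov (f i) (f i) else 0)"
      proof (cases "i = j")
        case False
        then have "cov (f i) (f j) = - dcov (f i) (f j)"
          using dist[OF ij] by (intro cov_eq A(2) ij) simp_all
        then show ?thesis using False by simp
      qed simp
    qed
    moreover have "\<dots> \<le> (\<Sum>i\<in>A. C)"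
    proof -
      have "(\<Sum>i\<in>A. \<Sum>j\<in>A. if i = j then cov (f i) (f i) + dcov (f i) (f i) else 0) =
          (\<Sum>i\<in>A. cov (f i) (f i) + dcov (f i) (f i))"
        using A(1) by (intro sum.cong refl) simp
      also have "\<dots> \<le> (\<Sum>i\<in>A. C)"
        by (intro sum_mono diag A(2))
      finally show ?thesis .
    qed
    moreover have "(\<integral>n. (\<Sum>i\<in>A. real_of_int (n (f i)))\<^sup>2 \<partial>\<nu>) = (\<Sum>i\<in>A. \<Sum>j\<in>A. cov (f i) (f j))"
      by (rule sq_sum(2)[OF A])
    ultimately show ?thesis
      by (simp add: sum.distrib mult.commute)
  qed
  show ?thesis
  proof (intro exI[of _ C] conjI allI impI)
    show "C \<ge> 0" by (simp add: C_def)
    fix A :: "'i set" and f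
    assume "finite A" "\<forall>i\<in>A. f i \<in> Z2"
      and dist: "\<forall>i\<in>A. \<forall>j\<in>A. i \<noteq> j \<longrightarrow> f j \<noteq> f i \<and> f j \<noteq> prod.swap (f i)"
    then show "(\<integral>n. (\<Sum>i\<in>A. real_of_int (n (f i)))\<^sup>2 \<partial>\<nu>) \<le> C * real (card A)"
      by (intro main) blast+
  qed
qed

section \<open>Variance of height differences along coordinate lines\<close>

definition G :: "nat \<Rightarrow> real" where
  "G k = (\<Sum>i<k. \<Sum>j<k. cov (hz (int i) 0) (hz (int j) 0))"

lemma hz_variance: "(\<integral>n. (\<Sum>i<k. real_of_int (n (hz (x + int i) y)))\<^sup>2 \<partial>\<nu>) = G k"
proof -
  have "cov (hz (x + int i) y) (hz (x + int j) y) = cov (hz (int i) 0) (hz (int j) 0)" for i j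
    using cov_shift[OF hz_vt_Z2(1) hz_vt_Z2(1), of "(x, y)" "int i" 0 "int j" 0]
    unfolding emap_hz by (simp only: add.commute add_0_left)
  then have "(\<Sum>i<k. \<Sum>j<k. cov (hz (x + int i) y) (hz (x + int j) y)) = G k"
    unfolding G_def by (simp only:)
  then show ?thesis
    using sq_sum(2)[of "{..<k}" "\<lambda>i. hz (x + int i) y"] by simp
qed

lemma vt_variance: "(\<integral>n. (\<Sum>i<k. real_of_int (n (vt x (y + int i))))\<^sup>2 \<partial>\<nu>) = G k"
proof -
  have "cov (vt x (y + int i)) (vt x (y + int j)) = cov (hz (int i) 0) (hz (int j) 0)" for i j
  proof -
    have "cov (vt x (y + int i)) (vt x (y + int j)) = cov (hz (y + int i) x) (hz (y + int j) x)"
      using cov_transpose[OF hz_vt_Z2(1) hz_vt_Z2(1), of "y + int i" x "y + int j" x] unfolding emap_hz .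
    also have "\<dots> = cov (hz (int i) 0) (hz (int j) 0)"
      using cov_shift[OF hz_vt_Z2(1) hz_vt_Z2(1), of "(y, x)" "int i" 0 "int j" 0]
      unfolding emap_hz by (simp only: add.commute add_0_left)
    finally show ?thesis .
  qed
  then have "(\<Sum>i<k. \<Sum>j<k. cov (vt x (y + int i)) (vt x (y + int j))) = G k"
    unfolding G_def by (simp only:)
  then show ?thesis
    using sq_sum(2)[of "{..<k}" "\<lambda>i. vt x (y + int i)"] by simp
qed

lemma G_nonneg: "G k \<ge> 0"
  unfolding hz_variance[where x = 0 and y = 0, symmetric]
  by (rule Bochner_Integration.integral_nonneg) simp

definition cor :: "nat \<Rightarrow> real" where "cor m = cov (hz 0 0) (hz (int m) 0)"

lemma cov_sym: "cov e e' = cov e' e"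
  by (simp add: cov_def mult.commute)

lemma cov_hz: "i \<le> j \<Longrightarrow> cov (hz (int i) 0) (hz (int j) 0) = cor (j - i)"
  using cov_shift[OF hz_vt_Z2(1) hz_vt_Z2(1), of "(int i, 0)" 0 0 "int (j - i)" 0]
  unfolding emap_hz cor_def by (simp add: of_nat_diff)

text \<open>The appended edge adds its own second moment and twice its covariances with the earlier
  edges, which lie at distances 1 to \<open>k\<close>.\<close>

lemma G_Suc: "G (Suc k) = G k + cor 0 + 2 * (\<Sum>m<k. cor (Suc m))"
proof -
  have "(\<Sum>i<k. cov (hz (int i) 0) (hz (int k) 0)) = (\<Sum>i<k. cor (Suc (k - Suc i)))"
    by (intro sum.cong refl) (simp add: cov_hz Suc_diff_Suc)
  also have "\<dots> = (\<Sum>m<k. cor (Suc m))"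
    by (rule sum.nat_diff_reindex)
  finally have *: "(\<Sum>i<k. cov (hz (int i) 0) (hz (int k) 0)) = (\<Sum>m<k. cor (Suc m))" .
  have "G (Suc k) = (\<Sum>i<k. (\<Sum>j<k. cov (hz (int i) 0) (hz (int j) 0)) + cov (hz (int i) 0) (hz (int k) 0)) +
      ((\<Sum>j<k. cov (hz (int k) 0) (hz (int j) 0)) + cov (hz (int k) 0) (hz (int k) 0))"
    unfolding G_def by simp
  also have "(\<Sum>j<k. cov (hz (int k) 0) (hz (int j) 0)) = (\<Sum>m<k. cor (Suc m))"
    unfolding *[symmetric] by (intro sum.cong refl cov_sym)
  also have "cov (hz (int k) 0) (hz (int k) 0) = cor 0"
    using cov_hz[of k k] by simp
  finally show ?thesis
    unfolding sum.distrib * G_def by simp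
qed

text \<open>Stated at positive distance, since on the diagonal the second moment takes the place of
  the square of \<open>dU\<close>. The sign disappears in absolute values.\<close>

lemma cor_two_point: "cor (Suc m) = - two_point V \<mu> (Suc m)"
proof -
  have "cor (Suc m) = - dcov (hz 0 0) (hz (int (Suc m)) 0)"
    unfolding cor_def by (rule cov_eq) simp_all
  then show ?thesis
    by (simp add: dcov_def two_point_def horiz_edge_hz dU_def)
qed

text \<open>Replacing the straight path by an average of detours at heights \<open>j < L\<close> spreads the unit flow.\<close>

lemma G_upper:
  obtains C where "C \<ge> 0" "\<And>L k. L \<ge> 1 \<Longrightarrow> G k \<le> C * (2 * real L + real k / real L)"
proof -
  \<comment> \<open>The quadratic bound is used with two index types, for the edges of a line and
    for those of a grid; the larger constant serves both.\<close>
  obtain C1 where C1: "C1 \<ge> 0" "\<forall>(A :: nat set) f. finite A \<longrightarrow> (\<forall>i\<in>A. f i \<in> Z2) \<longrightarrow>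
      (\<forall>i\<in>A. \<forall>j\<in>A. i \<noteq> j \<longrightarrow> f j \<noteq> f i \<and> f j \<noteq> prod.swap (f i)) \<longrightarrow>
      (\<integral>n. (\<Sum>i\<in>A. real_of_int (n (f i)))\<^sup>2 \<partial>\<nu>) \<le> C1 * real (card A)"
    using quadratic_bound[where 'i = nat] by blast
  obtain C2 where C2: "C2 \<ge> 0" "\<forall>(A :: (nat \<times> nat) set) f. finite A \<longrightarrow> (\<forall>i\<in>A. f i \<in> Z2) \<longrightarrow>
      (\<forall>i\<in>A. \<forall>j\<in>A. i \<noteq> j \<longrightarrow> f j \<noteq> f i \<and> f j \<noteq> prod.swap (f i)) \<longrightarrow>
      (\<integral>n. (\<Sum>i\<in>A. real_of_int (n (f i)))\<^sup>2 \<partial>\<nu>) \<le> C2 * real (card A)"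
    using quadratic_bound[where 'i = "nat \<times> nat"] by blast
  define C where "C = max C1 C2"
  have C: "C \<ge> 0" "C1 \<le> C" "C2 \<le> C" using C1 by (auto simp: C_def)
  \<comment> \<open>A crude linear bound, sufficient for the vertical legs of the detours, whose
    length is below \<open>L\<close>.\<close>
  have Gj: "G j \<le> C * real L" if "j \<le> L" for j L
  proof -
    have "G j \<le> C1 * real (card {..<j})"
      unfolding hz_variance[where x = 0 and y = 0, symmetric] by (rule C1(2)[rule_format]) simp_all
    also have "\<dots> \<le> C * real L" using C C1(1) that by (intro mult_mono) auto
    finally show ?thesis .
  qed
  have main: "G k \<le> 3 * C * (2 * real L + real k / real L)" if L: "L \<ge> 1" for L k
  proof -
    let ?p = "\<lambda>x j n. \<Sum>i<j. real_of_int (n (vt x (0 + int i)))"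
    let ?w = "\<lambda>n. \<Sum>p\<in>{..<L} \<times> {..<k}. real_of_int (n (hz (0 + int (snd p)) (int (fst p))))"
    let ?x = "\<lambda>n. \<Sum>i<k. real_of_int (n (hz (0 + int i) 0))"
    \<comment> \<open>The vertical legs are treated by Cauchy-Schwarz over the \<open>L\<close>
      detours. The horizontal part \<open>?w\<close> stays a single sum over the grid: its second
      moment is of order \<open>L * k\<close>, so the prefactor \<open>1 / L^2\<close> leaves
      \<open>k / L\<close>.\<close>
    let ?R = "\<lambda>n. 3 / real L * ((\<Sum>j<L. (?p 0 j n)\<^sup>2) + (\<Sum>j<L. (?p (int k) j n)\<^sup>2)) + 3 / (real L)\<^sup>2 * (?w n)\<^sup>2"
    have ip: "integrable \<nu> (\<lambda>n. (?p x j n)\<^sup>2)" for x j by (rule sq_sum(1)) simp_all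
    have iw: "integrable \<nu> (\<lambda>n. (?w n)\<^sup>2)" by (rule sq_sum(1)) simp_all
    have ix: "integrable \<nu> (\<lambda>n. (?x n)\<^sup>2)" by (rule sq_sum(1)) simp_all
    have iR: "integrable \<nu> ?R"
      by (intro Bochner_Integration.integrable_add integrable_mult_right Bochner_Integration.integrable_sum ip iw)
    have le: "AE n in \<nu>. (?x n)\<^sup>2 \<le> ?R n"
      using AE_exact
    proof eventually_elim
      case (elim n)
      define h where "h = height_fun n"
      have nh: "n = ext_d Z2 h" unfolding h_def by (rule height_fun_exact[OF elim])
      have X: "?x n = real_of_int (h (int k, 0) - h (0, 0))"
        using telescope_hz[OF nh, of 0 0 k] by (simp flip: of_int_sum)
      have Pj: "?p x j n = real_of_int (h (x, int j) - h (x, 0))" for x j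
        using telescope_vt[OF nh, of x 0 j] by (simp flip: of_int_sum)
      have W: "?w n = (\<Sum>j<L. real_of_int (h (int k, int j) - h (0, int j)))"
      proof -
        have "?w n = (\<Sum>j<L. \<Sum>i<k. real_of_int (n (hz (0 + int i) (int j))))"
          by (simp add: sum.cartesian_product case_prod_beta)
        also have "\<dots> = (\<Sum>j<L. real_of_int (h (int k, int j) - h (0, int j)))"
          using telescope_hz[OF nh, of 0 _ k] by (intro sum.cong refl) (simp flip: of_int_sum)
        finally show ?thesis .
      qed
      define P where "P = (\<Sum>j<L. ?p 0 j n)"
      define Q where "Q = (\<Sum>j<L. ?p (int k) j n)"
      have "real L * ?x n = (\<Sum>j<L. ?x n)" by simp
      \<comment> \<open>The detour number \<open>j\<close> goes up at abscissa 0, across at height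
        \<open>j\<close> and down at abscissa \<open>k\<close>; by exactness its total does not
        depend on \<open>j\<close>.\<close>
      also have "\<dots> = (\<Sum>j<L. ?p 0 j n + real_of_int (h (int k, int j) - h (0, int j)) - ?p (int k) j n)"
        unfolding X Pj by (intro sum.cong refl) simp
      also have "\<dots> = P + ?w n - Q"
        unfolding P_def Q_def W by (simp only: sum.distrib sum_subtractf)
      finally have Lx: "real L * ?x n = P + ?w n - Q" .
      have "(real L)\<^sup>2 * (?x n)\<^sup>2 = (P + ?w n - Q)\<^sup>2"
        unfolding Lx[symmetric] by (simp add: power_mult_distrib)
      also have "\<dots> \<le> 3 * (P\<^sup>2 + Q\<^sup>2 + (?w n)\<^sup>2)"
      proof -
        \<comment> \<open>The three squares add up to exactly the difference of the two
          sides.\<close>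
        have "0 \<le> (P - ?w n)\<^sup>2 + (P + Q)\<^sup>2 + (?w n + Q)\<^sup>2" by simp
        then show ?thesis by (simp add: power2_eq_square algebra_simps)
      qed
      also have "\<dots> \<le> 3 * (real L * (\<Sum>j<L. (?p 0 j n)\<^sup>2) + real L * (\<Sum>j<L. (?p (int k) j n)\<^sup>2) + (?w n)\<^sup>2)"
      proof -
        have "P\<^sup>2 \<le> real L * (\<Sum>j<L. (?p 0 j n)\<^sup>2)" "Q\<^sup>2 \<le> real L * (\<Sum>j<L. (?p (int k) j n)\<^sup>2)"
          unfolding P_def Q_def
          using sum_squared_le_sum_of_squares[of "\<lambda>j. ?p 0 j n" "{..<L}"]
            sum_squared_le_sum_of_squares[of "\<lambda>j. ?p (int k) j n" "{..<L}"]
          by (simp_all only: mult.commute card_lessThan)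
        then show ?thesis by simp
      qed
      also have "\<dots> = (real L)\<^sup>2 * ?R n"
        using L by (simp add: field_simps power2_eq_square)
      finally show ?case using L by (simp add: mult_le_cancel_left)
    qed
    have "G k = (\<integral>n. (?x n)\<^sup>2 \<partial>\<nu>)" by (rule hz_variance[symmetric])
    also have "\<dots> \<le> (\<integral>n. ?R n \<partial>\<nu>)"
      by (rule integral_mono_AE[OF ix iR le])
    also have "\<dots> = 3 / real L * ((\<Sum>j<L. G j) + (\<Sum>j<L. G j)) + 3 / (real L)\<^sup>2 * (\<integral>n. (?w n)\<^sup>2 \<partial>\<nu>)"
    proof -
      have "(\<integral>n. (\<Sum>j<L. (?p x j n)\<^sup>2) \<partial>\<nu>) = (\<Sum>j<L. G j)" for x
        by (subst Bochner_Integration.integral_sum) (rule ip, simp only: vt_variance)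
      moreover have iS: "integrable \<nu> (\<lambda>n. \<Sum>j<L. (?p x j n)\<^sup>2)" for x
        by (intro Bochner_Integration.integrable_sum ip)
      ultimately show ?thesis
        by (subst Bochner_Integration.integral_add)
          (simp_all only: iw iS Bochner_Integration.integral_add[OF iS iS] integral_mult_right_zero
            integrable_mult_right Bochner_Integration.integrable_add)
    qed
    also have "\<dots> \<le> 3 / real L * (real L * (C * real L) + real L * (C * real L)) + 3 / (real L)\<^sup>2 * (C * (real L * real k))"
    proof -
      have "(\<Sum>j<L. G j) \<le> (\<Sum>j<L. C * real L)" by (intro sum_mono Gj) simp
      then have "(\<Sum>j<L. G j) \<le> real L * (C * real L)" by simp
      moreover have "(\<integral>n. (?w n)\<^sup>2 \<partial>\<nu>) \<le> C * (real L * real k)"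
      proof -
        have "(\<integral>n. (?w n)\<^sup>2 \<partial>\<nu>) \<le> C2 * real (card ({..<L} \<times> {..<k}))"
          by (rule C2(2)[rule_format]) auto
        also have "\<dots> = C2 * (real L * real k)" by simp
        also have "\<dots> \<le> C * (real L * real k)" using C by (intro mult_right_mono) auto
        finally show ?thesis .
      qed
      ultimately show ?thesis by (intro add_mono mult_left_mono) auto
    qed
    also have "\<dots> = 3 * C * (2 * real L + real k / real L)"
      using L by (simp add: field_simps power2_eq_square)
    finally show ?thesis .
  qed
  show thesis
    by (rule that[of "3 * C"]) (use C(1) main in auto)
qed

text \<open>Reach \<open>v\<close> by a horizontal leg followed by a vertical one. Each leg has
  second moment \<open>G\<close>, and \<open>(a + b)^2 \<le> 2 * a^2 + 2 * b^2\<close> turns a bound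
  \<open>A\<close> on \<open>G\<close> into \<open>4 * A\<close>.\<close>

lemma height_variance_bounded:
  assumes sm: "summable (\<lambda>m. real (Suc m) * \<bar>two_point V \<mu> (Suc m)\<bar>)"
  shows "\<exists>B. \<forall>v. (\<integral>\<^sup>+ n. ennreal ((real_of_int (height_fun n v - height_fun n (0, 0)))\<^sup>2) \<partial>\<nu>) \<le> ennreal B"
proof -
  obtain C where C: "C \<ge> 0" "\<And>L k. L \<ge> 1 \<Longrightarrow> G k \<le> C * (2 * real L + real k / real L)"
    using G_upper by metis
  have "summable (\<lambda>m. real (Suc m) * \<bar>cor (Suc m)\<bar>)"
    using sm by (simp add: cor_two_point)
  from variance_bounded[of G cor, OF _ G_Suc G_nonneg C this]
  obtain A where A: "\<And>k. G k \<le> A" by (auto simp: G_def)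
  have "(\<integral>\<^sup>+ n. ennreal ((real_of_int (height_fun n v - height_fun n (0, 0)))\<^sup>2) \<partial>\<nu>) \<le> ennreal (4 * A)" for v
  proof -
    obtain x y where v: "v = (x, y)" by (cases v)
    \<comment> \<open>Starting at \<open>min x 0\<close> covers negative \<open>x\<close> as well:
      the leg then runs in the opposite direction, and the square removes the sign.\<close>
    let ?s = "\<lambda>n. \<Sum>i<nat \<bar>x\<bar>. real_of_int (n (hz (min x 0 + int i) 0))"
    let ?t = "\<lambda>n. \<Sum>i<nat \<bar>y\<bar>. real_of_int (n (vt x (min y 0 + int i)))"
    have iS: "integrable \<nu> (\<lambda>n. (?s n)\<^sup>2)" by (rule sq_sum(1)) simp_all
    have it: "integrable \<nu> (\<lambda>n. (?t n)\<^sup>2)" by (rule sq_sum(1)) simp_all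
    have "AE n in \<nu>. (real_of_int (height_fun n v - height_fun n (0, 0)))\<^sup>2 \<le> 2 * (?s n)\<^sup>2 + 2 * (?t n)\<^sup>2"
      using AE_exact
    proof eventually_elim
      case (elim n)
      define h where "h = height_fun n"
      have nh: "n = ext_d Z2 h" unfolding h_def by (rule height_fun_exact[OF elim])
      have S: "(?s n)\<^sup>2 = (real_of_int (h (x, 0) - h (0, 0)))\<^sup>2"
        using telescope_hz[OF nh, of "min x 0" 0 "nat \<bar>x\<bar>"]
        by (cases "x \<ge> 0") (simp_all add: min_def power2_commute flip: of_int_sum)
      have T: "(?t n)\<^sup>2 = (real_of_int (h (x, y) - h (x, 0)))\<^sup>2"
        using telescope_vt[OF nh, of x "min y 0" "nat \<bar>y\<bar>"]
        by (cases "y \<ge> 0") (simp_all add: min_def power2_commute flip: of_int_sum)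
      have "(a + b)\<^sup>2 \<le> 2 * a\<^sup>2 + 2 * b\<^sup>2" for a b :: real
        using zero_le_power2[of "a - b"] by (simp add: power2_eq_square algebra_simps)
      from this[of "real_of_int (h (x, 0) - h (0, 0))" "real_of_int (h (x, y) - h (x, 0))"]
      show ?case unfolding S T v h_def[symmetric] by simp
    qed
    then have "(\<integral>\<^sup>+ n. ennreal ((real_of_int (height_fun n v - height_fun n (0, 0)))\<^sup>2) \<partial>\<nu>) \<le>
        (\<integral>\<^sup>+ n. ennreal (2 * (?s n)\<^sup>2 + 2 * (?t n)\<^sup>2) \<partial>\<nu>)"
      by (intro nn_integral_mono_AE) (erule eventually_mono, erule ennreal_leI)
    also have "\<dots> = ennreal (\<integral>n. 2 * (?s n)\<^sup>2 + 2 * (?t n)\<^sup>2 \<partial>\<nu>)"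
      using iS it by (intro nn_integral_eq_integral) auto
    also have "(\<integral>n. 2 * (?s n)\<^sup>2 + 2 * (?t n)\<^sup>2 \<partial>\<nu>) = 2 * G (nat \<bar>x\<bar>) + 2 * G (nat \<bar>y\<bar>)"
      by (subst Bochner_Integration.integral_add)
        (simp_all only: integrable_mult_right iS it integral_mult_right_zero hz_variance vt_variance)
    also have "ennreal \<dots> \<le> ennreal (4 * A)"
      using A[of "nat \<bar>x\<bar>"] A[of "nat \<bar>y\<bar>"] by (intro ennreal_leI) linarith
    finally show ?thesis .
  qed
  then show ?thesis by blast
qed

end

text \<open>Half of the decay rate absorbs the linear weight, through
  \<open>y * exp (- 2 * y) \<le> exp (- y)\<close> with \<open>y\<close> equal to half the
  exponent.\<close>

lemma summable_exp_decay:
  fixes t :: "nat \<Rightarrow> real"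
  assumes c: "c > 0" and t: "\<And>i. \<bar>t i\<bar> \<le> C * exp (- c * real i)"
  shows "summable (\<lambda>i. real (Suc i) * \<bar>t (Suc i)\<bar>)"
proof (rule summable_comparison_test)
  have C: "C \<ge> 0" using t[of 0] by simp
  have "summable (\<lambda>i. (2 * C / c * exp (- (c / 2))) * exp (- (c / 2)) ^ i)"
    using c by (intro summable_mult summable_geometric) simp
  then show "summable (\<lambda>i. 2 * C / c * exp (- (c / 2) * real (Suc i)))"
    by (rule summable_cong[THEN iffD1, rotated])
      (auto simp: exp_of_nat_mult[symmetric] exp_add[symmetric] algebra_simps)
  show "\<exists>N. \<forall>i\<ge>N. norm (real (Suc i) * \<bar>t (Suc i)\<bar>) \<le> 2 * C / c * exp (- (c / 2) * real (Suc i))"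
  proof (intro exI allI impI)
    fix i :: nat
    define y where "y = c / 2 * real (Suc i)"
    have "y \<le> exp y" using exp_ge_add_one_self[of y] by linarith
    have "norm (real (Suc i) * \<bar>t (Suc i)\<bar>) = real (Suc i) * \<bar>t (Suc i)\<bar>" by (simp add: abs_mult)
    also have "\<dots> \<le> real (Suc i) * (C * exp (- c * real (Suc i)))"
      by (intro mult_left_mono t) simp
    also have "\<dots> = 2 * C / c * (y * exp (- 2 * y))"
      using c by (simp add: y_def)
    also have "\<dots> \<le> 2 * C / c * (exp y * exp (- 2 * y))"
      using \<open>y \<le> exp y\<close> C c by (intro mult_left_mono mult_right_mono) auto
    also have "exp y * exp (- 2 * y) = exp (- (c / 2) * real (Suc i))"
      by (simp add: y_def exp_add[symmetric])
    finally show "norm (real (Suc i) * \<bar>t (Suc i)\<bar>) \<le> 2 * C / c * exp (- (c / 2) * real (Suc i))" .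
  qed
qed

theorem theorem4p2:
  fixes V :: "int \<Rightarrow> ereal"
    and r :: "nat \<Rightarrow> nat"
    and \<mu> :: "(point \<times> point \<Rightarrow> complex) measure"
  assumes "height_potential V"
    and "strict_mono r"
    and "spin_limit V r \<mu>"
  shows "(\<exists>\<nu>. height_limit V r \<nu>) \<and>
    (\<forall>\<nu>. height_limit V r \<nu> \<longrightarrow>
       (SUP v. \<integral>\<^sup>+ n. ennreal ((real_of_int (height_fun n v - height_fun n (0, 0)))\<^sup>2) \<partial>\<nu>) = \<infinity> \<longrightarrow>
       (\<Sum>i. ennreal (real (Suc i) * \<bar>two_point V \<mu> (Suc i)\<bar>)) = \<infinity> \<and>
       \<not> (\<exists>C c. c > 0 \<and> (\<forall>i. \<bar>two_point V \<mu> i\<bar> \<le> C * exp (- c * real i))))"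
proof -
  interpret spin_lim V r \<mu>
    using assms by unfold_locales
  \<comment> \<open>Divergence of the series and failure of exponential decay both reduce to
    non-summability of the weighted two-point function.\<close>
  have main: "\<not> summable (\<lambda>i. real (Suc i) * \<bar>two_point V \<mu> (Suc i)\<bar>)"
    if \<nu>: "height_limit V r \<nu>"
      and sup: "(SUP v. \<integral>\<^sup>+ n. ennreal ((real_of_int (height_fun n v - height_fun n (0, 0)))\<^sup>2) \<partial>\<nu>) = \<infinity>" for \<nu>
  proof
    assume sm: "summable (\<lambda>i. real (Suc i) * \<bar>two_point V \<mu> (Suc i)\<bar>)"
    interpret height_lim V r \<mu> \<nu>
      using \<nu> by unfold_locales
    obtain B where "\<And>v. (\<integral>\<^sup>+ n. ennreal ((real_of_int (height_fun n v - height_fun n (0, 0)))\<^sup>2) \<partial>\<nu>) \<le> ennreal B"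
      using height_variance_bounded[OF sm] by blast
    then have "(SUP v. \<integral>\<^sup>+ n. ennreal ((real_of_int (height_fun n v - height_fun n (0, 0)))\<^sup>2) \<partial>\<nu>) \<le> ennreal B"
      by (intro SUP_least)
    with sup have "(\<infinity> :: ennreal) \<le> ennreal B" by (simp only:)
    then show False by (simp add: top_unique)
  qed
  show ?thesis
  proof (intro conjI allI impI ex_height_limit notI)
    fix \<nu> assume \<nu>: "height_limit V r \<nu>"
      and sup: "(SUP v. \<integral>\<^sup>+ n. ennreal ((real_of_int (height_fun n v - height_fun n (0, 0)))\<^sup>2) \<partial>\<nu>) = \<infinity>"
    show "(\<Sum>i. ennreal (real (Suc i) * \<bar>two_point V \<mu> (Suc i)\<bar>)) = \<infinity>"
    proof (rule ccontr)
      assume "(\<Sum>i. ennreal (real (Suc i) * \<bar>two_point V \<mu> (Suc i)\<bar>)) \<noteq> \<infinity>"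
      then have "summable (\<lambda>i. real (Suc i) * \<bar>two_point V \<mu> (Suc i)\<bar>)"
        by (intro summable_suminf_not_top) simp_all
      then show False using main[OF \<nu> sup] by contradiction
    qed
    assume "\<exists>C c. c > 0 \<and> (\<forall>i. \<bar>two_point V \<mu> i\<bar> \<le> C * exp (- c * real i))"
    then obtain C c where "c > 0" "\<And>i. \<bar>two_point V \<mu> i\<bar> \<le> C * exp (- c * real i)" by blast
    then have "summable (\<lambda>i. real (Suc i) * \<bar>two_point V \<mu> (Suc i)\<bar>)"
      by (rule summable_exp_decay)
    then show False using main[OF \<nu> sup] by contradiction
  qed
qed

end
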